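(* Suppose for some constant $c > 0$ that we can solve dynamic / incremental / decremental $O(n^c)$-approximate graph HAC under complete linkage or under weighted average linkage in $p(m,n)$ preprocessing work, $u(m,n)$ update work, and $q(m,n)$ query work. Then we can solve dynamic / decremental / incremental SubConn (respectively) with $\tilde{O}(m) + p(\tilde{O}(m),\tilde{O}(n))$ preprocessing work, $u(\tilde{O}(m),\tilde{O}(n))$ update work, and $q(\tilde{O}(m),\tilde{O}(n))$ query work. The same relationship also holds between \#HAC and ConnSub.
   Context: Graph HAC: the input is an undirected graph $G=(V,E)$ ($n$ vertices, $m$ edges) with edge weights (similarities) $w$. Initially every vertex is its own cluster; two clusters are adjacent if some edge crosses between them, and the similarity $\mathcal{W}$ of adjacent clusters is given by a linkage function. HAC repeatedly merges the two adjacent clusters of highest similarity. Complete linkage: $\mathcal{W}(X,Y)$ is the minimum weight of an edge between $X$ and $Y$. Weighted average linkage: if cluster $Z$ is formed by merging $X$ and $Y$, its similarity to an adjacent cluster $U$ is $(\mathcal{W}(X,U)+\mathcal{W}(Y,U))/2$ if both $X$ and $Y$ are adjacent to $U$, and otherwise equals the similarity of the one that is adjacent. $\lambda$-approximate HAC ($\lambda\ge 1$, $\lambda \le \mathrm{poly}(n)$): at a step where the maximum similarity is $\mathcal{W}_{\max}$, any two adjacent clusters with similarity at least $\mathcal{W}_{\max}/\lambda$ may be merged. Dynamic (resp. incremental, decremental) HAC: the graph undergoes edge insertions and deletions (resp. only insertions, only deletions), and a query, given vertices $s,t$ and a threshold $\theta$, answers whether $s$ and $t$ are in the same cluster if agglomerative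 clustering is run until all cluster similarities are strictly below $\theta$. \#HAC is the same, except the query, given $\theta$, answers the number of clusters at that point. SubConn: given an undirected graph $G=(V,E)$, maintain a subset $S\subseteq V$ under insertions and deletions of vertices into $S$ (incremental: only insertions; decremental: only deletions), answering queries of whether given vertices $s,t$ are connected in the subgraph induced by $S$. ConnSub: the same, but the query asks whether the subgraph induced by $S$ is connected. $\tilde{O}$ hides polylogarithmic factors. *)

theory Defs
  imports "HOL-Library.Landau_Symbols"
begin

section \<open>Model of computation: a word RAM\<close>

text \<open>
  Work is the number of instructions executed by a fixed program on a word RAM with \<open>w\<close>-bit
  words. The memory is presented as a family of unbounded arrays; a program, being a finite
  term, only mentions finitely many of them, so that interleaving the arrays in one address
  space changes addresses by a constant factor only. Scalars are arrays accessed at a constant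
  index.
\<close>

type_synonym mem = "nat \<Rightarrow> nat \<Rightarrow> nat"

datatype binop = Add | Sub | Mul | Div | Mod | BAnd | BOr | BXor | Shl | Shr | Lt | Eq

datatype expr = Const nat | Read nat expr | Op binop expr expr

datatype prog =
    Skip
  | Write nat expr expr  \<comment> \<open>array, index, new contents\<close>
  | Seq prog prog
  | Cond expr prog prog
  | While expr prog

text \<open>Results are later reduced modulo \<open>2 ^ w\<close>. On words \<open>y < 2 ^ w\<close>, so \<open>Sub\<close> wraps around.\<close>

fun op_val :: "nat \<Rightarrow> binop \<Rightarrow> nat \<Rightarrow> nat \<Rightarrow> nat" where
  "op_val w Add x y = x + y"
| "op_val w Sub x y = x + 2 ^ w - y"
| "op_val w Mul x y = x * y"
| "op_val w Div x y = x div y"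
| "op_val w Mod x y = x mod y"
| "op_val w BAnd x y = Bit_Operations.and x y"
| "op_val w BOr x y = Bit_Operations.or x y"
| "op_val w BXor x y = Bit_Operations.xor x y"
| "op_val w Shl x y = push_bit y x"
| "op_val w Shr x y = drop_bit y x"
| "op_val w Lt x y = of_bool (x < y)"
| "op_val w Eq x y = of_bool (x = y)"

fun expr_val :: "nat \<Rightarrow> expr \<Rightarrow> mem \<Rightarrow> nat" where
  "expr_val w (Const c) M = c mod 2 ^ w"
| "expr_val w (Read a e) M = M a (expr_val w e M)"
| "expr_val w (Op f e e') M = op_val w f (expr_val w e M) (expr_val w e' M) mod 2 ^ w"

text \<open>
  \<open>exec w P M t M'\<close>: on \<open>w\<close>-bit words, program \<open>P\<close> started in memory \<open>M\<close> halts in memory \<open>M'\<close>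
  after work \<open>t\<close>. An expression is charged one unit; it has constant size, since programs are
  fixed, so this is work up to a constant factor.
\<close>

inductive exec :: "nat \<Rightarrow> prog \<Rightarrow> mem \<Rightarrow> nat \<Rightarrow> mem \<Rightarrow> bool" for w where
  Skip: "exec w Skip M 1 M"
| Write: "exec w (Write a i e) M 1 (M(a := (M a)(expr_val w i M := expr_val w e M)))"
| Seq: "exec w P M t M' \<Longrightarrow> exec w Q M' t' M'' \<Longrightarrow> exec w (Seq P Q) M (t + t') M''"
| CondT: "expr_val w b M \<noteq> 0 \<Longrightarrow> exec w P M t M' \<Longrightarrow> exec w (Cond b P Q) M (1 + t) M'"
| CondF: "expr_val w b M = 0 \<Longrightarrow> exec w Q M t M' \<Longrightarrow> exec w (Cond b P Q) M (1 + t) M'"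
| WhileT: "expr_val w b M \<noteq> 0 \<Longrightarrow> exec w P M t M' \<Longrightarrow> exec w (While b P) M' t' M''
    \<Longrightarrow> exec w (While b P) M (1 + t + t') M''"
| WhileF: "expr_val w b M = 0 \<Longrightarrow> exec w (While b P) M 1 M"

text \<open>Arrays used for communication with the outside.\<close>

abbreviation "header_arr \<equiv> 0 :: nat"
abbreviation "fst_end_arr \<equiv> 1 :: nat"
abbreviation "snd_end_arr \<equiv> 2 :: nat"
abbreviation "data_arr \<equiv> 3 :: nat"
abbreviation "args_arr \<equiv> 4 :: nat"
abbreviation "result_arr \<equiv> 5 :: nat"

definition array_of :: "nat list \<Rightarrow> nat \<Rightarrow> nat" where
  "array_of xs i = (if i < length xs then xs ! i else 0)"

definition put_args :: "nat list \<Rightarrow> mem \<Rightarrow> mem" where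
  "put_args xs M = M(args_arr := (\<lambda>i. if i < length xs then xs ! i else M args_arr i))"

text \<open>Edge lists: every edge once, in arbitrary order and orientation.\<close>

definition edge_list :: "(nat \<times> nat) list \<Rightarrow> nat set set \<Rightarrow> bool" where
  "edge_list es E \<longleftrightarrow> distinct (map (\<lambda>(u, v). {u, v}) es) \<and> set (map (\<lambda>(u, v). {u, v}) es) = E"

definition input_mem :: "nat list \<Rightarrow> (nat \<times> nat) list \<Rightarrow> nat list \<Rightarrow> mem" where
  "input_mem hs es xs = (\<lambda>_ _. 0)
     (header_arr := array_of hs, fst_end_arr := array_of (map fst es),
      snd_end_arr := array_of (map snd es), data_arr := array_of xs)"


section \<open>Dynamic problems and their solutions\<close>

record ('s, 'u, 'q) dyn_problem =
  verts :: "'s \<Rightarrow> nat"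
  edges :: "'s \<Rightarrow> nat"
  input :: "'s \<Rightarrow> mem \<Rightarrow> bool"  \<comment> \<open>legal initial objects and their encodings\<close>
  update :: "'s \<Rightarrow> 'u \<Rightarrow> 's \<Rightarrow> bool"
  update_args :: "'u \<Rightarrow> nat list"
  legal_query :: "'s \<Rightarrow> 'q \<Rightarrow> bool"
  query_args :: "'q \<Rightarrow> nat list"
  answer :: "'s \<Rightarrow> 'q \<Rightarrow> nat \<Rightarrow> bool"  \<comment> \<open>acceptable answers\<close>

text \<open>
  Words have at least \<open>a \<cdot> log (n + x)\<close> bits for every number \<open>x\<close> in the input, where the
  constant \<open>a\<close> may depend on the algorithm.
\<close>

definition fits :: "nat \<Rightarrow> nat \<Rightarrow> nat \<Rightarrow> nat \<Rightarrow> bool" where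
  "fits a w n x \<longleftrightarrow> (n + x + 2) ^ a \<le> 2 ^ w"

definition initial :: "('s, 'u, 'q) dyn_problem \<Rightarrow> nat \<Rightarrow> nat \<Rightarrow> 's \<Rightarrow> mem \<Rightarrow> bool" where
  "initial \<Pi> a w s M \<longleftrightarrow> input \<Pi> s M \<and> (\<forall>b i. fits a w (verts \<Pi> s) (M b i))"

definition can_update ::
  "('s, 'u, 'q) dyn_problem \<Rightarrow> nat \<Rightarrow> nat \<Rightarrow> 's \<Rightarrow> 'u \<Rightarrow> 's \<Rightarrow> bool" where
  "can_update \<Pi> a w s x s' \<longleftrightarrow>
     update \<Pi> s x s' \<and> (\<forall>y \<in> set (update_args \<Pi> x). fits a w (verts \<Pi> s) y)"

definition can_query :: "('s, 'u, 'q) dyn_problem \<Rightarrow> nat \<Rightarrow> nat \<Rightarrow> 's \<Rightarrow> 'q \<Rightarrow> bool" where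
  "can_query \<Pi> a w s x \<longleftrightarrow>
     legal_query \<Pi> s x \<and> (\<forall>y \<in> set (query_args \<Pi> x). fits a w (verts \<Pi> s) y)"

text \<open>
  The current object and the memory contents after some sequence of legal operations; \<open>Pre\<close>,
  \<open>Upd\<close> and \<open>Qry\<close> are the preprocessing, update and query programs.
\<close>

inductive reachable ::
  "('s, 'u, 'q) dyn_problem \<Rightarrow> nat \<Rightarrow> nat \<Rightarrow> prog \<Rightarrow> prog \<Rightarrow> prog \<Rightarrow> 's \<Rightarrow> mem \<Rightarrow> bool"
  for \<Pi> a w Pre Upd Qry where
  preprocess: "initial \<Pi> a w s M \<Longrightarrow> exec w Pre M t M' \<Longrightarrow> reachable \<Pi> a w Pre Upd Qry s M'"
| update: "reachable \<Pi> a w Pre Upd Qry s M \<Longrightarrow> can_update \<Pi> a w s x s'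
    \<Longrightarrow> exec w Upd (put_args (update_args \<Pi> x) M) t M' \<Longrightarrow> reachable \<Pi> a w Pre Upd Qry s' M'"
| query: "reachable \<Pi> a w Pre Upd Qry s M \<Longrightarrow> can_query \<Pi> a w s x
    \<Longrightarrow> exec w Qry (put_args (query_args \<Pi> x) M) t M' \<Longrightarrow> reachable \<Pi> a w Pre Upd Qry s M'"

text \<open>Worst-case bounds in terms of the current numbers \<open>m\<close> of edges and \<open>n\<close> of vertices.\<close>

definition solvable :: "('s, 'u, 'q) dyn_problem \<Rightarrow>
    (nat \<Rightarrow> nat \<Rightarrow> real) \<Rightarrow> (nat \<Rightarrow> nat \<Rightarrow> real) \<Rightarrow> (nat \<Rightarrow> nat \<Rightarrow> real) \<Rightarrow> bool" where
  "solvable \<Pi> p u q \<longleftrightarrow> (\<exists>Pre Upd Qry. \<exists>a > 0. \<forall>w.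
     (\<forall>s M. initial \<Pi> a w s M \<longrightarrow>
        (\<exists>t M'. exec w Pre M t M' \<and> real t \<le> p (edges \<Pi> s) (verts \<Pi> s))) \<and>
     (\<forall>s M x s'. reachable \<Pi> a w Pre Upd Qry s M \<and> can_update \<Pi> a w s x s' \<longrightarrow>
        (\<exists>t M'. exec w Upd (put_args (update_args \<Pi> x) M) t M' \<and>
           real t \<le> u (edges \<Pi> s) (verts \<Pi> s))) \<and>
     (\<forall>s M x. reachable \<Pi> a w Pre Upd Qry s M \<and> can_query \<Pi> a w s x \<longrightarrow>
        (\<exists>t M'. exec w Qry (put_args (query_args \<Pi> x) M) t M' \<and>
           real t \<le> q (edges \<Pi> s) (verts \<Pi> s) \<and> answer \<Pi> s x (M' result_arr 0))))"


section \<open>Bounds in \<open>m\<close> and \<open>n\<close>\<close>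

text \<open>
  Soft-O for functions of \<open>m\<close> and \<open>n\<close>; polylogarithmic means polylogarithmic in \<open>n\<close>, which for
  graphs is the same as in \<open>m + n\<close>. The maximum with 1 only concerns \<open>m = 0\<close> and \<open>n = 0\<close>, where
  a literal bound of 0 would be void.
\<close>

definition soft_O :: "(nat \<Rightarrow> nat \<Rightarrow> real) \<Rightarrow> (nat \<Rightarrow> nat \<Rightarrow> real) set" where
  "soft_O g = {f. \<exists>C > 0. \<exists>k :: nat. \<forall>m n. f m n \<le> C * max 1 (g m n) * log 2 (real n + 2) ^ k}"

text \<open>Functions bounded by \<open>f (soft_O m) (soft_O n)\<close>, up to a constant factor.\<close>

definition soft_comp :: "(nat \<Rightarrow> nat \<Rightarrow> real) \<Rightarrow> (nat \<Rightarrow> nat \<Rightarrow> real) set" where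
  "soft_comp f = {h. \<exists>\<mu> \<nu> :: nat \<Rightarrow> nat \<Rightarrow> nat.
     (\<lambda>m n. real (\<mu> m n)) \<in> soft_O (\<lambda>m n. real m) \<and>
     (\<lambda>m n. real (\<nu> m n)) \<in> soft_O (\<lambda>m n. real n) \<and>
     (\<exists>C > 0. \<forall>m n. h m n \<le> C * f (\<mu> m n) (\<nu> m n))}"

definition soft_m_plus_comp :: "(nat \<Rightarrow> nat \<Rightarrow> real) \<Rightarrow> (nat \<Rightarrow> nat \<Rightarrow> real) set" where
  "soft_m_plus_comp f = {h. \<exists>h1 \<in> soft_O (\<lambda>m n. real m). \<exists>h2 \<in> soft_comp f.
     \<forall>m n. h m n \<le> h1 m n + h2 m n}"


section \<open>Graph HAC\<close>

datatype dyn_mode = Dynamic | Incremental | Decremental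

fun dual_mode :: "dyn_mode \<Rightarrow> dyn_mode" where
  "dual_mode Dynamic = Dynamic"
| "dual_mode Incremental = Decremental"
| "dual_mode Decremental = Incremental"

text \<open>All graphs have vertex set \<open>{..<n}\<close>, and edges are two-element sets.\<close>

definition all_edges :: "nat \<Rightarrow> nat set set" where
  "all_edges n = {{u, v} | u v. u < n \<and> v < n \<and> u \<noteq> v}"

record wgraph =
  size_V :: nat
  weight :: "nat set \<rightharpoonup> nat"  \<comment> \<open>defined on the edges\<close>

definition wgraph_ok :: "wgraph \<Rightarrow> bool" where
  "wgraph_ok G \<longleftrightarrow> dom (weight G) \<subseteq> all_edges (size_V G) \<and> (\<forall>x \<in> ran (weight G). x > 0)"

definition crossing :: "wgraph \<Rightarrow> nat set \<Rightarrow> nat set \<Rightarrow> nat set set" where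
  "crossing G X Y = {e \<in> dom (weight G). \<exists>x \<in> X. \<exists>y \<in> Y. e = {x, y}}"

definition adjacent :: "wgraph \<Rightarrow> nat set \<Rightarrow> nat set \<Rightarrow> bool" where
  "adjacent G X Y \<longleftrightarrow> crossing G X Y \<noteq> {}"

datatype linkage = Complete | Weighted_Average

text \<open>Similarity functions; their values matter for distinct adjacent clusters only.\<close>

type_synonym sim = "nat set \<Rightarrow> nat set \<Rightarrow> real"

definition min_sim :: "wgraph \<Rightarrow> sim" where
  "min_sim G X Y = Min ((\<lambda>e. real (the (weight G e))) ` crossing G X Y)"

definition average_sim :: "wgraph \<Rightarrow> sim \<Rightarrow> nat set \<Rightarrow> nat set \<Rightarrow> nat set \<Rightarrow> real" where
  "average_sim G W X Y U =
     (if adjacent G X U \<and> adjacent G Y U then (W X U + W Y U) / 2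
      else if adjacent G X U then W X U else W Y U)"

text \<open>The similarities after merging \<open>X\<close> and \<open>Y\<close>.\<close>

fun merge_sim :: "linkage \<Rightarrow> wgraph \<Rightarrow> nat set \<Rightarrow> nat set \<Rightarrow> sim \<Rightarrow> sim" where
  "merge_sim Complete G X Y W = min_sim G"
| "merge_sim Weighted_Average G X Y W = (\<lambda>A B.
     if A = X \<union> Y then average_sim G W X Y B
     else if B = X \<union> Y then average_sim G W X Y A
     else W A B)"

definition similarities :: "wgraph \<Rightarrow> nat set set \<Rightarrow> sim \<Rightarrow> real set" where
  "similarities G \<C> W = {W X Y | X Y. X \<in> \<C> \<and> Y \<in> \<C> \<and> X \<noteq> Y \<and> adjacent G X Y}"

text \<open>
  The clusterings (with their similarities) that \<open>\<lambda>\<close>-approximate HAC may go through while some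
  similarity is at least \<open>\<theta>\<close>. Initially all clusters are singletons, and \<open>min_sim\<close> between two
  of them is the weight of the edge joining them.
\<close>

inductive hac_run :: "linkage \<Rightarrow> real \<Rightarrow> wgraph \<Rightarrow> real \<Rightarrow> nat set set \<Rightarrow> sim \<Rightarrow> bool"
  for L lam G \<theta> where
  start: "hac_run L lam G \<theta> ((\<lambda>v. {v}) ` {..<size_V G}) (min_sim G)"
| merge: "hac_run L lam G \<theta> \<C> W \<Longrightarrow> \<exists>x \<in> similarities G \<C> W. x \<ge> \<theta>
    \<Longrightarrow> X \<in> \<C> \<Longrightarrow> Y \<in> \<C> \<Longrightarrow> X \<noteq> Y \<Longrightarrow> adjacent G X Y
    \<Longrightarrow> W X Y \<ge> Max (similarities G \<C> W) / lam
    \<Longrightarrow> hac_run L lam G \<theta> (insert (X \<union> Y) (\<C> - {X, Y})) (merge_sim L G X Y W)"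

definition hac_result :: "linkage \<Rightarrow> real \<Rightarrow> wgraph \<Rightarrow> real \<Rightarrow> nat set set \<Rightarrow> bool" where
  "hac_result L lam G \<theta> \<C> \<longleftrightarrow>
     (\<exists>W. hac_run L lam G \<theta> \<C> W \<and> (\<forall>x \<in> similarities G \<C> W. x < \<theta>))"

datatype edge_update = InsertE nat nat nat | DeleteE nat nat

fun edge_update_args :: "edge_update \<Rightarrow> nat list" where
  "edge_update_args (InsertE u v x) = [1, u, v, x]"
| "edge_update_args (DeleteE u v) = [0, u, v]"

inductive edge_step :: "dyn_mode \<Rightarrow> wgraph \<Rightarrow> edge_update \<Rightarrow> wgraph \<Rightarrow> bool" for D G where
  "D \<noteq> Decremental \<Longrightarrow> {u, v} \<in> all_edges (size_V G) \<Longrightarrow> {u, v} \<notin> dom (weight G) \<Longrightarrow> x > 0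
    \<Longrightarrow> edge_step D G (InsertE u v x) (G\<lparr>weight := (weight G)({u, v} \<mapsto> x)\<rparr>)"
| "D \<noteq> Incremental \<Longrightarrow> {u, v} \<in> dom (weight G)
    \<Longrightarrow> edge_step D G (DeleteE u v) (G\<lparr>weight := (weight G)({u, v} := None)\<rparr>)"

definition wgraph_input :: "wgraph \<Rightarrow> mem \<Rightarrow> bool" where
  "wgraph_input G M \<longleftrightarrow> wgraph_ok G \<and> (\<exists>es. edge_list es (dom (weight G)) \<and>
     M = input_mem [size_V G, length es] es (map (\<lambda>(u, v). the (weight G {u, v})) es))"

text \<open>
  The approximation factor \<open>lam n\<close> depends on the number of vertices. An answer is acceptable if
  it is the one given by some \<open>lam n\<close>-approximate run; different queries may refer to different
  runs.
\<close>

definition HAC :: "linkage \<Rightarrow> (nat \<Rightarrow> real) \<Rightarrow> dyn_mode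
    \<Rightarrow> (wgraph, edge_update, nat \<times> nat \<times> nat) dyn_problem" where
  "HAC L lam D = \<lparr>
     verts = size_V, edges = (\<lambda>G. card (dom (weight G))), input = wgraph_input,
     update = edge_step D, update_args = edge_update_args,
     legal_query = (\<lambda>G (s, t, \<theta>). s < size_V G \<and> t < size_V G),
     query_args = (\<lambda>(s, t, \<theta>). [s, t, \<theta>]),
     answer = (\<lambda>G (s, t, \<theta>) r. \<exists>\<C>. hac_result L (lam (size_V G)) G (real \<theta>) \<C> \<and>
       r = of_bool (\<exists>X \<in> \<C>. s \<in> X \<and> t \<in> X)) \<rparr>"

definition Num_HAC :: "linkage \<Rightarrow> (nat \<Rightarrow> real) \<Rightarrow> dyn_mode
    \<Rightarrow> (wgraph, edge_update, nat) dyn_problem" where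
  "Num_HAC L lam D = \<lparr>
     verts = size_V, edges = (\<lambda>G. card (dom (weight G))), input = wgraph_input,
     update = edge_step D, update_args = edge_update_args,
     legal_query = (\<lambda>G \<theta>. True), query_args = (\<lambda>\<theta>. [\<theta>]),
     answer = (\<lambda>G \<theta> r. \<exists>\<C>. hac_result L (lam (size_V G)) G (real \<theta>) \<C> \<and> r = card \<C>) \<rparr>"


section \<open>Subgraph connectivity\<close>

record vsubgraph =
  sg_n :: nat
  sg_E :: "nat set set"
  sg_S :: "nat set"

definition induced_adj :: "vsubgraph \<Rightarrow> (nat \<times> nat) set" where
  "induced_adj G = {(u, v). u \<in> sg_S G \<and> v \<in> sg_S G \<and> {u, v} \<in> sg_E G}"

definition connected_in :: "vsubgraph \<Rightarrow> nat \<Rightarrow> nat \<Rightarrow> bool" where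
  "connected_in G s t \<longleftrightarrow> s \<in> sg_S G \<and> t \<in> sg_S G \<and> (s, t) \<in> (induced_adj G)\<^sup>*"

text \<open>The empty graph counts as connected.\<close>

definition induced_connected :: "vsubgraph \<Rightarrow> bool" where
  "induced_connected G \<longleftrightarrow> (\<forall>s \<in> sg_S G. \<forall>t \<in> sg_S G. connected_in G s t)"

datatype vertex_update = InsertV nat | DeleteV nat

fun vertex_update_args :: "vertex_update \<Rightarrow> nat list" where
  "vertex_update_args (InsertV v) = [1, v]"
| "vertex_update_args (DeleteV v) = [0, v]"

inductive vertex_step :: "dyn_mode \<Rightarrow> vsubgraph \<Rightarrow> vertex_update \<Rightarrow> vsubgraph \<Rightarrow> bool"
  for D G where
  "D \<noteq> Decremental \<Longrightarrow> v < sg_n G \<Longrightarrow> v \<notin> sg_S G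
    \<Longrightarrow> vertex_step D G (InsertV v) (G\<lparr>sg_S := insert v (sg_S G)\<rparr>)"
| "D \<noteq> Incremental \<Longrightarrow> v \<in> sg_S G
    \<Longrightarrow> vertex_step D G (DeleteV v) (G\<lparr>sg_S := sg_S G - {v}\<rparr>)"

text \<open>
  The initial \<open>S\<close> is arbitrary. It is given by its size and its characteristic array, which need
  not be read completely, so that even preprocessing sublinear in \<open>n\<close> makes sense.
\<close>

definition vsubgraph_input :: "vsubgraph \<Rightarrow> mem \<Rightarrow> bool" where
  "vsubgraph_input G M \<longleftrightarrow> sg_E G \<subseteq> all_edges (sg_n G) \<and> sg_S G \<subseteq> {..<sg_n G} \<and>
     (\<exists>es. edge_list es (sg_E G) \<and>
       M = input_mem [sg_n G, length es, card (sg_S G)] es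
             (map (\<lambda>v. of_bool (v \<in> sg_S G)) [0..<sg_n G]))"

definition SubConn :: "dyn_mode \<Rightarrow> (vsubgraph, vertex_update, nat \<times> nat) dyn_problem" where
  "SubConn D = \<lparr>
     verts = sg_n, edges = (\<lambda>G. card (sg_E G)), input = vsubgraph_input,
     update = vertex_step D, update_args = vertex_update_args,
     legal_query = (\<lambda>G (s, t). s < sg_n G \<and> t < sg_n G), query_args = (\<lambda>(s, t). [s, t]),
     answer = (\<lambda>G (s, t) r. r = of_bool (connected_in G s t)) \<rparr>"

definition ConnSub :: "dyn_mode \<Rightarrow> (vsubgraph, vertex_update, unit) dyn_problem" where
  "ConnSub D = \<lparr>
     verts = sg_n, edges = (\<lambda>G. card (sg_E G)), input = vsubgraph_input,
     update = vertex_step D, update_args = vertex_update_args,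
     legal_query = (\<lambda>G _. True), query_args = (\<lambda>_. []),
     answer = (\<lambda>G _ r. r = of_bool (induced_connected G)) \<rparr>"

end

theory Submission
  imports Defs
begin

text \<open>
  Attach to every non-isolated vertex \<open>v\<close> a star with \<open>k = O(log n)\<close> leaves, join its centre and
  its leaves to the neighbours of \<open>v\<close> by edges of weight 1, and let the given edges have weight
  \<open>2 ^ k\<close>, the star edges weight \<open>4 ^ k\<close>, and the edge between \<open>v\<close> and its centre, which is present
  only if \<open>v\<close> is not in \<open>S\<close>, weight \<open>8 ^ k\<close>. As \<open>2 ^ k\<close> exceeds \<open>\<lambda>\<close>, a vertex outside \<open>S\<close> first joins its
  centre and then all leaves, and every leaf halves its similarity to the neighbours (up to an
  additive constant); under complete linkage the first light edge already has this effect.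
  So vertices outside \<open>S\<close> drop out, and clustering down to \<open>2 ^ k\<close> yields the components of the
  subgraph induced by \<open>S\<close> plus a known number of other clusters. A change of \<open>S\<close> is the insertion
  or deletion of a single edge, which is why insertions and deletions trade places.
\<close>

section \<open>Agglomerative clustering in general\<close>

text \<open>The light edges are what makes a merge costly: under weighted average linkage a
  similarity keeps its value if only one of the merged clusters sees the third one, so every centre
  and leaf must see all neighbours of \<open>v\<close>. Once the column of \<open>v\<close> is
  complete, the excess over 1 is \<open>2 * 2 ^ k / 2 ^ (k + 2) = 1 / 2\<close>, whereas a merge at
  maximum similarity at least \<open>2 ^ k\<close> needs similarity at least
  \<open>2 ^ k / lam > 2\<close>. For \<open>v\<close> in \<open>S\<close> the star becomes a
  cluster of its own, which only light edges leave. The difficulty is that an approximate run may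
  choose among many merges and interleave the work on different vertices. The proof therefore
  follows no particular run but maintains invariants of every intermediate clustering, using only
  bounds common to both linkages. The choice of \<open>k\<close> is circular, since
  \<open>lam\<close> is taken at the size \<open>(k + 2) * n\<close> of the gadget graph. Skipping
  isolated vertices keeps the reduction's own work near-linear in \<open>m\<close>, but makes the
  number of clusters avoiding \<open>S\<close> depend on the isolated members of \<open>S\<close>;
  hence the running target kept for the counting query.\<close>

lemma adjacent_iff:
  "adjacent G X Y \<longleftrightarrow> (\<exists>x \<in> X. \<exists>y \<in> Y. {x, y} \<in> dom (weight G))"
  by (auto simp: adjacent_def crossing_def)

lemma crossing_commute: "crossing G X Y = crossing G Y X"
  unfolding crossing_def by (metis insert_commute)

lemma adjacent_commute: "adjacent G X Y = adjacent G Y X"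
  by (simp add: adjacent_def crossing_commute)

lemma min_sim_commute: "min_sim G X Y = min_sim G Y X"
  by (simp add: min_sim_def crossing_commute)

lemma crossing_Un: "crossing G (X \<union> Y) U = crossing G X U \<union> crossing G Y U"
  by (auto simp: crossing_def)

lemma adjacent_Un: "adjacent G (X \<union> Y) U \<longleftrightarrow> adjacent G X U \<or> adjacent G Y U"
  by (simp add: adjacent_def crossing_Un)

definition is_partition :: "nat \<Rightarrow> nat set set \<Rightarrow> bool" where
  "is_partition N \<C> \<longleftrightarrow> \<Union>\<C> = {..<N} \<and> {} \<notin> \<C> \<and> (\<forall>A \<in> \<C>. \<forall>B \<in> \<C>. A \<noteq> B \<longrightarrow> A \<inter> B = {})"

lemma is_partition_finite: "is_partition N \<C> \<Longrightarrow> finite \<C>"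
  by (metis is_partition_def finite_UnionD finite_lessThan)

lemma is_partition_cover:
  assumes "is_partition N \<C>" "x < N"
  obtains X where "X \<in> \<C>" "x \<in> X"
  using assms unfolding is_partition_def by blast

lemma is_partition_unique:
  "is_partition N \<C> \<Longrightarrow> A \<in> \<C> \<Longrightarrow> B \<in> \<C> \<Longrightarrow> x \<in> A \<Longrightarrow> x \<in> B \<Longrightarrow> A = B"
  unfolding is_partition_def by blast

lemma is_partition_finite_cluster: "is_partition N \<C> \<Longrightarrow> A \<in> \<C> \<Longrightarrow> finite A"
  unfolding is_partition_def by (metis Union_upper finite_lessThan finite_subset)

text \<open>Ensures that the test \<open>A = X \<union> Y\<close> in \<open>merge_sim\<close> never
  fires for a surviving cluster: an element of each part would force both parts to equal
  \<open>A\<close>.\<close>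

lemma is_partition_merge_new:
  assumes P: "is_partition N \<C>" and "X \<in> \<C>" "Y \<in> \<C>" "X \<noteq> Y" "A \<in> \<C>"
  shows "A \<noteq> X \<union> Y"
proof
  assume A: "A = X \<union> Y"
  obtain x y where "x \<in> X" "y \<in> Y"
    using assms unfolding is_partition_def by (metis ex_in_conv)
  then have "X = A" "Y = A"
    using is_partition_unique[OF P] assms A by blast+
  then show False using assms by blast
qed

lemma is_partition_merge:
  assumes P: "is_partition N \<C>" and XY: "X \<in> \<C>" "Y \<in> \<C>"
  shows "is_partition N (insert (X \<union> Y) (\<C> - {X, Y}))"
proof -
  have "\<Union>(insert (X \<union> Y) (\<C> - {X, Y})) = \<Union>\<C>"
    using XY by blast
  moreover have "A \<inter> (X \<union> Y) = {}" if "A \<in> \<C> - {X, Y}" for A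
    using is_partition_unique[OF P] XY that by blast
  moreover have "A \<inter> B = {}" if "A \<in> \<C>" "B \<in> \<C>" "A \<noteq> B" for A B
    using is_partition_unique[OF P] that by blast
  moreover have "X \<noteq> {}" "{} \<notin> \<C>" "\<Union>\<C> = {..<N}"
    using P XY unfolding is_partition_def by auto
  ultimately show ?thesis
    unfolding is_partition_def by (simp add: Int_commute)
qed

text \<open>What the two linkage functions have in common; the argument needs nothing else.\<close>

definition merge_bounds ::
  "wgraph \<Rightarrow> nat set set \<Rightarrow> nat set \<Rightarrow> nat set \<Rightarrow> sim \<Rightarrow> sim \<Rightarrow> bool" where
  "merge_bounds G \<C> X Y W W' \<longleftrightarrow>
     (\<forall>A \<in> \<C> - {X, Y}. \<forall>B \<in> \<C> - {X, Y}. W' A B = W A B) \<and>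
     (\<forall>U \<in> \<C> - {X, Y}.
        (adjacent G X U \<and> adjacent G Y U \<longrightarrow>
           W' (X \<union> Y) U \<le> (W X U + W Y U) / 2 \<and> min (W X U) (W Y U) \<le> W' (X \<union> Y) U) \<and>
        (adjacent G X U \<and> \<not> adjacent G Y U \<longrightarrow> W' (X \<union> Y) U = W X U) \<and>
        (\<not> adjacent G X U \<and> adjacent G Y U \<longrightarrow> W' (X \<union> Y) U = W Y U))"

lemma merge_bounds_commute: "merge_bounds G \<C> X Y W W' \<Longrightarrow> merge_bounds G \<C> Y X W W'"
  unfolding merge_bounds_def Un_commute[of Y X] insert_commute[of Y X]
  by (simp add: min.commute add.commute)

text \<open>Complete linkage forgets the history of the run, so its merges can be computed from
  crossing edges alone. Symmetry later allows the merged cluster to be taken on the left.\<close>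

lemma hac_run_sim:
  assumes "hac_run L lam G \<theta> \<C> W"
  shows "(\<forall>A B. W A B = W B A) \<and> (L = Complete \<longrightarrow> W = min_sim G)"
  using assms
proof induction
  case start
  then show ?case by (simp add: min_sim_commute)
next
  case (merge \<C> W X Y)
  have "merge_sim L G X Y W A B = merge_sim L G X Y W B A" for A B
  proof (cases L)
    case Complete
    then show ?thesis by (simp add: min_sim_commute[of G A B])
  next
    case Weighted_Average
    have "W A B = W B A" using merge.IH by blast
    then show ?thesis using Weighted_Average by simp
  qed
  moreover have "L = Complete \<longrightarrow> merge_sim L G X Y W = min_sim G"
    by simp
  ultimately show ?case by blast
qed

lemma hac_run_partition:
  assumes "hac_run L lam G \<theta> \<C> W"
  shows "is_partition (size_V G) \<C>"
  using assms
proof induction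
  case start
  then show ?case by (auto simp: is_partition_def)
next
  case merge
  then show ?case by (simp add: is_partition_merge)
qed

text \<open>A minimum is at most an average, and an average is at least a minimum: complete linkage
  meets the lower bound of \<open>merge_bounds\<close> with equality, weighted average linkage the
  upper one.\<close>

lemma hac_run_merge_bounds:
  assumes run: "hac_run L lam G \<theta> \<C> W" and fin: "finite (dom (weight G))"
    and XY: "X \<in> \<C>" "Y \<in> \<C>" "X \<noteq> Y"
  shows "merge_bounds G \<C> X Y W (merge_sim L G X Y W)"
proof (cases L)
  case Complete
  then have W: "W = min_sim G" using hac_run_sim[OF run] by blast
  have fc: "finite (crossing G A B)" for A B
    using fin by (simp add: crossing_def)
  have "min_sim G (X \<union> Y) U = min (min_sim G X U) (min_sim G Y U)"
    if "adjacent G X U" "adjacent G Y U" for U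
    using that fc by (simp add: min_sim_def crossing_Un image_Un adjacent_def Min_Un)
  moreover have "min_sim G (X \<union> Y) U = min_sim G X U" if "\<not> adjacent G Y U" for U
    using that by (simp add: min_sim_def crossing_Un adjacent_def)
  moreover have "min_sim G (X \<union> Y) U = min_sim G Y U" if "\<not> adjacent G X U" for U
    using that by (simp add: min_sim_def crossing_Un adjacent_def)
  ultimately show ?thesis
    using Complete W by (auto simp: merge_bounds_def)
next
  case Weighted_Average
  have "A \<noteq> X \<union> Y" if "A \<in> \<C>" for A
    using is_partition_merge_new[OF hac_run_partition[OF run] XY that] .
  then show ?thesis
    using Weighted_Average by (simp add: merge_bounds_def average_sim_def min_def)
qed

text \<open>The premises on the parts are conditional because \<open>W\<close> carries no meaning
  between non-adjacent clusters; in that case \<open>merge_bounds\<close> passes on the value of the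
  adjacent part.\<close>

lemma merge_bounds_le:
  assumes mb: "merge_bounds G \<C> X Y W W'" and U: "U \<in> \<C> - {X, Y}"
    and adj: "adjacent G (X \<union> Y) U"
    and X: "adjacent G X U \<Longrightarrow> W X U \<le> M" and Y: "adjacent G Y U \<Longrightarrow> W Y U \<le> M"
  shows "W' (X \<union> Y) U \<le> M"
proof -
  note b = mb[unfolded merge_bounds_def, THEN conjunct2, rule_format, OF U]
  consider "adjacent G X U" "adjacent G Y U" | "adjacent G X U" "\<not> adjacent G Y U"
    | "\<not> adjacent G X U" "adjacent G Y U"
    using adj unfolding adjacent_Un by blast
  then show ?thesis
  proof cases
    case 1
    then have "W' (X \<union> Y) U \<le> (W X U + W Y U) / 2" "W X U \<le> M" "W Y U \<le> M"
      using b X Y by blast+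
    then show ?thesis by simp
  next
    case 2
    then show ?thesis using b X by simp
  next
    case 3
    then show ?thesis using b Y by simp
  qed
qed

lemma merge_bounds_ge:
  assumes mb: "merge_bounds G \<C> X Y W W'" and U: "U \<in> \<C> - {X, Y}"
    and adj: "adjacent G (X \<union> Y) U"
    and X: "adjacent G X U \<Longrightarrow> M \<le> W X U" and Y: "adjacent G Y U \<Longrightarrow> M \<le> W Y U"
  shows "M \<le> W' (X \<union> Y) U"
proof -
  note b = mb[unfolded merge_bounds_def, THEN conjunct2, rule_format, OF U]
  consider "adjacent G X U" "adjacent G Y U" | "adjacent G X U" "\<not> adjacent G Y U"
    | "\<not> adjacent G X U" "adjacent G Y U"
    using adj unfolding adjacent_Un by blast
  then show ?thesis
  proof cases
    case 1
    then have "min (W X U) (W Y U) \<le> W' (X \<union> Y) U" "M \<le> W X U" "M \<le> W Y U"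
      using b X Y by blast+
    then show ?thesis by simp
  next
    case 2
    then show ?thesis using b X by simp
  next
    case 3
    then show ?thesis using b Y by simp
  qed
qed

text \<open>Every similarity is a kind of mean of the weights of the crossing edges, as both halves
  of \<open>merge_bounds\<close> keep it within their range. Apart from the halving argument,
  similarities are estimated through this by inspecting edges.\<close>

lemma hac_run_bounds:
  assumes "hac_run L lam G \<theta> \<C> W" and fin: "finite (dom (weight G))"
    and "A \<in> \<C>" "B \<in> \<C>" "A \<noteq> B" "adjacent G A B"
  shows "((\<forall>e \<in> crossing G A B. real (the (weight G e)) \<le> M) \<longrightarrow> W A B \<le> M) \<and>
         ((\<forall>e \<in> crossing G A B. M \<le> real (the (weight G e))) \<longrightarrow> M \<le> W A B)"
  using assms(1,3-)
proof (induction arbitrary: A B)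
  case start
  have "finite (crossing G A B)" "crossing G A B \<noteq> {}"
    using fin start by (auto simp: crossing_def adjacent_def)
  then show ?case
    unfolding min_sim_def by (auto simp: Min_le_iff)
next
  case (merge \<C> W X Y)
  have mb: "merge_bounds G \<C> X Y W (merge_sim L G X Y W)"
    using hac_run_merge_bounds[OF merge.hyps(1) fin] merge.hyps by blast
  have *: "((\<forall>e \<in> crossing G (X \<union> Y) B. real (the (weight G e)) \<le> M) \<longrightarrow> merge_sim L G X Y W (X \<union> Y) B \<le> M) \<and>
         ((\<forall>e \<in> crossing G (X \<union> Y) B. M \<le> real (the (weight G e))) \<longrightarrow> M \<le> merge_sim L G X Y W (X \<union> Y) B)"
    if B: "B \<in> \<C> - {X, Y}" "adjacent G (X \<union> Y) B" for B
  proof -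
    have X: "adjacent G X B \<Longrightarrow> ((\<forall>e\<in>crossing G X B. real (the (weight G e)) \<le> M) \<longrightarrow> W X B \<le> M) \<and>
       ((\<forall>e\<in>crossing G X B. M \<le> real (the (weight G e))) \<longrightarrow> M \<le> W X B)"
      using merge.IH[of X B] merge.hyps B by blast
    have Y: "adjacent G Y B \<Longrightarrow> ((\<forall>e\<in>crossing G Y B. real (the (weight G e)) \<le> M) \<longrightarrow> W Y B \<le> M) \<and>
       ((\<forall>e\<in>crossing G Y B. M \<le> real (the (weight G e))) \<longrightarrow> M \<le> W Y B)"
      using merge.IH[of Y B] merge.hyps B by blast
    show ?thesis
      using merge_bounds_le[OF mb B, of M] merge_bounds_ge[OF mb B, of M] X Y
      unfolding crossing_Un by blast
  qed
  have sym: "merge_sim L G X Y W A B = merge_sim L G X Y W B A"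
    using hac_run_sim[OF hac_run.merge[OF merge.hyps]] by blast
  consider "A = X \<union> Y" "B \<in> \<C> - {X, Y}" | "B = X \<union> Y" "A \<in> \<C> - {X, Y}" | "A \<in> \<C> - {X, Y}" "B \<in> \<C> - {X, Y}"
    using merge.prems by blast
  then show ?case
  proof cases
    case 1
    then show ?thesis using * merge.prems by blast
  next
    case 2
    then show ?thesis
      using *[of A] merge.prems sym crossing_commute[of G A B] adjacent_commute[of G A B] by auto
  next
    case 3
    then have "merge_sim L G X Y W A B = W A B"
      using mb unfolding merge_bounds_def by blast
    then show ?thesis using merge.IH[of A B] merge.prems 3 by auto
  qed
qed

lemma similarities_finite: "finite \<C> \<Longrightarrow> finite (similarities G \<C> W)"
proof -
  assume "finite \<C>"
  have "similarities G \<C> W \<subseteq> (\<lambda>(X, Y). W X Y) ` (\<C> \<times> \<C>)"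
    by (auto simp: similarities_def)
  then show ?thesis using \<open>finite \<C>\<close> finite_subset by blast
qed

section \<open>The gadget graph\<close>

text \<open>
  Vertex \<open>x\<close> of the gadget graph lies in layer \<open>x div n\<close> above the vertex \<open>x mod n\<close> of the given
  graph. Layers \<open>2\<close> to \<open>k + 1\<close> above \<open>v\<close> are the leaves of a star with centre \<open>n + v\<close>; the edge
  between \<open>v\<close> and the centre is present if \<open>v\<close> is not in \<open>S\<close>. Isolated vertices get no gadget,
  since there is no time to look at them.
\<close>

definition covered :: "nat set set \<Rightarrow> nat set" where
  "covered E = \<Union>E"

abbreviation vsub :: "nat \<Rightarrow> nat set set \<Rightarrow> nat set \<Rightarrow> vsubgraph" where
  "vsub n E S \<equiv> \<lparr>sg_n = n, sg_E = E, sg_S = S\<rparr>"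

text \<open>Only one edge per column looks at \<open>S\<close>, the one between layers 0 and 1; the
  light edges are present on both sides of \<open>S\<close>. This makes a change of \<open>S\<close>
  a change of a single edge. Vertices above layer 0 in different columns are never joined.\<close>

definition pair_weight :: "nat \<Rightarrow> nat \<Rightarrow> nat set set \<Rightarrow> nat set \<Rightarrow> nat \<Rightarrow> nat \<Rightarrow> nat option" where
  "pair_weight n k E S x y =
     (let u = x mod n; v = y mod n; i = x div n; j = y div n in
      if u = v then
        if u \<in> covered E \<and> (i = 1 \<and> 2 \<le> j \<or> j = 1 \<and> 2 \<le> i) then Some (2 ^ k * 2 ^ k)
        else if u \<in> covered E - S \<and> (i = 0 \<and> j = 1 \<or> i = 1 \<and> j = 0) then Some (2 ^ k * 2 ^ k * 2 ^ k)
        else None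
      else if {u, v} \<in> E then
        if i = 0 \<and> j = 0 then Some (2 ^ k) else if i = 0 \<or> j = 0 then Some 1 else None
      else None)"

text \<open>An edge is a set, so \<open>Min\<close> and \<open>Max\<close> merely order its ends; as
  \<open>pair_weight\<close> is symmetric, the order is immaterial.\<close>

definition gadget_graph :: "nat \<Rightarrow> nat \<Rightarrow> nat set set \<Rightarrow> nat set \<Rightarrow> wgraph" where
  "gadget_graph n k E S = \<lparr>size_V = (k + 2) * n, weight = (\<lambda>e.
     if e \<in> all_edges ((k + 2) * n) then pair_weight n k E S (Min e) (Max e) else None)\<rparr>"

lemma pair_weight_commute: "pair_weight n k E S x y = pair_weight n k E S y x"
  unfolding pair_weight_def Let_def by (auto simp: insert_commute)

lemma all_edges_pair: "{x, y} \<in> all_edges n \<longleftrightarrow> x < n \<and> y < n \<and> x \<noteq> y"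
  by (auto simp: all_edges_def doubleton_eq_iff)

lemma all_edges_finite: "finite (all_edges n)"
proof -
  have "all_edges n \<subseteq> (\<lambda>(u, v). {u, v}) ` ({..<n} \<times> {..<n})"
    by (auto simp: all_edges_def)
  then show ?thesis using finite_subset by blast
qed

lemma size_V_gadget [simp]: "size_V (gadget_graph n k E S) = (k + 2) * n"
  by (simp add: gadget_graph_def)

lemma weight_gadget:
  "weight (gadget_graph n k E S) {x, y} =
     (if x < (k + 2) * n \<and> y < (k + 2) * n \<and> x \<noteq> y then pair_weight n k E S x y else None)"
proof (cases "x \<le> y")
  case True
  then show ?thesis by (simp add: gadget_graph_def all_edges_pair)
next
  case False
  then show ?thesis
    by (simp add: gadget_graph_def all_edges_pair pair_weight_commute[of n k E S x y])
qed

lemma dom_weight_gadget: "dom (weight (gadget_graph n k E S)) \<subseteq> all_edges ((k + 2) * n)"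
  by (auto simp: gadget_graph_def split: if_splits)

lemma finite_dom_weight_gadget: "finite (dom (weight (gadget_graph n k E S)))"
  by (rule finite_subset[OF dom_weight_gadget all_edges_finite])

lemma dom_weight_gadgetE:
  assumes "e \<in> dom (weight (gadget_graph n k E S))"
  obtains x y where "e = {x, y}" "x < (k + 2) * n" "y < (k + 2) * n" "x \<noteq> y"
proof -
  have "e \<in> all_edges ((k + 2) * n)" using assms dom_weight_gadget by blast
  then show ?thesis using that unfolding all_edges_def by auto
qed

lemma wgraph_ok_gadget: "wgraph_ok (gadget_graph n k E S)"
proof -
  have "x > 0" if x: "x \<in> ran (weight (gadget_graph n k E S))" for x
  proof -
    obtain e where e: "weight (gadget_graph n k E S) e = Some x"
      using x by (auto simp: ran_def)
    then obtain a b where "e = {a, b}"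
      using dom_weight_gadgetE[of e n k E S] by (metis domI)
    with e show ?thesis
      by (auto simp: weight_gadget pair_weight_def Let_def split: if_splits)
  qed
  then show ?thesis
    using dom_weight_gadget by (auto simp: wgraph_ok_def)
qed

lemma card_column:
  assumes "v < n"
  shows "card {x. x < m * n \<and> x mod n = v} = m"
proof -
  have "{x. x < m * n \<and> x mod n = v} = (\<lambda>l. l * n + v) ` {..<m}"
  proof (intro equalityI subsetI)
    fix x assume x: "x \<in> {x. x < m * n \<and> x mod n = v}"
    then have "x = (x div n) * n + v" "x div n < m"
      using div_mult_mod_eq[of x n] by (auto simp: less_mult_imp_div_less)
    then show "x \<in> (\<lambda>l. l * n + v) ` {..<m}" by blast
  next
    fix x assume "x \<in> (\<lambda>l. l * n + v) ` {..<m}"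
    then obtain l where l: "l < m" "x = l * n + v" by blast
    then have "l * n + n \<le> m * n" by (metis Suc_leI add.commute mult_Suc mult_le_mono1)
    then show "x \<in> {x. x < m * n \<and> x mod n = v}" using l assms by simp
  qed
  moreover have "inj_on (\<lambda>l. l * n + v) {..<m}"
    using assms by (auto simp: inj_on_def)
  ultimately show ?thesis by (simp add: card_image)
qed

section \<open>Columns of the gadget graph and the inventory of its edges\<close>

locale gadget =
  fixes n k :: nat and E :: "nat set set" and S :: "nat set"
  assumes E: "E \<subseteq> all_edges n" and S: "S \<subseteq> {..<n}"
begin

abbreviation "G \<equiv> gadget_graph n k E S"
abbreviation "conn \<equiv> (induced_adj (vsub n E S))\<^sup>*"

lemma E_D: "{u, v} \<in> E \<Longrightarrow> u < n \<and> v < n \<and> u \<noteq> v \<and> u \<in> covered E \<and> v \<in> covered E"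
  using E all_edges_pair unfolding covered_def by blast

lemma Union_E_D: "v \<in> covered E \<Longrightarrow> v < n"
  using E by (auto simp: all_edges_def covered_def)

lemma induced_adj_iff:
  "(u, v) \<in> induced_adj (vsub n E S) \<longleftrightarrow> u \<in> S \<and> v \<in> S \<and> {u, v} \<in> E"
  by (simp add: induced_adj_def)

text \<open>\<open>conn\<close> is reflexive on all numbers, so a vertex outside \<open>S\<close> is
  still connected to itself; a path of positive length starts and ends in non-isolated vertices of
  \<open>S\<close>.\<close>

lemma conn_isolated: "(u, v) \<in> conn \<Longrightarrow> u = v \<or> u \<in> S \<inter> covered E \<and> v \<in> S \<inter> covered E"
  by (induction rule: rtrancl_induct) (auto simp: induced_adj_iff covered_def)

lemma conn_sym: "(u, v) \<in> conn \<Longrightarrow> (v, u) \<in> conn"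
proof -
  have "sym (induced_adj (vsub n E S))"
    by (auto simp: sym_def induced_adj_iff insert_commute)
  then show "(u, v) \<in> conn \<Longrightarrow> (v, u) \<in> conn"
    using sym_rtrancl symD by metis
qed

lemma edge_lt: "{x, y} \<in> dom (weight G) \<Longrightarrow> x < (k + 2) * n \<and> y < (k + 2) * n \<and> x \<noteq> y"
  using dom_weight_gadget all_edges_pair by blast

text \<open>Every edge inside a column ends in the centre. Such edges weigh at least
  \<open>4 ^ k\<close>, whereas by \<open>edge_diff_base\<close> edges between columns weigh at most
  \<open>2 ^ k\<close>; this gap is what tells the phases apart.\<close>

lemma edge_same_base:
  assumes "{x, y} \<in> dom (weight G)" "x mod n = v" "y mod n = v"
  shows "v \<in> covered E \<and> (x = n + v \<and> 2 \<le> y div n \<and> weight G {x, y} = Some (2 ^ k * 2 ^ k) \<or>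
                    y = n + v \<and> 2 \<le> x div n \<and> weight G {x, y} = Some (2 ^ k * 2 ^ k) \<or>
                    x = v \<and> y = n + v \<and> v \<notin> S \<or> x = n + v \<and> y = v \<and> v \<notin> S)"
proof -
  have lt: "x < (k + 2) * n" "y < (k + 2) * n" "x \<noteq> y"
    using edge_lt[OF assms(1)] by auto
  have "x div n = 1 \<Longrightarrow> x = n + v" "x div n = 0 \<Longrightarrow> x = v"
    "y div n = 1 \<Longrightarrow> y = n + v" "y div n = 0 \<Longrightarrow> y = v"
    using assms(2,3) div_mult_mod_eq[of x n] div_mult_mod_eq[of y n] by auto
  moreover have "weight G {x, y} = pair_weight n k E S x y" "pair_weight n k E S x y \<noteq> None"
    using assms(1) lt by (auto simp: weight_gadget)
  moreover from this have "v \<in> covered E \<and>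
      (x div n = 1 \<and> 2 \<le> y div n \<and> weight G {x, y} = Some (2 ^ k * 2 ^ k) \<or>
       y div n = 1 \<and> 2 \<le> x div n \<and> weight G {x, y} = Some (2 ^ k * 2 ^ k) \<or>
       x div n = 0 \<and> y div n = 1 \<and> v \<notin> S \<or> x div n = 1 \<and> y div n = 0 \<and> v \<notin> S)"
    using assms(2,3) unfolding pair_weight_def Let_def
    by (auto simp del: One_nat_def split: if_splits)
  ultimately show ?thesis by auto
qed

lemma edge_diff_base:
  assumes "{x, y} \<in> dom (weight G)" "x mod n \<noteq> y mod n"
  shows "{x mod n, y mod n} \<in> E \<and> (x < n \<and> y < n \<and> weight G {x, y} = Some (2 ^ k) \<or>
      (x < n \<or> y < n) \<and> \<not> (x < n \<and> y < n) \<and> weight G {x, y} = Some 1)"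
proof -
  have lt: "x < (k + 2) * n" "y < (k + 2) * n" "x \<noteq> y"
    using edge_lt[OF assms(1)] by auto
  then have "n > 0" by (cases n) auto
  then have "x div n = 0 \<longleftrightarrow> x < n" "y div n = 0 \<longleftrightarrow> y < n"
    by (auto simp: div_eq_0_iff)
  then show ?thesis
    using assms lt by (auto simp: weight_gadget pair_weight_def Let_def split: if_splits)
qed

lemma edge_main: "{u, v} \<in> E \<Longrightarrow> weight G {u, v} = Some (2 ^ k)"
  using E_D[of u v] by (simp add: weight_gadget pair_weight_def)

lemma edge_light:
  assumes "{u, y mod n} \<in> E" "n \<le> y" "y < (k + 2) * n"
  shows "{u, y} \<in> dom (weight G)"
  using E_D[OF assms(1)] assms
  by (auto simp: weight_gadget pair_weight_def Let_def dom_def)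

lemma edge_centre:
  assumes "v \<in> covered E" "v \<notin> S"
  shows "weight G {v, n + v} = Some (2 ^ k * 2 ^ k * 2 ^ k)"
proof -
  have "v < n" using Union_E_D assms by blast
  moreover from this have "(n + v) div n = 1" "(n + v) mod n = v" by simp_all
  ultimately show ?thesis
    using assms by (simp add: weight_gadget pair_weight_def)
qed

lemma edge_leaf:
  assumes "x mod n \<in> covered E" "2 \<le> x div n" "x < (k + 2) * n"
  shows "weight G {x, n + x mod n} = Some (2 ^ k * 2 ^ k)"
proof -
  have "x mod n < n" using Union_E_D assms by blast
  moreover from this have "(n + x mod n) div n = 1" "(n + x mod n) mod n = x mod n"
    by simp_all
  moreover from this have "x \<noteq> n + x mod n" using assms by auto
  ultimately show ?thesis
    using assms by (simp add: weight_gadget pair_weight_def)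
qed

lemma centre_lt: "v < n \<Longrightarrow> n + v < (k + 2) * n"
  by simp

lemma lt_size: "v < n \<Longrightarrow> v < (k + 2) * n"
  by simp

text \<open>The clusters of the last phase: parts of components of the induced subgraph. A lone
  isolated vertex outside \<open>S\<close> qualifies too, because \<open>conn\<close> is
  reflexive.\<close>

definition linked :: "nat set \<Rightarrow> bool" where
  "linked X \<longleftrightarrow> X \<subseteq> {..<n} - (covered E - S) \<and> (\<forall>s \<in> X. \<forall>t \<in> X. (s, t) \<in> conn)"

text \<open>A cluster that has grown inside a column contains the centre, since every edge there
  ends in it. The base vertex can have joined only if its edge to the centre exists.\<close>

definition column :: "nat \<Rightarrow> nat set \<Rightarrow> bool" where
  "column v X \<longleftrightarrow> v < n \<and> (\<forall>x \<in> X. x mod n = v) \<and>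
     ((\<exists>x. X = {x}) \<or> v \<in> covered E \<and> n + v \<in> X \<and> (v \<in> X \<longrightarrow> v \<notin> S))"

end

text \<open>
  Three phases, kept apart by the factor \<open>2 ^ k > \<lambda>\<close>: every \<open>v\<close> outside \<open>S\<close> joins its centre, then
  the centres collect their leaves, and finally the vertices of \<open>S\<close> are clustered along the given
  edges. In the second phase each leaf halves the excess over 1 of the similarity between the
  cluster of \<open>v\<close> and its neighbours.
\<close>

locale gadget_state = gadget +
  fixes \<C> :: "nat set set" and W :: sim
  assumes part: "is_partition ((k + 2) * n) \<C>"
    and sym: "W A B = W B A"
    and le: "\<lbrakk>A \<in> \<C>; B \<in> \<C>; A \<noteq> B; adjacent G A B;
       \<And>x y. x \<in> A \<Longrightarrow> y \<in> B \<Longrightarrow> {x, y} \<in> dom (weight G) \<Longrightarrow> real (the (weight G {x, y})) \<le> M\<rbrakk>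
       \<Longrightarrow> W A B \<le> M"
    and ge: "\<lbrakk>A \<in> \<C>; B \<in> \<C>; A \<noteq> B; adjacent G A B;
       \<And>x y. x \<in> A \<Longrightarrow> y \<in> B \<Longrightarrow> {x, y} \<in> dom (weight G) \<Longrightarrow> M \<le> real (the (weight G {x, y}))\<rbrakk>
       \<Longrightarrow> M \<le> W A B"
    and shape: "X \<in> \<C> \<Longrightarrow> linked X \<or> (\<exists>v. column v X)"
    and first_phase: "\<lbrakk>v \<in> covered E - S; {v} \<in> \<C>; X \<in> \<C>; x \<in> X; 2 \<le> x div n\<rbrakk> \<Longrightarrow> X = {x}"
    and excess: "\<lbrakk>X \<in> \<C>; v \<in> X; v \<in> covered E - S; Y \<in> \<C>; Y \<noteq> X; adjacent G X Y; \<forall>y \<in> Y. y mod n \<noteq> v\<rbrakk>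
       \<Longrightarrow> W X Y \<le> 1 + 2 * 2 ^ k / 2 ^ card X"
begin

lemma same: "A \<in> \<C> \<Longrightarrow> B \<in> \<C> \<Longrightarrow> x \<in> A \<Longrightarrow> x \<in> B \<Longrightarrow> A = B"
  using is_partition_unique[OF part] by blast

lemma cluster_lt: "A \<in> \<C> \<Longrightarrow> x \<in> A \<Longrightarrow> x < (k + 2) * n"
  using part unfolding is_partition_def by blast

lemma nonempty: "A \<in> \<C> \<Longrightarrow> A \<noteq> {}"
  using part unfolding is_partition_def by blast

lemma finite_cluster: "A \<in> \<C> \<Longrightarrow> finite A"
  using is_partition_finite_cluster[OF part] .

lemma cover: assumes "x < (k + 2) * n" obtains X where "X \<in> \<C>" "x \<in> X"
  using is_partition_cover[OF part assms] by blast

lemma column_of: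
  assumes "X \<in> \<C>" "x \<in> X" "n \<le> x \<or> x \<in> covered E - S"
  shows "column (x mod n) X"
proof -
  have "\<not> linked X" using assms unfolding linked_def by auto
  then show ?thesis using shape[OF assms(1)] assms(2) unfolding column_def by auto
qed

lemma column_centre:
  assumes "column v X" "x \<in> X" "y \<in> X" "x \<noteq> y"
  shows "n + v \<in> X \<and> v \<in> covered E \<and> (v \<in> X \<longrightarrow> v \<notin> S)"
  using assms unfolding column_def by auto

lemma similarity_in: "A \<in> \<C> \<Longrightarrow> B \<in> \<C> \<Longrightarrow> A \<noteq> B \<Longrightarrow> adjacent G A B \<Longrightarrow> W A B \<in> similarities G \<C> W"
  unfolding similarities_def by blast

lemma sim_le_Max: "x \<in> similarities G \<C> W \<Longrightarrow> x \<le> Max (similarities G \<C> W)"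
  using similarities_finite[OF is_partition_finite[OF part]] by simp

text \<open>While \<open>v\<close> is alone, \<open>first_phase\<close> says that no leaf has moved
  at all, and a centre can only have merged inside its column; so the centre of \<open>v\<close> is
  alone as well.\<close>

lemma first_phase_partner:
  assumes "v \<in> covered E - S" "{v} \<in> \<C>" "X \<in> \<C>" "n + v \<in> X"
  shows "X = {n + v}"
proof -
  have v: "v < n" using assms Union_E_D by blast
  have "x = n + v" if x: "x \<in> X" for x
  proof (rule ccontr)
    assume ne: "x \<noteq> n + v"
    have "column v X" using column_of[of X "n + v"] assms v by simp
    then have "x mod n = v" using x unfolding column_def by blast
    then have eq: "x = (x div n) * n + v" using div_mult_mod_eq by metis
    have "x div n \<noteq> 0"
    proof
      assume "x div n = 0"
      with eq have "x = v" by simp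
      then have "X = {v}" using same[of X "{v}" v] assms x by simp
      then show False using assms v by auto
    qed
    moreover have "x div n \<noteq> 1" using ne eq by auto
    ultimately have "X = {x}" using first_phase[of v X x] assms x by simp
    then show False using assms ne by simp
  qed
  then show ?thesis using assms by blast
qed

text \<open>Between two lone vertices the similarity is the weight of their edge. A maximum of
  \<open>8 ^ k\<close> then rules out merges of similarity \<open>4 ^ k\<close> or less, so the
  first phase must end before any leaf moves.\<close>

lemma first_phase_sim:
  assumes "v \<in> covered E - S" "{v} \<in> \<C>"
  shows "\<exists>x \<in> similarities G \<C> W. 2 ^ k * 2 ^ k * 2 ^ k \<le> x"
proof -
  have v: "v < n" using assms Union_E_D by blast
  obtain X where X: "X \<in> \<C>" "n + v \<in> X" using cover[OF centre_lt[OF v]] .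
  then have X': "X = {n + v}" using first_phase_partner assms by blast
  have w: "weight G {v, n + v} = Some (2 ^ k * 2 ^ k * 2 ^ k)" using edge_centre assms by blast
  then have adj: "adjacent G {v} X" unfolding adjacent_iff X' by blast
  have ne: "{v} \<noteq> X" using v X' by auto
  have "2 ^ k * 2 ^ k * 2 ^ k \<le> W {v} X"
    using ge[OF assms(2) X(1) ne adj] w X' by simp
  then show ?thesis
    using similarity_in[OF assms(2) X(1) ne adj] by blast
qed

text \<open>The only edge of a leaf within its column goes to the centre, so whatever the cluster of
  the centre has already collected, its similarity to a lone leaf is still
  \<open>4 ^ k\<close>.\<close>

lemma leaf_sim:
  assumes "x mod n \<in> covered E" "2 \<le> x div n" "{x} \<in> \<C>"
  shows "\<exists>x \<in> similarities G \<C> W. 2 ^ k * 2 ^ k \<le> x"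
proof -
  define v where "v = x mod n"
  have v: "v < n" "v \<in> covered E" using assms Union_E_D v_def by auto
  have x: "x < (k + 2) * n" using cluster_lt assms by blast
  obtain X where X: "X \<in> \<C>" "n + v \<in> X" using cover[OF centre_lt[OF v(1)]] .
  have col: "column v X" using column_of[of X "n + v"] X v by simp
  have w: "weight G {x, n + v} = Some (2 ^ k * 2 ^ k)" using edge_leaf assms x v_def by blast
  then have adj: "adjacent G {x} X" unfolding adjacent_iff using X by blast
  have ne: "{x} \<noteq> X"
  proof
    assume "{x} = X"
    then have "x = n + v" using X by blast
    then show False using assms(2) v by simp
  qed
  have "2 ^ k * 2 ^ k \<le> real (the (weight G {x, y}))" if "y \<in> X" "{x, y} \<in> dom (weight G)" for y
  proof -
    have "y mod n = v" using col that unfolding column_def by blast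
    moreover have "x \<noteq> v" "x \<noteq> n + v" using assms(2) v by auto
    ultimately have "weight G {x, y} = Some (2 ^ k * 2 ^ k)"
      using edge_same_base[OF that(2) v_def[symmetric]] by auto
    then show ?thesis by simp
  qed
  then have "2 ^ k * 2 ^ k \<le> W {x} X"
    using ge[OF assms(3) X(1) ne adj, of "2 ^ k * 2 ^ k"] by blast
  then show ?thesis
    using similarity_in[OF assms(3) X(1) ne adj] by blast
qed

lemma outside_joined:
  assumes "\<And>v. v \<in> covered E - S \<Longrightarrow> {v} \<notin> \<C>" and X: "X \<in> \<C>" "n + v \<in> X" and v: "v \<in> covered E - S"
  shows "v \<in> X"
proof -
  have "v < n" using v Union_E_D by blast
  then obtain C where C: "C \<in> \<C>" "v \<in> C" using cover[OF lt_size] by blast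
  have "column v C" using column_of[OF C] v \<open>v < n\<close> by simp
  moreover have "C \<noteq> {v}" using assms C by blast
  then obtain y where "y \<in> C" "y \<noteq> v" using C by blast
  ultimately have "n + v \<in> C" using column_centre C by blast
  then show ?thesis using same[of X C] X C by blast
qed

lemma leaves_joined:
  assumes "\<And>x. x mod n \<in> covered E \<Longrightarrow> 2 \<le> x div n \<Longrightarrow> {x} \<notin> \<C>" and X: "X \<in> \<C>" "n + v \<in> X"
    and v: "v \<in> covered E" and x: "x < (k + 2) * n" "x mod n = v" "2 \<le> x div n"
  shows "x \<in> X"
proof -
  obtain C where C: "C \<in> \<C>" "x \<in> C" using cover[OF x(1)] by blast
  have "n \<le> x" using x(3) by (metis div_less not_le not_numeral_le_zero)
  then have "column v C" using column_of[OF C] x by blast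
  moreover have "C \<noteq> {x}" using assms(1)[of x] x v C(1) by blast
  then obtain y where "y \<in> C" "y \<noteq> x" using C by blast
  ultimately have "n + v \<in> C" using column_centre C by blast
  then show ?thesis using same[of X C] X C by blast
qed

text \<open>A cluster in a column grows only through its centre, so once nothing in the column of
  \<open>v\<close> is left alone, the cluster is the whole column. Its size \<open>k + 2\<close> is
  what \<open>excess\<close> needs to drop to \<open>3 / 2\<close>.\<close>

lemma outside_complete:
  assumes "\<And>v. v \<in> covered E - S \<Longrightarrow> {v} \<notin> \<C>"
    and "\<And>x. x mod n \<in> covered E \<Longrightarrow> 2 \<le> x div n \<Longrightarrow> {x} \<notin> \<C>"
    and X: "X \<in> \<C>" "v \<in> X" and v: "v \<in> covered E - S"
  shows "card X = k + 2"
proof -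
  have vn: "v < n" using v Union_E_D by blast
  have col: "column v X" using column_of[OF X] v vn by simp
  have "X \<noteq> {v}" using assms by blast
  then obtain y where "y \<in> X" "y \<noteq> v" using X by blast
  then have c: "n + v \<in> X" using column_centre[OF col] X by blast
  have "X = {x. x < (k + 2) * n \<and> x mod n = v}"
  proof (intro equalityI subsetI)
    fix x assume "x \<in> X"
    then show "x \<in> {x. x < (k + 2) * n \<and> x mod n = v}"
      using col cluster_lt[OF X(1)] unfolding column_def by blast
  next
    fix x assume x: "x \<in> {x. x < (k + 2) * n \<and> x mod n = v}"
    then have eq: "x = (x div n) * n + v" using div_mult_mod_eq[of x n] by simp
    consider "x div n = 0" | "x div n = 1" | "2 \<le> x div n" by linarith
    then show "x \<in> X"
    proof cases
      case 1
      then have "x = v" using eq by simp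
      then show ?thesis using X by simp
    next
      case 2
      then have "x = n + v" using eq by simp
      then show ?thesis using c by simp
    next
      case 3
      then show ?thesis using leaves_joined[OF assms(2) X(1) c] v x by blast
    qed
  qed
  then show ?thesis using card_column[OF vn, of "k + 2"] by simp
qed

text \<open>A maximum of at least \<open>2 ^ k\<close> forces the merge to have similarity above 2,
  while a cluster that is not linked reaches other columns with similarity at most
  \<open>3 / 2\<close>. Stated for \<open>X\<close> only; symmetry gives \<open>Y\<close>.\<close>

lemma last_phase_linked:
  assumes lam: "2 * lam < 2 ^ k" "1 \<le> lam"
    and XY: "X \<in> \<C>" "Y \<in> \<C>" "X \<noteq> Y" "adjacent G X Y"
    and dif: "\<And>x y. x \<in> X \<Longrightarrow> y \<in> Y \<Longrightarrow> {x, y} \<in> dom (weight G) \<Longrightarrow> x mod n \<noteq> y mod n"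
    and sim: "Max (similarities G \<C> W) / lam \<le> W X Y" "2 ^ k \<le> Max (similarities G \<C> W)"
  shows "linked X \<and> (\<forall>v \<in> covered E - S. {v} \<notin> \<C>)"
proof -
  \<comment> \<open>The maximum exceeds this by a factor of at most \<open>lam\<close>, so it stays
    below \<open>4 ^ k\<close>: neither a lone covered vertex outside \<open>S\<close> nor a lone
    leaf of a star is left.\<close>
  have "W X Y \<le> 2 ^ k"
  proof (rule le[OF XY])
    fix x y assume "x \<in> X" "y \<in> Y" "{x, y} \<in> dom (weight G)"
    then show "real (the (weight G {x, y})) \<le> 2 ^ k"
      using edge_diff_base[of x y] dif by fastforce
  qed
  then have "Max (similarities G \<C> W) \<le> lam * 2 ^ k"
    using sim lam by (simp add: field_simps order_trans)
  also have "\<dots> < 2 ^ k * 2 ^ k" using lam by simp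
  finally have M: "Max (similarities G \<C> W) < 2 ^ k * 2 ^ k" .
  have "(2::real) ^ k * 2 ^ k * 1 \<le> 2 ^ k * 2 ^ k * 2 ^ k"
    by (intro mult_left_mono) auto
  with M have un: "\<And>v. v \<in> covered E - S \<Longrightarrow> {v} \<notin> \<C>"
    using first_phase_sim sim_le_Max by fastforce
  have lv: "\<And>x. x mod n \<in> covered E \<Longrightarrow> 2 \<le> x div n \<Longrightarrow> {x} \<notin> \<C>" using M leaf_sim sim_le_Max by fastforce
  have "2 * lam < Max (similarities G \<C> W)" using lam sim by linarith
  then have "2 < Max (similarities G \<C> W) / lam" using lam by (simp add: field_simps)
  then have big: "2 < W X Y" using sim by linarith
  have "linked X"
  proof (rule ccontr)
    assume nl: "\<not> linked X"
    then obtain v where col: "column v X" using shape XY by blast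
    then have v: "v < n" "\<And>x. x \<in> X \<Longrightarrow> x mod n = v" unfolding column_def by blast+
    show False
    proof (cases "v \<in> X")
      case True
      have K: "v \<in> covered E - S"
      proof (cases "X = {v}")
        case True
        then show ?thesis using nl v unfolding linked_def by auto
      next
        case False
        then obtain y where "y \<in> X" "y \<noteq> v" using \<open>v \<in> X\<close> by blast
        then show ?thesis using column_centre[OF col] \<open>v \<in> X\<close> by blast
      qed
      \<comment> \<open>If \<open>Y\<close> touched the column of \<open>v\<close>, it would lie in
        it entirely, and all crossing edges would be inside one column, against
        \<open>dif\<close>.\<close>
      have nb: "\<forall>y \<in> Y. y mod n \<noteq> v"
      proof (intro ballI notI)
        fix y assume y: "y \<in> Y" "y mod n = v"
        have "n \<le> y"
        proof (rule ccontr)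
          assume "\<not> n \<le> y"
          then have "y = v" using y by simp
          then show False using same[of X Y v] XY \<open>v \<in> X\<close> y by blast
        qed
        then have "column v Y" using column_of[of Y y] XY y by blast
        then have "\<And>z. z \<in> Y \<Longrightarrow> z mod n = v" unfolding column_def by blast
        then show False using dif v XY(4) unfolding adjacent_iff by metis
      qed
      have "W X Y \<le> 1 + 2 * 2 ^ k / 2 ^ card X"
        using excess[OF XY(1) True K XY(2) XY(3)[symmetric] XY(4) nb] .
      moreover have "card X = k + 2" using outside_complete[OF un lv XY(1) True K] by blast
      ultimately show False using big by simp
    next
      case False
      \<comment> \<open>Without \<open>v\<close> the cluster has no original vertex, so only light
        edges lead to other columns.\<close>
      have "W X Y \<le> 1"
      proof (rule le[OF XY])
        fix x y assume xy: "x \<in> X" "y \<in> Y" "{x, y} \<in> dom (weight G)"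
        have "\<not> x < n" using xy v False by fastforce
        then show "real (the (weight G {x, y})) \<le> 1"
          using edge_diff_base[of x y] dif xy by fastforce
      qed
      then show False using big by simp
    qed
  qed
  then show ?thesis using un by blast
qed

text \<open>A merge of one of the first two phases, with a direction: the lone vertex
  \<open>y\<close> of \<open>B\<close> lies above layer 0 and thus sees other columns by light edges
  only. The last clause records that a leaf moves only after the first phase is over
  everywhere.\<close>

definition absorbs :: "nat set \<Rightarrow> nat set \<Rightarrow> bool" where
  "absorbs A B \<longleftrightarrow> (\<exists>v y. B = {y} \<and> y mod n = v \<and> n \<le> y \<and> (\<forall>x \<in> A. x mod n = v) \<and>
     v \<in> covered E \<and> (v \<in> A \<longleftrightarrow> v \<notin> S) \<and> n + v \<in> A \<union> B \<and>
     (A = {v} \<and> y = n + v \<or> (\<forall>v \<in> covered E - S. {v} \<notin> \<C>)))"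

text \<open>With the centre in \<open>A\<close>, the other column \<open>B\<close> can only be a
  lone vertex, and whether this is the base vertex or a leaf decides the phase.\<close>

lemma column_merge:
  assumes lam: "2 * lam < 2 ^ k" "1 \<le> lam"
    and AB: "A \<in> \<C>" "B \<in> \<C>" "A \<noteq> B" "adjacent G A B"
    and col: "column v A" "column v B" and c: "n + v \<in> A"
    and sim: "Max (similarities G \<C> W) / lam \<le> W A B"
  shows "absorbs A B \<or> absorbs B A"
proof -
  have v: "v < n" "\<And>x. x \<in> A \<Longrightarrow> x mod n = v" "\<And>x. x \<in> B \<Longrightarrow> x mod n = v"
    using col unfolding column_def by blast+
  have cB: "n + v \<notin> B" using same[of A B] AB c by blast
  then obtain b where b: "B = {b}" using col unfolding column_def by blast
  obtain a where a: "a \<in> A" "{a, b} \<in> dom (weight G)" using AB(4) unfolding adjacent_iff b by blast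
  have vb: "b mod n = v" using v b by blast
  have e: "v \<in> covered E \<and> (2 \<le> b div n \<or> b = v \<and> v \<notin> S)"
    using edge_same_base[OF a(2) v(2)[OF a(1)] vb] cB b by auto
  then consider "b = v" "v \<notin> S" | "2 \<le> b div n" by blast
  then show ?thesis
  proof cases
    case 1
    \<comment> \<open>First phase: the lone base vertex plays the absorbing part, and
      \<open>A\<close>, which is just the centre, is absorbed.\<close>
    then have "A = {n + v}" using first_phase_partner[of v A] AB b c e by blast
    then have "absorbs B A" using 1 b e v unfolding absorbs_def by auto
    then show ?thesis ..
  next
    case 2
    \<comment> \<open>Second phase: the maximum is at most \<open>lam * 4 ^ k\<close>, hence below
      \<open>8 ^ k\<close>, so no covered vertex outside \<open>S\<close> is alone any more.\<close>
    have "W A B \<le> 2 ^ k * 2 ^ k"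
    proof (rule le[OF AB])
      fix x y assume xy: "x \<in> A" "y \<in> B" "{x, y} \<in> dom (weight G)"
      have "b \<noteq> v" "b \<noteq> n + v" using 2 v(1) by auto
      then have "weight G {x, y} = Some (2 ^ k * 2 ^ k)"
        using edge_same_base[OF xy(3), of v] v b xy(1,2) by blast
      then show "real (the (weight G {x, y})) \<le> 2 ^ k * 2 ^ k" by simp
    qed
    then have "Max (similarities G \<C> W) \<le> lam * (2 ^ k * 2 ^ k)"
      using sim lam by (simp add: field_simps order_trans)
    also have "\<dots> < 2 ^ k * (2 ^ k * 2 ^ k)" using lam by (intro mult_strict_right_mono) auto
    finally have un: "\<And>v. v \<in> covered E - S \<Longrightarrow> {v} \<notin> \<C>"
      using first_phase_sim sim_le_Max by fastforce
    have "n \<le> b" using 2 by (metis div_less not_le not_numeral_le_zero)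
    moreover have "v \<in> A \<longleftrightarrow> v \<notin> S"
    proof
      assume "v \<in> A"
      then show "v \<notin> S" using column_centre[OF col(1), of v "n + v"] c v by auto
    next
      assume "v \<notin> S"
      then show "v \<in> A" using outside_joined[OF un AB(1) c] e by blast
    qed
    ultimately have "absorbs A B"
      unfolding absorbs_def using b vb v e c un by (intro exI[of _ v] exI[of _ b]) auto
    then show ?thesis ..
  qed
qed

text \<open>A crossing edge inside a column puts the centre into one of the clusters, which is the
  situation of \<open>column_merge\<close>. If all crossing edges run between columns, only the last
  phase is possible.\<close>

lemma merge_cases:
  assumes lam: "2 * lam < 2 ^ k" "1 \<le> lam"
    and XY: "X \<in> \<C>" "Y \<in> \<C>" "X \<noteq> Y" "adjacent G X Y"
    and sim: "Max (similarities G \<C> W) / lam \<le> W X Y" "2 ^ k \<le> Max (similarities G \<C> W)"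
  shows "absorbs X Y \<or> absorbs Y X \<or>
    linked X \<and> linked Y \<and> (\<exists>x \<in> X. \<exists>y \<in> Y. {x, y} \<in> E) \<and> (\<forall>v \<in> covered E - S. {v} \<notin> \<C>)"
proof (cases "\<exists>x \<in> X. \<exists>y \<in> Y. {x, y} \<in> dom (weight G) \<and> x mod n = y mod n")
  case True
  then obtain x y where xy: "x \<in> X" "y \<in> Y" "{x, y} \<in> dom (weight G)" "x mod n = y mod n" by blast
  define v where "v = y mod n"
  have v: "x mod n = v" "y mod n = v" using xy v_def by auto
  have e: "v \<in> covered E" "x = n + v \<or> y = n + v" "n \<le> x \<or> x = v \<and> v \<notin> S" "n \<le> y \<or> y = v \<and> v \<notin> S"
    using edge_same_base[OF xy(3) v] by (auto simp: div_greater_zero_iff Suc_le_eq)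
  have "column v X" "column v Y"
    using column_of[OF XY(1) xy(1)] column_of[OF XY(2) xy(2)] e v by auto
  then show ?thesis
    using column_merge[OF lam XY _ _ _ sim(1), of v]
      column_merge[OF lam XY(2,1) XY(3)[symmetric], of v] XY(4) adjacent_commute[of G X Y]
      sim(1) sym[of X Y] e(2) xy(1,2) by metis
next
  case False
  have lX: "linked X \<and> (\<forall>v \<in> covered E - S. {v} \<notin> \<C>)"
    using last_phase_linked[OF lam XY _ sim] False by blast
  have lY: "linked Y"
    using last_phase_linked[OF lam XY(2,1) XY(3)[symmetric] _ _ _ sim(2)] False
      adjacent_commute[of G X Y] XY(4) sim(1) sym[of X Y] by (metis insert_commute)
  obtain x y where xy: "x \<in> X" "y \<in> Y" "{x, y} \<in> dom (weight G)"
    using XY(4) unfolding adjacent_iff by blast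
  then have "{x mod n, y mod n} \<in> E" using edge_diff_base False by blast
  moreover have "x < n" "y < n" using lX lY xy unfolding linked_def by auto
  ultimately show ?thesis using lX lY xy by auto
qed

end

section \<open>Preservation of the invariants by one merge\<close>

context gadget_state
begin

lemma not_singleton_merge:
  assumes "X \<in> \<C>" "Y \<in> \<C>" "X \<noteq> Y"
  shows "{v} \<noteq> X \<union> Y"
proof
  assume v: "{v} = X \<union> Y"
  then have "X \<subseteq> {v}" "Y \<subseteq> {v}" by auto
  then have "X = {v}" "Y = {v}"
    using nonempty[OF assms(1)] nonempty[OF assms(2)] subset_singletonD by metis+
  then show False using assms by blast
qed

lemma absorbs_column:
  assumes "absorbs A B"
  shows "\<exists>v. column v (A \<union> B)"
proof -
  obtain v y where vy: "B = {y}" "y mod n = v" "n \<le> y" "\<forall>x \<in> A. x mod n = v" "v \<in> covered E"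
    "v \<in> A \<longleftrightarrow> v \<notin> S" "n + v \<in> A \<union> B"
    using assms unfolding absorbs_def by blast
  have "v < n" using vy Union_E_D by blast
  then have "column v (A \<union> B)" using vy unfolding column_def by auto
  then show ?thesis by blast
qed

text \<open>Ends of edges in \<open>E\<close> are covered, and a linked cluster has no covered
  vertex outside \<open>S\<close>; so the joining edge belongs to the induced subgraph.\<close>

lemma linked_merge:
  assumes "linked X" "linked Y" "x \<in> X" "y \<in> Y" "{x, y} \<in> E"
  shows "linked (X \<union> Y)"
proof -
  have "x \<in> S" "y \<in> S"
    using assms E_D[OF assms(5)] unfolding linked_def by blast+
  then have xy: "(x, y) \<in> conn" using assms by (simp add: induced_adj_iff r_into_rtrancl)
  have XY: "(s, t) \<in> conn" if "s \<in> X" "t \<in> Y" for s t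
  proof -
    have "(s, x) \<in> conn" "(y, t) \<in> conn" using assms that unfolding linked_def by blast+
    with xy show ?thesis by (meson rtrancl_trans)
  qed
  then have "(t, s) \<in> conn" if "s \<in> X" "t \<in> Y" for s t
    using that conn_sym by blast
  with XY show ?thesis using assms(1,2) unfolding linked_def by blast
qed

text \<open>The halving: the absorbed vertex has similarity at most 1 to \<open>U\<close>, the
  average of this and \<open>1 + e\<close> is at most \<open>1 + e / 2\<close>, and the cluster has
  grown by exactly one vertex.\<close>

lemma excess_absorbs:
  assumes mb: "merge_bounds G \<C> A B W W'" and ab: "absorbs A B"
    and AB: "A \<in> \<C>" "B \<in> \<C>" "A \<noteq> B"
    and v: "v \<in> A \<union> B" "v \<in> covered E - S"
    and U: "U \<in> \<C> - {A, B}" "adjacent G (A \<union> B) U" "\<forall>y \<in> U. y mod n \<noteq> v"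
  shows "W' (A \<union> B) U \<le> 1 + 2 * 2 ^ k / 2 ^ card (A \<union> B)"
proof -
  obtain w y where wy: "B = {y}" "y mod n = w" "n \<le> y" "\<forall>x \<in> A. x mod n = w" "w \<in> covered E"
    using ab unfolding absorbs_def by blast
  have "v mod n = w" "v < n" using v wy Union_E_D by auto
  then have w: "w = v" by simp
  have vA: "v \<in> A" using v wy \<open>v < n\<close> by auto
  have "y \<notin> A" using same[of A B y] AB wy by blast
  then have card: "card (A \<union> B) = Suc (card A)"
    using wy finite_cluster[OF AB(1)] by simp
  have yN: "y < (k + 2) * n" using cluster_lt AB wy by blast
  have UC: "U \<in> \<C>" "U \<noteq> A" "U \<noteq> B" using U by blast+
  have diff: "a mod n \<noteq> u mod n" if "a \<in> A \<union> B" "u \<in> U" for a u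
    using that wy w U(3) by auto
  have light: "W B U \<le> 1" if "adjacent G B U"
  proof (rule le[OF AB(2) UC(1) UC(3)[symmetric] that])
    fix b u assume bu: "b \<in> B" "u \<in> U" "{b, u} \<in> dom (weight G)"
    have "\<not> b < n" using bu wy by simp
    then show "real (the (weight G {b, u})) \<le> 1"
      using edge_diff_base[OF bu(3)] diff bu by fastforce
  qed
  consider "adjacent G A U" "adjacent G B U" | "adjacent G A U" "\<not> adjacent G B U"
    | "\<not> adjacent G A U" "adjacent G B U"
    using U(2) unfolding adjacent_Un by blast
  then show ?thesis
  proof cases
    case 1
    then have "W' (A \<union> B) U \<le> (W A U + W B U) / 2"
      using mb U(1) unfolding merge_bounds_def by blast
    moreover define e :: real where "e = 2 * 2 ^ k / 2 ^ card A"
    moreover have "W A U \<le> 1 + e"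
      using excess[OF AB(1) vA v(2) UC(1) UC(2) 1(1) U(3)] unfolding e_def .
    moreover have "2 * 2 ^ k / 2 ^ card (A \<union> B) = e / 2"
      using card by (simp add: e_def)
    ultimately show ?thesis using light[OF 1(2)] by simp
  next
    \<comment> \<open>No averaging takes place here, so \<open>W A U\<close> must be small already:
      an edge from \<open>A\<close> to an original vertex \<open>u\<close> of \<open>U\<close> would
      put \<open>{u, v}\<close> into \<open>E\<close>, and then \<open>y\<close> would have a light
      edge to \<open>u\<close> as well.\<close>
    case 2
    have "W A U \<le> 1"
    proof (rule le[OF AB(1) UC(1) UC(2)[symmetric] 2(1)])
      fix a u assume au: "a \<in> A" "u \<in> U" "{a, u} \<in> dom (weight G)"
      have av: "a mod n = v" using au wy w by blast
      have "\<not> u < n"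
      proof
        assume "u < n"
        moreover have "a mod n \<noteq> u mod n" using diff au by blast
        ultimately have "{u, y mod n} \<in> E"
          using edge_diff_base[OF au(3)] av wy w by (simp add: insert_commute)
        then have "{u, y} \<in> dom (weight G)" using edge_light wy yN by blast
        then have "adjacent G B U"
          unfolding adjacent_iff using wy au(2) by (metis insert_commute singletonI)
        with 2 show False by blast
      qed
      then show "real (the (weight G {a, u})) \<le> 1"
        using edge_diff_base[OF au(3)] diff au by fastforce
    qed
    moreover have "W' (A \<union> B) U = W A U"
      using mb U(1) 2 unfolding merge_bounds_def by blast
    ultimately show ?thesis by (simp add: add_increasing2)
  next
    case 3
    moreover have "W' (A \<union> B) U = W B U"
      using mb U(1) 3 unfolding merge_bounds_def by blast
    ultimately show ?thesis using light by (simp add: add_increasing2)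
  qed
qed

text \<open>The conclusions are \<open>shape\<close>, \<open>first_phase\<close> and
  \<open>excess\<close> after the merge. Only \<open>merge_bounds\<close> and symmetry are assumed
  of \<open>W'\<close>, so both linkages are treated at once.\<close>

lemma merge_step:
  assumes lam: "2 * lam < 2 ^ k" "1 \<le> lam"
    and XY: "X \<in> \<C>" "Y \<in> \<C>" "X \<noteq> Y" "adjacent G X Y"
    and sim: "Max (similarities G \<C> W) / lam \<le> W X Y" "2 ^ k \<le> Max (similarities G \<C> W)"
    and mb: "merge_bounds G \<C> X Y W W'" and sym': "\<And>A B. W' A B = W' B A"
  defines "\<C>' \<equiv> insert (X \<union> Y) (\<C> - {X, Y})"
  shows "A \<in> \<C>' \<Longrightarrow> linked A \<or> (\<exists>v. column v A)"
    and "\<lbrakk>v \<in> covered E - S; {v} \<in> \<C>'; A \<in> \<C>'; x \<in> A; 2 \<le> x div n\<rbrakk> \<Longrightarrow> A = {x}"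
    and "\<lbrakk>A \<in> \<C>'; v \<in> A; v \<in> covered E - S; B \<in> \<C>'; B \<noteq> A; adjacent G A B; \<forall>y \<in> B. y mod n \<noteq> v\<rbrakk>
       \<Longrightarrow> W' A B \<le> 1 + 2 * 2 ^ k / 2 ^ card A"
proof -
  note cases = merge_cases[OF lam XY sim]
  show "linked A \<or> (\<exists>v. column v A)" if "A \<in> \<C>'"
  proof (cases "A = X \<union> Y")
    case True
    then show ?thesis
      using cases absorbs_column[of X Y] absorbs_column[of Y X] linked_merge[of X Y] Un_commute[of X Y]
      by metis
  next
    case False
    then show ?thesis using that shape unfolding \<C>'_def by blast
  qed
  show "A = {x}" if A: "v \<in> covered E - S" "{v} \<in> \<C>'" "A \<in> \<C>'" "x \<in> A" "2 \<le> x div n" for x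
  proof -
    have v: "{v} \<in> \<C>" using A not_singleton_merge[OF XY(1-3), of v] unfolding \<C>'_def by blast
    \<comment> \<open>As \<open>v\<close> was alone, the merge joined some base vertex to its
      centre, and neither of these lies in layer 2 or above.\<close>
    have nx: False if ab: "absorbs P Q" and x: "x \<in> P \<union> Q" for P Q
    proof -
      obtain w y where wy: "Q = {y}" "y mod n = w" "w \<in> covered E" "P = {w} \<and> y = n + w"
        using ab v A(1) unfolding absorbs_def by blast
      have "w < n" using wy Union_E_D by blast
      then show False using wy x A(5) by auto
    qed
    show ?thesis
    proof (cases "A = X \<union> Y")
      case True
      then show ?thesis using cases nx[of X Y] nx[of Y X] A v by blast
    next
      case False
      then show ?thesis using first_phase[OF A(1) v _ A(4,5)] A unfolding \<C>'_def by blast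
    qed
  qed
  show "W' A B \<le> 1 + 2 * 2 ^ k / 2 ^ card A"
    if A: "A \<in> \<C>'" "v \<in> A" "v \<in> covered E - S" "B \<in> \<C>'" "B \<noteq> A" "adjacent G A B"
      "\<forall>y \<in> B. y mod n \<noteq> v"
  proof -
    consider "A = X \<union> Y" "B \<in> \<C> - {X, Y}" | "B = X \<union> Y" "A \<in> \<C> - {X, Y}"
      | "A \<in> \<C> - {X, Y}" "B \<in> \<C> - {X, Y}"
      using A unfolding \<C>'_def by blast
    then show ?thesis
    proof cases
      case 1
      have "\<not> (linked X \<and> linked Y)" using A 1 unfolding linked_def by blast
      then consider "absorbs X Y" | "absorbs Y X" using cases by blast
      then show ?thesis
      proof cases
        assume "absorbs X Y"
        then show ?thesis
          using excess_absorbs[OF mb _ XY(1-3), of v B] A 1 by blast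
      next
        assume "absorbs Y X"
        then show ?thesis
          using excess_absorbs[OF merge_bounds_commute[OF mb] _ XY(2,1) XY(3)[symmetric], of v B] A 1
          by (metis Un_commute insert_commute)
      qed
    next
      \<comment> \<open>Now the neighbour is the merged cluster; \<open>A\<close> keeps its size,
        and a merge never yields more than the larger of the two old similarities.\<close>
      case 2
      have "W X A \<le> 1 + 2 * 2 ^ k / 2 ^ card A" if "adjacent G X A"
        using excess[of A v X] 2 A XY that sym[of X A] adjacent_commute[of G X A] by auto
      moreover have "W Y A \<le> 1 + 2 * 2 ^ k / 2 ^ card A" if "adjacent G Y A"
        using excess[of A v Y] 2 A XY that sym[of Y A] adjacent_commute[of G Y A] by auto
      ultimately have "W' (X \<union> Y) A \<le> 1 + 2 * 2 ^ k / 2 ^ card A"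
        using merge_bounds_le[OF mb 2(2)] A(6) 2(1) adjacent_commute[of G A B] by blast
      then show ?thesis using sym'[of A B] 2 by simp
    next
      case 3
      then have "W' A B = W A B" using mb unfolding merge_bounds_def by blast
      then show ?thesis using excess[of A v B] 3 A by auto
    qed
  qed
qed

end

lemma gadget_state_run:
  assumes G: "gadget n E S"
    and run: "hac_run L lam (gadget_graph n k E S) \<theta> \<C> W"
    and lam: "2 * lam < 2 ^ k" "1 \<le> lam" and \<theta>: "\<theta> = 2 ^ k"
  shows "gadget_state n k E S \<C> W"
proof -
  interpret gadget n k E S by fact
  note fin = finite_dom_weight_gadget[of n k E S]
  have intro: "gadget_state n k E S \<C> W"
    if run: "hac_run L lam G \<theta> \<C> W"
      and 1: "\<And>X. X \<in> \<C> \<Longrightarrow> linked X \<or> (\<exists>v. column v X)"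
      and 2: "\<And>v X x. \<lbrakk>v \<in> covered E - S; {v} \<in> \<C>; X \<in> \<C>; x \<in> X; 2 \<le> x div n\<rbrakk> \<Longrightarrow> X = {x}"
      and 3: "\<And>X v Y. \<lbrakk>X \<in> \<C>; v \<in> X; v \<in> covered E - S; Y \<in> \<C>; Y \<noteq> X; adjacent G X Y;
        \<forall>y \<in> Y. y mod n \<noteq> v\<rbrakk> \<Longrightarrow> W X Y \<le> 1 + 2 * 2 ^ k / 2 ^ card X"
    for \<C> W
  proof
    show "is_partition ((k + 2) * n) \<C>" using hac_run_partition[OF run] by simp
    show "W A B = W B A" for A B using hac_run_sim[OF run] by blast
    show "W A B \<le> M"
      if "A \<in> \<C>" "B \<in> \<C>" "A \<noteq> B" "adjacent G A B"
       "\<And>x y. x \<in> A \<Longrightarrow> y \<in> B \<Longrightarrow> {x, y} \<in> dom (weight G) \<Longrightarrow> real (the (weight G {x, y})) \<le> M" for A B M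
      using hac_run_bounds[OF run fin that(1-4), of M] that(5) unfolding crossing_def by blast
    show "M \<le> W A B"
      if "A \<in> \<C>" "B \<in> \<C>" "A \<noteq> B" "adjacent G A B"
       "\<And>x y. x \<in> A \<Longrightarrow> y \<in> B \<Longrightarrow> {x, y} \<in> dom (weight G) \<Longrightarrow> M \<le> real (the (weight G {x, y}))" for A B M
      using hac_run_bounds[OF run fin that(1-4), of M] that(5) unfolding crossing_def by blast
  qed (fact 1 2 3)+
  show ?thesis using run
  proof induction
    case start
    show ?case
    proof (rule intro[OF hac_run.start])
      fix X assume "X \<in> (\<lambda>v. {v}) ` {..<size_V G}"
      then obtain x where x: "X = {x}" "x < (k + 2) * n" by auto
      then have "n > 0" by (cases n) auto
      then show "linked X \<or> (\<exists>v. column v X)" using x unfolding column_def by auto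
    next
      fix X v Y
      assume A: "X \<in> (\<lambda>v. {v}) ` {..<size_V G}" "v \<in> X" "Y \<in> (\<lambda>v. {v}) ` {..<size_V G}"
        "Y \<noteq> X" "adjacent G X Y" "\<forall>y \<in> Y. y mod n \<noteq> v" "v \<in> covered E - S"
      then obtain y where y: "X = {v}" "Y = {y}" by auto
      \<comment> \<open>For a singleton the bound of \<open>excess\<close> reads
        \<open>1 + 2 ^ k\<close>.\<close>
      have "min_sim G X Y \<le> 2 ^ k"
      proof (rule conjunct1[OF hac_run_bounds[OF hac_run.start fin A(1,3) A(4)[symmetric] A(5)], rule_format])
        fix e assume "e \<in> crossing G X Y"
        then have e: "e = {v, y}" "{v, y} \<in> dom (weight G)" using y by (auto simp: crossing_def)
        have "v mod n \<noteq> y mod n" using A y Union_E_D by auto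
        then show "real (the (weight G e)) \<le> 2 ^ k" using edge_diff_base[OF e(2)] e(1) by fastforce
      qed
      then show "min_sim G X Y \<le> 1 + 2 * 2 ^ k / 2 ^ card X" using y by simp
    qed auto
  next
    case (merge \<C> W X Y)
    then interpret gadget_state n k E S \<C> W by blast
    \<comment> \<open>The run goes on only while some similarity reaches the threshold; this
      supplies the lower bound that keeps light edges from being used.\<close>
    have M: "2 ^ k \<le> Max (similarities G \<C> W)"
      using merge.hyps(2) sim_le_Max \<theta> by fastforce
    have mb: "merge_bounds G \<C> X Y W (merge_sim L G X Y W)"
      using hac_run_merge_bounds[OF merge.hyps(1) fin] merge.hyps by blast
    have run': "hac_run L lam G \<theta> (insert (X \<union> Y) (\<C> - {X, Y})) (merge_sim L G X Y W)"
      using hac_run.merge[OF merge.hyps] .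
    have "merge_sim L G X Y W A B = merge_sim L G X Y W B A" for A B
      using hac_run_sim[OF run'] by blast
    note step = merge_step[OF lam merge.hyps(3-7) M mb this]
    show ?case
      by (rule intro[OF run']) (fact step)+
  qed
qed

text \<open>The number of clusters that do not meet \<open>S\<close>: one for every centre of a gadget, and one for
  every untouched vertex above an isolated vertex, except the isolated vertices in \<open>S\<close> themselves.\<close>

definition other_clusters :: "nat \<Rightarrow> nat \<Rightarrow> nat set set \<Rightarrow> nat set \<Rightarrow> nat" where
  "other_clusters n k E S =
     card (covered E) + (n - card (covered E)) * (k + 2) - card (S - covered E)"

section \<open>Counting the clusters that avoid \<open>S\<close>\<close>

context gadget
begin

lemma finite_covered: "finite (covered E)"
  using Union_E_D by (meson finite_nat_set_iff_bounded)

text \<open>A transversal of the final clusters that avoid \<open>S\<close>: a centre stands for its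
  star, whether or not the base vertex has joined it, and whatever lies above an isolated vertex
  stays alone.\<close>

definition representatives :: "nat set" where
  "representatives = (\<lambda>v. n + v) ` covered E \<union>
     ({x. x < (k + 2) * n \<and> x mod n \<notin> covered E} - S)"

lemma card_representatives: "card representatives = other_clusters n k E S"
proof -
  let ?I = "{x. x < (k + 2) * n \<and> x mod n \<notin> covered E}"
  have "?I = (\<Union>v \<in> {..<n} - covered E. {x. x < (k + 2) * n \<and> x mod n = v})"
    by (cases "n = 0") auto
  moreover have "card (\<Union>v \<in> {..<n} - covered E. {x. x < (k + 2) * n \<and> x mod n = v}) =
      (\<Sum>v \<in> {..<n} - covered E. card {x. x < (k + 2) * n \<and> x mod n = v})"
    by (intro card_UN_disjoint) auto
  moreover have "\<dots> = (\<Sum>v \<in> {..<n} - covered E. k + 2)"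
    by (intro sum.cong refl card_column) auto
  moreover have "card ({..<n} - covered E) = n - card (covered E)"
    using Union_E_D finite_covered by (subst card_Diff_subset) auto
  ultimately have cI: "card ?I = (n - card (covered E)) * (k + 2)" by simp
  have "?I - S = ?I - (S - covered E)"
  proof -
    have "x \<notin> covered E" if "x \<in> ?I" "x \<in> S" for x
      using that S by auto
    then show ?thesis by auto
  qed
  moreover have sub: "S - covered E \<subseteq> ?I" using S by auto
  moreover have fin: "finite (S - covered E)" using S finite_subset by blast
  ultimately have cIS: "card (?I - S) = (n - card (covered E)) * (k + 2) - card (S - covered E)"
    using card_Diff_subset[OF fin sub] cI by simp
  have "card ((\<lambda>v. n + v) ` covered E) = card (covered E)"
    by (intro card_image) auto
  moreover have "(\<lambda>v. n + v) ` covered E \<inter> (?I - S) = {}"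
    using Union_E_D by auto
  moreover have "finite ?I" by simp
  ultimately have "card representatives = card (covered E) + card (?I - S)"
    unfolding representatives_def using finite_covered by (subst card_Un_disjoint) auto
  \<comment> \<open>Lets the truncated subtraction be pulled out of the sum.\<close>
  moreover have "card (S - covered E) \<le> card ?I" by (rule card_mono[OF _ sub]) simp
  ultimately show ?thesis using cI cIS unfolding other_clusters_def by simp
qed

end

section \<open>Clusterings in which no similarity reaches the threshold\<close>

locale final_state = gadget_state +
  assumes final: "\<forall>x \<in> similarities G \<C> W. x < 2 ^ k"
begin

lemma outside_not_singleton: "v \<in> covered E - S \<Longrightarrow> {v} \<notin> \<C>"
proof
  assume "v \<in> covered E - S" "{v} \<in> \<C>"
  then obtain x :: real where "x < 2 ^ k" "2 ^ k * 2 ^ k * 2 ^ k \<le> x"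
    using first_phase_sim final by blast
  moreover have "(2 :: real) ^ k * 1 \<le> 2 ^ k * (2 ^ k * 2 ^ k)"
    by (intro mult_left_mono) (auto simp: power_add[symmetric])
  ultimately show False by simp
qed

lemma leaf_not_singleton: "x mod n \<in> covered E \<Longrightarrow> 2 \<le> x div n \<Longrightarrow> {x} \<notin> \<C>"
proof
  assume "x mod n \<in> covered E" "2 \<le> x div n" "{x} \<in> \<C>"
  then obtain x :: real where "x < 2 ^ k" "2 ^ k * 2 ^ k \<le> x"
    using leaf_sim final by blast
  moreover have "(2 :: real) ^ k * 1 \<le> 2 ^ k * 2 ^ k"
    by (intro mult_left_mono) auto
  ultimately show False by simp
qed

text \<open>A vertex of \<open>S\<close> lies in layer 0, so in a column it could only be the base
  vertex, and a column of several vertices contains its base vertex only outside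
  \<open>S\<close>.\<close>

lemma meets_S_linked:
  assumes "A \<in> \<C>" "u \<in> A" "u \<in> S"
  shows "linked A"
proof (rule ccontr)
  assume nl: "\<not> linked A"
  then obtain v where col: "column v A" using shape assms by blast
  have "u < n" using assms S by blast
  then have u: "u = v" using col assms unfolding column_def by auto
  have "A \<noteq> {u}" using nl assms \<open>u < n\<close> unfolding linked_def by auto
  then obtain y where "y \<in> A" "y \<noteq> u" using assms by blast
  then show False using column_centre[OF col] assms u by blast
qed

text \<open>Linked clusters consist of original vertices, so every crossing edge weighs exactly
  \<open>2 ^ k\<close> and no light edge can pull the similarity below the threshold.\<close>

lemma S_neighbours:
  assumes "A \<in> \<C>" "u \<in> A" "B \<in> \<C>" "v \<in> B" "u \<in> S" "v \<in> S" "{u, v} \<in> E"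
  shows "A = B"
proof (rule ccontr)
  assume ne: "A \<noteq> B"
  have adj: "adjacent G A B" unfolding adjacent_iff using edge_main[OF assms(7)] assms by blast
  have l: "linked A" "linked B" using meets_S_linked assms by blast+
  have "2 ^ k \<le> W A B"
  proof (rule ge[OF assms(1,3) ne adj])
    fix x y assume xy: "x \<in> A" "y \<in> B" "{x, y} \<in> dom (weight G)"
    then have "x < n" "y < n" using l unfolding linked_def by blast+
    moreover from this have "x mod n \<noteq> y mod n" using edge_lt[OF xy(3)] by simp
    ultimately show "2 ^ k \<le> real (the (weight G {x, y}))"
      using edge_diff_base[OF xy(3)] by fastforce
  qed
  then show False using final similarity_in[OF assms(1,3) ne adj] by fastforce
qed

lemma conn_same_cluster:
  assumes "A \<in> \<C>" "s \<in> A" "(s, t) \<in> conn"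
  shows "t \<in> A"
  using assms(3)
proof (induction rule: rtrancl_induct)
  case base
  then show ?case using assms by blast
next
  case (step u v)
  then have uv: "u \<in> S" "v \<in> S" "{u, v} \<in> E" by (auto simp: induced_adj_iff)
  then have "v < n" using S by blast
  then obtain B where "B \<in> \<C>" "v \<in> B" using cover[OF lt_size] by blast
  then show ?case using S_neighbours[OF assms(1) step.IH _ _ uv] by blast
qed

theorem same_cluster_iff:
  assumes "s \<in> S" "t < n"
  shows "(\<exists>X \<in> \<C>. s \<in> X \<and> t \<in> X) \<longleftrightarrow> (s, t) \<in> conn"
proof
  assume "\<exists>X \<in> \<C>. s \<in> X \<and> t \<in> X"
  then show "(s, t) \<in> conn" using meets_S_linked assms unfolding linked_def by blast
next
  assume st: "(s, t) \<in> conn"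
  have "s < n" using assms S by blast
  then obtain X where "X \<in> \<C>" "s \<in> X" using cover[OF lt_size] by blast
  then show "\<exists>X \<in> \<C>. s \<in> X \<and> t \<in> X" using conn_same_cluster[OF _ _ st] by blast
qed

abbreviation "meeting \<equiv> {X \<in> \<C>. X \<inter> S \<noteq> {}}"

lemma connected_iff_meeting:
  "induced_connected (vsub n E S) \<longleftrightarrow> card meeting \<le> 1"
proof -
  have fin: "finite meeting" using is_partition_finite[OF part] by simp
  have "(\<forall>s \<in> S. \<forall>t \<in> S. (s, t) \<in> conn) \<longleftrightarrow> (\<forall>A \<in> meeting. \<forall>B \<in> meeting. A = B)"
  proof (intro iffI ballI)
    fix A B assume c: "\<forall>s \<in> S. \<forall>t \<in> S. (s, t) \<in> conn" and AB: "A \<in> meeting" "B \<in> meeting"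
    then obtain s t where st: "s \<in> A" "s \<in> S" "t \<in> B" "t \<in> S" by blast
    then have "t \<in> A" using conn_same_cluster[of A s t] AB c by blast
    then show "A = B" using same[of A B t] AB st by blast
  next
    fix s t assume c: "\<forall>A \<in> meeting. \<forall>B \<in> meeting. A = B" and st: "s \<in> S" "t \<in> S"
    then have "s < n" "t < n" using S by blast+
    obtain A where A: "A \<in> \<C>" "s \<in> A" using cover[OF lt_size[OF \<open>s < n\<close>]] .
    obtain B where B: "B \<in> \<C>" "t \<in> B" using cover[OF lt_size[OF \<open>t < n\<close>]] .
    have "A \<in> meeting" "B \<in> meeting" using A B st by blast+
    then have "A = B" using c by blast
    then show "(s, t) \<in> conn" using same_cluster_iff[OF st(1) \<open>t < n\<close>] A B by blast
  qed
  also have "\<dots> \<longleftrightarrow> card meeting \<le> 1" using card_le_Suc0_iff_eq[OF fin] by simp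
  finally show ?thesis by (simp add: induced_connected_def connected_in_def)
qed

text \<open>All vertices of the cluster are connected to one in \<open>S\<close> and hence are in
  \<open>S\<close>, whereas a representative lies above layer 0 or outside \<open>S\<close>.\<close>

lemma meeting_no_representative:
  assumes "X \<in> meeting"
  shows "X \<inter> representatives = {}"
proof -
  obtain u where u: "u \<in> X" "u \<in> S" "X \<in> \<C>" using assms by blast
  have l: "linked X" using meets_S_linked u by blast
  have "x \<notin> representatives" if x: "x \<in> X" for x
  proof -
    have xn: "x < n" using l x unfolding linked_def by blast
    have "(u, x) \<in> conn" using l u x unfolding linked_def by blast
    then have "x \<in> S" using conn_isolated u by blast
    then show ?thesis using xn unfolding representatives_def by auto
  qed
  then show ?thesis by blast
qed

text \<open>A lone vertex must be a centre or lie above an isolated vertex, since lone leaves and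
  lone base vertices outside \<open>S\<close> have been excluded in covered columns. A larger
  cluster is a column and is represented by its centre.\<close>

lemma other_one_representative:
  assumes "X \<in> \<C> - meeting"
  shows "card (X \<inter> representatives) = 1"
proof -
  have X: "X \<in> \<C>" "X \<inter> S = {}" using assms by blast+
  then obtain x where x: "x \<in> X" using nonempty by blast
  have xN: "x < (k + 2) * n" using cluster_lt X x by blast
  have "\<exists>r. X \<inter> representatives = {r}"
  proof (cases "X = {x}")
    case True
    have "x \<in> representatives"
    proof (cases "x mod n \<in> covered E")
      case True
      have "x mod n < n" using True Union_E_D by blast
      have eq: "x = (x div n) * n + x mod n" by (metis div_mult_mod_eq)
      have "x div n \<noteq> 0"
      proof
        assume "x div n = 0"
        then have "x = x mod n" using eq by simp
        then have "x \<in> covered E - S" using True X x by auto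
        then show False using outside_not_singleton X \<open>X = {x}\<close> by blast
      qed
      moreover have "\<not> 2 \<le> x div n" using leaf_not_singleton True X \<open>X = {x}\<close> by blast
      ultimately have "x div n = 1" by simp
      then have "x = n + x mod n" using eq by simp
      then show ?thesis using True unfolding representatives_def by blast
    next
      case False
      then show ?thesis using xN X x unfolding representatives_def by blast
    qed
    then show ?thesis using True by blast
  next
    case False
    then obtain y where y: "y \<in> X" "y \<noteq> x" using x by blast
    have "\<not> linked X"
    proof
      assume "linked X"
      then have "(x, y) \<in> conn" using x y unfolding linked_def by blast
      then show False using conn_isolated X x y by blast
    qed
    then obtain v where col: "column v X" using shape X by blast
    have c: "n + v \<in> X" "v \<in> covered E" using column_centre[OF col x y(1)] y by blast+
    have "v < n" using c Union_E_D by blast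
    have "r = n + v" if r: "r \<in> X" "r \<in> representatives" for r
    proof -
      have "r mod n = v" using col r unfolding column_def by blast
      then obtain u where "r = n + u" "u \<in> covered E"
        using r c unfolding representatives_def by blast
      moreover from this have "u < n" using Union_E_D by blast
      ultimately show ?thesis using \<open>r mod n = v\<close> by simp
    qed
    moreover have "n + v \<in> representatives" using c unfolding representatives_def by blast
    ultimately have "X \<inter> representatives = {n + v}" using c by blast
    then show ?thesis by blast
  qed
  then show ?thesis by auto
qed

theorem card_clusters: "card \<C> = other_clusters n k E S + card meeting"
proof -
  have fin: "finite \<C>" using is_partition_finite[OF part] .
  have "representatives \<subseteq> {..<(k + 2) * n}"
    using Union_E_D unfolding representatives_def by (auto simp: trans_less_add1)
  then have lt: "x < (k + 2) * n" if "x \<in> representatives" for x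
    using that by blast
  have "representatives = (\<Union>X \<in> \<C> - meeting. X \<inter> representatives)"
  proof (intro equalityI subsetI)
    fix x assume x: "x \<in> representatives"
    obtain X where X: "X \<in> \<C>" "x \<in> X" using cover[OF lt[OF x]] .
    then have "X \<notin> meeting" using meeting_no_representative[of X] x by blast
    with X x show "x \<in> (\<Union>X \<in> \<C> - meeting. X \<inter> representatives)" by blast
  qed blast
  then have "card representatives = card (\<Union>X \<in> \<C> - meeting. X \<inter> representatives)"
    by simp
  also have "\<dots> = (\<Sum>X \<in> \<C> - meeting. card (X \<inter> representatives))"
  proof (rule card_UN_disjoint)
    show "finite (\<C> - meeting)" using fin by blast
    show "\<forall>X \<in> \<C> - meeting. finite (X \<inter> representatives)" using finite_cluster by blast
    show "\<forall>X \<in> \<C> - meeting. \<forall>Y \<in> \<C> - meeting. X \<noteq> Y \<longrightarrow>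
        (X \<inter> representatives) \<inter> (Y \<inter> representatives) = {}"
      using same by blast
  qed
  also have "\<dots> = card (\<C> - meeting)" using other_one_representative by simp
  finally have "card (\<C> - meeting) = other_clusters n k E S"
    using card_representatives by simp
  moreover have "card \<C> = card (\<C> - meeting) + card meeting"
    using fin by (subst card_Diff_subset) (auto simp: card_mono)
  ultimately show ?thesis by simp
qed

end

lemma final_state_result:
  assumes "gadget n E S" "hac_result L lam (gadget_graph n k E S) (real (2 ^ k)) \<C>"
    and "2 * lam < 2 ^ k" "1 \<le> lam"
  shows "\<exists>W. final_state n k E S \<C> W"
proof -
  obtain W where W: "hac_run L lam (gadget_graph n k E S) (real (2 ^ k)) \<C> W"
    "\<forall>x \<in> similarities (gadget_graph n k E S) \<C> W. x < real (2 ^ k)"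
    using assms(2) unfolding hac_result_def by blast
  then have "gadget_state n k E S \<C> W"
    using gadget_state_run[OF assms(1) W(1) assms(3,4)] by simp
  then have "final_state n k E S \<C> W"
    using W(2) by (simp add: final_state_def final_state_axioms_def)
  then show ?thesis by blast
qed

lemma hac_answer:
  assumes G: "gadget n E S" and r: "hac_result L lam (gadget_graph n k E S) (real (2 ^ k)) \<C>"
    and lam: "2 * lam < 2 ^ k" "1 \<le> lam" and st: "s \<in> S" "t < n"
  shows "(\<exists>X \<in> \<C>. s \<in> X \<and> t \<in> X) \<longleftrightarrow> connected_in (vsub n E S) s t"
proof -
  obtain W where "final_state n k E S \<C> W" using final_state_result[OF G r lam] by blast
  then interpret final_state n k E S \<C> W .
  have "(s, t) \<in> conn \<Longrightarrow> t \<in> S" using conn_isolated st by blast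
  then show ?thesis using same_cluster_iff[OF st] st by (auto simp: connected_in_def)
qed

text \<open>The \<open>+ 2\<close> turns "at most one cluster meets \<open>S\<close>" into a strict
  comparison, as provided by \<open>Lt\<close>; for empty \<open>S\<close> no cluster does.\<close>

lemma num_hac_answer:
  assumes G: "gadget n E S" and r: "hac_result L lam (gadget_graph n k E S) (real (2 ^ k)) \<C>"
    and lam: "2 * lam < 2 ^ k" "1 \<le> lam"
  shows "card \<C> < other_clusters n k E S + 2 \<longleftrightarrow>
    induced_connected (vsub n E S)"
proof -
  obtain W where "final_state n k E S \<C> W" using final_state_result[OF G r lam] by blast
  then interpret final_state n k E S \<C> W .
  show ?thesis using card_clusters connected_iff_meeting by auto
qed

section \<open>The edge list of the gadget graph\<close>

declare upt_Suc [simp del]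

text \<open>In the order in which the loops of the program emit the edges, so that the list grows by
  appending. Layer 1 is the centre, the higher ones are leaves.\<close>

definition edge_chunk :: "nat \<Rightarrow> nat \<Rightarrow> nat \<times> nat \<Rightarrow> (nat \<times> nat \<times> nat) list" where
  "edge_chunk n k = (\<lambda>(u, v). (u, v, 2 ^ k) #
     concat (map (\<lambda>l. [(u, l * n + v, 1), (v, l * n + u, 1)]) [1..<k + 2]))"

definition vertex_chunk :: "nat \<Rightarrow> nat \<Rightarrow> nat set \<Rightarrow> nat \<Rightarrow> (nat \<times> nat \<times> nat) list" where
  "vertex_chunk n k S v = map (\<lambda>l. (n + v, l * n + v, 2 ^ k * 2 ^ k)) [2..<k + 2] @
     (if v \<in> S then [] else [(v, n + v, 2 ^ k * 2 ^ k * 2 ^ k)])"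

text \<open>The order of \<open>vs\<close> is left open because the program discovers the covered
  vertices while scanning the edge list.\<close>

definition gadget_edges ::
  "nat \<Rightarrow> nat \<Rightarrow> nat set \<Rightarrow> (nat \<times> nat) list \<Rightarrow> nat list \<Rightarrow> (nat \<times> nat \<times> nat) list" where
  "gadget_edges n k S es vs = concat (map (edge_chunk n k) es) @ concat (map (vertex_chunk n k S) vs)"

abbreviation edges_mem :: "nat \<Rightarrow> (nat \<times> nat \<times> nat) list \<Rightarrow> mem" where
  "edges_mem N T \<equiv> input_mem [N, length T] (map (\<lambda>(x, y, z). (x, y)) T) (map (\<lambda>(x, y, z). z) T)"

definition ends :: "nat \<times> nat \<times> nat \<Rightarrow> nat set" where
  "ends = (\<lambda>(x, y, z). {x, y})"

text \<open>\<open>\<sigma>\<close> recovers from an image the key \<open>\<tau> x\<close> of the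
  chunk it came from, so chunks with different keys cannot overlap.\<close>

lemma distinct_map_concat:
  assumes "distinct (map \<tau> xs)" "\<And>x. x \<in> set xs \<Longrightarrow> distinct (map g (f x))"
    and "\<And>x t. x \<in> set xs \<Longrightarrow> t \<in> set (f x) \<Longrightarrow> \<sigma> (g t) = \<tau> x"
  shows "distinct (map g (concat (map f xs)))"
  using assms
proof (induction xs)
  case (Cons x xs)
  have "g t \<noteq> g t'" if "t \<in> set (f x)" "y \<in> set xs" "t' \<in> set (f y)" for t y t'
  proof
    assume "g t = g t'"
    then have "\<tau> x = \<tau> y" using Cons.prems(3)[of x t] Cons.prems(3)[of y t'] that by simp
    then show False using Cons.prems(1) that(2) by auto
  qed
  then show ?case using Cons by fastforce
qed simp

lemma length_edge_chunk: "length (edge_chunk n k e) = 2 * k + 3"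
proof -
  have "length (concat (map (\<lambda>l. [a l, b l]) xs)) = 2 * length xs" for a b :: "nat \<Rightarrow> nat \<times> nat \<times> nat" and xs
    by (induction xs) auto
  then show ?thesis by (simp add: edge_chunk_def split: prod.split)
qed

lemma length_vertex_chunk: "length (vertex_chunk n k S v) \<le> k + 1"
  by (simp add: vertex_chunk_def)

lemma length_gadget_edges:
  "length (gadget_edges n k S es vs) \<le> length es * (2 * k + 3) + length vs * (k + 1)"
proof -
  have "length (concat (map (edge_chunk n k) es)) = length es * (2 * k + 3)"
    by (induction es) (auto simp: length_edge_chunk)
  moreover have "length (concat (map (vertex_chunk n k S) vs)) \<le> length vs * (k + 1)"
  proof (induction vs)
    case (Cons v vs)
    then show ?case using length_vertex_chunk[of n k S v] by simp
  qed simp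
  ultimately show ?thesis by (simp add: gadget_edges_def)
qed

lemma covered_edge_list:
  assumes "edge_list es E"
  shows "covered E = fst ` set es \<union> snd ` set es"
proof -
  have "E = (\<lambda>(u, v). {u, v}) ` set es" using assms by (simp add: edge_list_def)
  then show ?thesis unfolding covered_def by (force simp: split_beta)
qed

context gadget
begin

lemma edge_light_weight:
  assumes "{u, v} \<in> E" "1 \<le> l" "l < k + 2"
  shows "weight G {u, l * n + v} = Some 1"
proof -
  have uv: "u < n" "v < n" "u \<noteq> v" using E_D[OF assms(1)] by auto
  have "(l * n + v) mod n = v" using uv by simp
  moreover have "l * n + n \<le> (k + 2) * n"
    using assms(3) by (metis Suc_leI add.commute mult_Suc mult_le_mono1)
  moreover have "n \<le> l * n" using assms(2) by simp
  ultimately have m: "(l * n + v) mod n = v" and lt: "n \<le> l * n + v" "l * n + v < (k + 2) * n"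
    using uv by linarith+
  then have "{u, l * n + v} \<in> dom (weight G)"
    using edge_light[of u "l * n + v"] assms(1) by simp
  then show ?thesis using edge_diff_base[of u "l * n + v"] uv m lt by auto
qed

lemma gadget_edges_weight:
  assumes es: "edge_list es E" and vs: "set vs = covered E"
    and t: "(x, y, z) \<in> set (gadget_edges n k S es vs)"
  shows "weight G {x, y} = Some z"
proof -
  consider u v where "(u, v) \<in> set es" "(x, y, z) \<in> set (edge_chunk n k (u, v))"
    | v where "v \<in> covered E" "(x, y, z) \<in> set (vertex_chunk n k S v)"
    using t vs unfolding gadget_edges_def by auto
  then show ?thesis
  proof cases
    case (1 u v)
    then have uv: "{u, v} \<in> E" "{v, u} \<in> E"
      using es unfolding edge_list_def by (force simp: insert_commute)+
    from 1(2) consider "(x, y, z) = (u, v, 2 ^ k)"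
      | l where "1 \<le> l" "l < k + 2" "(x, y, z) = (u, l * n + v, 1) \<or> (x, y, z) = (v, l * n + u, 1)"
      unfolding edge_chunk_def by auto
    then show ?thesis
      using edge_main[OF uv(1)] edge_light_weight[OF uv(1)] edge_light_weight[OF uv(2)] by cases auto
  next
    case (2 v)
    then have v: "v < n" "v \<in> covered E" using Union_E_D by blast+
    from 2(2) consider l where "2 \<le> l" "l < k + 2" "x = n + v" "y = l * n + v" "z = 2 ^ k * 2 ^ k"
      | "v \<notin> S" "x = v" "y = n + v" "z = 2 ^ k * 2 ^ k * 2 ^ k"
      unfolding vertex_chunk_def by (auto split: if_splits)
    then show ?thesis
    proof cases
      case (1 l)
      have "y mod n = v" "2 \<le> y div n" using 1 v by simp_all
      moreover have "l * n + n \<le> (k + 2) * n"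
        using 1(2) by (metis Suc_leI add.commute mult_Suc mult_le_mono1)
      ultimately show ?thesis
        using edge_leaf[of y] 1 v by (simp add: insert_commute)
    next
      case 2
      then show ?thesis using edge_centre v by blast
    qed
  qed
qed

lemma gadget_edges_complete:
  assumes es: "edge_list es E" and vs: "set vs = covered E"
    and e: "e \<in> dom (weight G)"
  shows "e \<in> ends ` set (gadget_edges n k S es vs)"
proof -
  obtain x y where xy: "e = {x, y}" "x < (k + 2) * n" "y < (k + 2) * n" "x \<noteq> y"
    using dom_weight_gadgetE[OF e] by blast
  have dom: "{x, y} \<in> dom (weight G)" using e xy by simp
  have n: "n > 0" using xy by (cases n) auto
  have lay: "x div n < k + 2" "y div n < k + 2"
    using xy by (auto simp: less_mult_imp_div_less)
  have inV: "(a, b, c) \<in> set (gadget_edges n k S es vs)"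
    if "(a, b, c) \<in> set (vertex_chunk n k S v)" "v \<in> covered E" for a b c v
    using that vs unfolding gadget_edges_def by auto
  \<comment> \<open>The list fixes an orientation of each edge that is not known here; therefore
    \<open>ch\<close> is required for both.\<close>
  have inE: "{a, b} \<in> ends ` set (gadget_edges n k S es vs)"
    if ch: "\<And>u v. {u, v} = d \<Longrightarrow> {a, b} \<in> ends ` set (edge_chunk n k (u, v))" and d: "d \<in> E" for a b d
  proof -
    obtain u v where uv: "(u, v) \<in> set es" "{u, v} = d"
      using d es unfolding edge_list_def by force
    then have "{a, b} \<in> ends ` set (edge_chunk n k (u, v))" using ch by blast
    then show ?thesis using uv unfolding gadget_edges_def by auto
  qed
  show ?thesis
  proof (cases "x mod n = y mod n")
    case True
    define v where "v = y mod n"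
    have xv: "x mod n = v" "y mod n = v" using True v_def by auto
    have v: "v < n" using n v_def by simp
    have leaf: "(n + v, b, 2 ^ k * 2 ^ k) \<in> set (vertex_chunk n k S v)"
      if "b mod n = v" "2 \<le> b div n" "b div n < k + 2" for b
    proof -
      have "b = (b div n) * n + v" using that(1) by (metis div_mult_mod_eq)
      then show ?thesis using that unfolding vertex_chunk_def by auto
    qed
    have centre: "(v, n + v, 2 ^ k * 2 ^ k * 2 ^ k) \<in> set (vertex_chunk n k S v)" if "v \<notin> S"
      using that unfolding vertex_chunk_def by simp
    have cov: "v \<in> covered E" using edge_same_base[OF dom xv] by blast
    consider "x = n + v" "2 \<le> y div n" | "y = n + v" "2 \<le> x div n"
      | "v \<notin> S" "e = {v, n + v}"
      using edge_same_base[OF dom xv] xy(1) by auto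
    then show ?thesis
    proof cases
      case 1
      then have "ends (n + v, y, 2 ^ k * 2 ^ k) = e" by (simp add: ends_def xy)
      then show ?thesis using inV[OF leaf[of y] cov] 1 xv lay by blast
    next
      case 2
      then have "ends (n + v, x, 2 ^ k * 2 ^ k) = e" by (simp add: ends_def xy insert_commute)
      then show ?thesis using inV[OF leaf[of x] cov] 2 xv lay by blast
    next
      case 3
      then have "ends (v, n + v, 2 ^ k * 2 ^ k * 2 ^ k) = e" by (simp add: ends_def)
      then show ?thesis using inV[OF centre cov] 3 by blast
    qed
  next
    case False
    then have E': "{x mod n, y mod n} \<in> E" "x < n \<or> y < n" using edge_diff_base[OF dom] by auto
    have light: "{a, l * n + b} \<in> ends ` set (edge_chunk n k (u, v))"
      if "{u, v} = {a, b}" "1 \<le> l" "l < k + 2" for a b l u v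
    proof -
      have "(u, l * n + v, 1) \<in> set (edge_chunk n k (u, v))"
        "(v, l * n + u, 1) \<in> set (edge_chunk n k (u, v))"
        using that unfolding edge_chunk_def by force+
      then have "ends (u, l * n + v, 1) \<in> ends ` set (edge_chunk n k (u, v))"
        "ends (v, l * n + u, 1) \<in> ends ` set (edge_chunk n k (u, v))" by blast+
      moreover have "ends (u, l * n + v, 1) = {u, l * n + v}" "ends (v, l * n + u, 1) = {v, l * n + u}"
        by (simp_all add: ends_def)
      moreover have "u = a \<and> v = b \<or> u = b \<and> v = a" using that(1) by (auto simp: doubleton_eq_iff)
      ultimately show ?thesis by auto
    qed
    have layer: "1 \<le> a div n" if "\<not> a < n" for a
      using that n by (simp add: Suc_le_eq div_greater_zero_iff)
    consider "x < n" "y < n" | "x < n" "\<not> y < n" | "\<not> x < n" "y < n" using E' by blast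
    then show ?thesis
    proof cases
      case 1
      have "{x, y} \<in> ends ` set (edge_chunk n k (u, v))" if "{u, v} = {x, y}" for u v
      proof -
        have "ends (u, v, 2 ^ k) \<in> ends ` set (edge_chunk n k (u, v))"
          unfolding edge_chunk_def by simp
        then show ?thesis using that by (simp add: ends_def)
      qed
      then show ?thesis using inE[of "{x, y}" x y] E' 1 xy(1) by simp
    next
      case 2
      have "{x, (y div n) * n + y mod n} \<in> ends ` set (gadget_edges n k S es vs)"
        using inE[OF light[of _ _ x "y mod n" "y div n"], of "{x, y mod n}"] E'(1) 2 lay layer by simp
      then show ?thesis using xy(1) by simp
    next
      case 3
      have "{y, (x div n) * n + x mod n} \<in> ends ` set (gadget_edges n k S es vs)"
        using inE[OF light[of _ _ y "x mod n" "x div n"], of "{y, x mod n}"] E'(1) 3 lay layer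
        by (simp add: insert_commute)
      then show ?thesis using xy(1) by (simp add: insert_commute)
    qed
  qed
qed

lemma distinct_edge_chunk:
  assumes "{u, v} \<in> E"
  shows "distinct (map ends (edge_chunk n k (u, v)))"
proof -
  have uv: "u < n" "v < n" "u \<noteq> v" using E_D[OF assms] by auto
  let ?c = "concat (map (\<lambda>l. [(u, l * n + v, 1 :: nat), (v, l * n + u, 1)]) [1..<k + 2])"
  have "distinct (map ends ?c)"
  \<comment> \<open>Of the two ends of a light edge one is in layer 0, so the larger layer recovers
    \<open>l\<close>.\<close>
  proof (rule distinct_map_concat[where \<tau> = "\<lambda>l. l" and \<sigma> = "\<lambda>e. Max ((\<lambda>x. x div n) ` e)"])
    show "distinct (map (\<lambda>l. l) [1..<k + 2])" by simp
    show "distinct (map ends [(u, l * n + v, 1 :: nat), (v, l * n + u, 1)])" if "l \<in> set [1..<k + 2]" for l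
      using that uv by (auto simp: ends_def doubleton_eq_iff)
    show "Max ((\<lambda>x. x div n) ` ends t) = l"
      if "l \<in> set [1..<k + 2]" "t \<in> set [(u, l * n + v, 1 :: nat), (v, l * n + u, 1)]" for l t
      using that uv by (auto simp: ends_def)
  qed
  moreover have "{u, v} \<notin> set (map ends ?c)"
  proof
    assume "{u, v} \<in> set (map ends ?c)"
    then obtain l where l: "1 \<le> l" "{u, v} = {u, l * n + v} \<or> {u, v} = {v, l * n + u}"
      by (auto simp: ends_def)
    then have "n \<le> l * n" by simp
    then show False using l(2) uv by (auto simp: doubleton_eq_iff)
  qed
  ultimately show ?thesis by (simp add: edge_chunk_def ends_def)
qed

lemma distinct_vertex_chunk:
  assumes "v < n"
  shows "distinct (map ends (vertex_chunk n k S v))"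
proof -
  have "distinct (map (\<lambda>l. {n + v, l * n + v}) [2..<k + 2])"
  proof -
    have "inj_on (\<lambda>l. {n + v, l * n + v}) {2..<k + 2}"
      using assms by (auto simp: inj_on_def doubleton_eq_iff)
    then show ?thesis by (simp add: distinct_map)
  qed
  moreover have "{v, n + v} \<notin> set (map (\<lambda>l. {n + v, l * n + v}) [2..<k + 2])"
    using assms by (auto simp: doubleton_eq_iff)
  ultimately show ?thesis
    by (simp add: vertex_chunk_def ends_def comp_def del: set_map)
qed

text \<open>The set of columns touched by an edge serves as the key: \<open>{u, v}\<close> in the
  chunk of an edge, a singleton in the chunk of a vertex.\<close>

lemma distinct_gadget_edges:
  assumes es: "edge_list es E" and vs: "set vs = covered E" "distinct vs"
  shows "distinct (map ends (gadget_edges n k S es vs))"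
proof -
  let ?\<sigma> = "\<lambda>e. (\<lambda>x. x mod n) ` e"
  have E': "{u, v} \<in> E" if "(u, v) \<in> set es" for u v
    using es that unfolding edge_list_def by force
  have 1: "?\<sigma> (ends t) = {u, v}" if "(u, v) \<in> set es" "t \<in> set (edge_chunk n k (u, v))" for u v t
  proof -
    have "u < n" "v < n" using E_D[OF E'[OF that(1)]] by auto
    then show ?thesis using that(2) by (auto simp: edge_chunk_def ends_def)
  qed
  have 2: "?\<sigma> (ends t) = {v}" if "v \<in> covered E" "t \<in> set (vertex_chunk n k S v)" for v t
    using that Union_E_D[of v] by (auto simp: vertex_chunk_def ends_def split: if_splits)
  have "distinct (map ends (concat (map (edge_chunk n k) es)))"
  proof (rule distinct_map_concat[where \<tau> = "\<lambda>(u, v). {u, v}" and \<sigma> = ?\<sigma>])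
    show "distinct (map (\<lambda>(u, v). {u, v}) es)" using es by (simp add: edge_list_def)
    show "distinct (map ends (edge_chunk n k e))" if "e \<in> set es" for e
      using distinct_edge_chunk E' that by (cases e) blast
    show "?\<sigma> (ends t) = (case e of (u, v) \<Rightarrow> {u, v})" if "e \<in> set es" "t \<in> set (edge_chunk n k e)" for e t
      using 1 that by (cases e) blast
  qed
  moreover have "distinct (map ends (concat (map (vertex_chunk n k S) vs)))"
  proof (rule distinct_map_concat[where \<tau> = "\<lambda>v. {v}" and \<sigma> = ?\<sigma>])
    show "distinct (map (\<lambda>v. {v}) vs)" using vs by (simp add: distinct_map inj_on_def)
    show "distinct (map ends (vertex_chunk n k S v))" if "v \<in> set vs" for v
      using distinct_vertex_chunk Union_E_D vs that by blast
    show "?\<sigma> (ends t) = {v}" if "v \<in> set vs" "t \<in> set (vertex_chunk n k S v)" for v t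
      using 2 vs that by blast
  qed
  moreover have "ends t \<noteq> ends t'"
    if "(u, v) \<in> set es" "t \<in> set (edge_chunk n k (u, v))" "a \<in> set vs" "t' \<in> set (vertex_chunk n k S a)"
    for u v t a t'
  proof
    assume "ends t = ends t'"
    then have "{u, v} = {a}" using 1[OF that(1,2)] 2[of a t'] that vs by simp
    then show False using E_D[OF E'[OF that(1)]] by auto
  qed
  then have "set (map ends (concat (map (edge_chunk n k) es))) \<inter>
      set (map ends (concat (map (vertex_chunk n k S) vs))) = {}"
    by fastforce
  ultimately show ?thesis unfolding gadget_edges_def by simp
qed

lemma gadget_edge_list:
  assumes es: "edge_list es E" and vs: "set vs = covered E" "distinct vs"
  defines "T \<equiv> gadget_edges n k S es vs"
  shows "edge_list (map (\<lambda>(x, y, z). (x, y)) T) (dom (weight G))"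
    and "map (\<lambda>(u, v). the (weight G {u, v})) (map (\<lambda>(x, y, z). (x, y)) T) = map (\<lambda>(x, y, z). z) T"
    and "card (dom (weight G)) = length T"
proof -
  have e: "map (\<lambda>(u, v). {u, v}) (map (\<lambda>(x, y, z). (x, y)) T) = map ends T"
    by (simp add: ends_def split_beta comp_def)
  have w: "weight G {x, y} = Some z" if "(x, y, z) \<in> set T" for x y z
    using gadget_edges_weight[OF es vs(1)] that unfolding T_def by blast
  have "dom (weight G) = ends ` set T"
  proof (intro equalityI subsetI)
    fix e assume "e \<in> dom (weight G)"
    then show "e \<in> ends ` set T" using gadget_edges_complete[OF es vs(1)] unfolding T_def by blast
  next
    fix e assume "e \<in> ends ` set T"
    then obtain x y z where "(x, y, z) \<in> set T" "e = {x, y}" by (force simp: ends_def)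
    then show "e \<in> dom (weight G)" using w by blast
  qed
  moreover have d: "distinct (map ends T)" using distinct_gadget_edges[OF es vs] unfolding T_def .
  ultimately show "edge_list (map (\<lambda>(x, y, z). (x, y)) T) (dom (weight G))"
    "card (dom (weight G)) = length T"
    using distinct_card[OF d] unfolding edge_list_def e by simp_all
  show "map (\<lambda>(u, v). the (weight G {u, v})) (map (\<lambda>(x, y, z). (x, y)) T) = map (\<lambda>(x, y, z). z) T"
    using w by (force simp: split_beta)
qed

end

section \<open>Reasoning about RAM programs\<close>

inductive_cases exec_SkipE: "exec w Skip M t M'"
inductive_cases exec_WriteE: "exec w (Write a i e) M t M'"
inductive_cases exec_SeqE: "exec w (Seq P Q) M t M'"
inductive_cases exec_CondE: "exec w (Cond b P Q) M t M'"
inductive_cases exec_WhileE: "exec w (While b P) M t M'"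

lemma exec_deterministic:
  assumes "exec w P M t M'" "exec w P M t' M''"
  shows "t' = t \<and> M'' = M'"
  using assms
proof (induction arbitrary: t' M'')
  case (Seq P M t M' Q s N)
  from Seq.prems show ?case
  proof (rule exec_SeqE)
    fix t1 M1 t2
    assume a: "t' = t1 + t2" "exec w P M t1 M1" "exec w Q M1 t2 M''"
    have "t1 = t \<and> M1 = M'" using Seq.IH(1)[OF a(2)] .
    then show ?thesis using Seq.IH(2) a by blast
  qed
next
  case (CondT b M P t M' Q)
  from CondT.prems show ?case 
    by (rule exec_CondE) (insert CondT.hyps, auto dest!: CondT.IH)
next
  case (CondF b M Q t M' P)
  from CondF.prems show ?case 
    by (rule exec_CondE) (insert CondF.hyps, auto dest!: CondF.IH)
next
  case (WhileT b M P t M' s N)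
  from WhileT.prems show ?case
  proof (rule exec_WhileE)
    fix t1 M1 t2
    assume a: "t' = Suc (t1 + t2)" "exec w P M t1 M1" "exec w (While b P) M1 t2 M''"
    have 1: "t1 = t" "M1 = M'" using WhileT.IH(1)[OF a(2)] by auto
    then have "t2 = s \<and> M'' = N" using WhileT.IH(2) a(3) by simp
    then show ?thesis using 1 a(1) by simp
  qed (use WhileT.hyps in simp_all)
next
  case (WhileF b M P)
  from WhileF.prems show ?case by (rule exec_WhileE) (use WhileF.hyps in simp_all)
qed (auto elim: exec_SkipE exec_WriteE)

lemma exec_pos: "exec w P M t M' \<Longrightarrow> 1 \<le> t"
  by (induction rule: exec.induct) auto

lemma exec_Skip_iff: "exec w Skip M t M' \<longleftrightarrow> t = 1 \<and> M' = M"
  using exec.Skip by (auto elim: exec_SkipE)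

lemma exec_Write_iff:
  "exec w (Write a i e) M t M' \<longleftrightarrow> t = 1 \<and> M' = M(a := (M a)(expr_val w i M := expr_val w e M))"
  using exec.Write by (auto elim: exec_WriteE)

text \<open>Total correctness with a work bound; as \<open>exec\<close> is deterministic, the
  execution asserted to exist is the only one.\<close>

definition runs :: "nat \<Rightarrow> prog \<Rightarrow> mem \<Rightarrow> nat \<Rightarrow> (mem \<Rightarrow> bool) \<Rightarrow> bool" where
  "runs w P M T Q \<longleftrightarrow> (\<exists>t M'. exec w P M t M' \<and> t \<le> T \<and> Q M')"

lemma runsI: "exec w P M t M' \<Longrightarrow> t \<le> T \<Longrightarrow> Q M' \<Longrightarrow> runs w P M T Q"
  unfolding runs_def by blast

lemma runs_mono: "runs w P M T Q \<Longrightarrow> T \<le> T' \<Longrightarrow> (\<And>M'. Q M' \<Longrightarrow> Q' M') \<Longrightarrow> runs w P M T' Q'"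
  unfolding runs_def using order_trans by blast

lemma runs_Skip: "runs w Skip M T Q \<longleftrightarrow> 1 \<le> T \<and> Q M"
  unfolding runs_def exec_Skip_iff by auto

lemma runs_Write:
  "runs w (Write a i e) M T Q \<longleftrightarrow>
     1 \<le> T \<and> Q (M(a := (M a)(expr_val w i M := expr_val w e M)))"
  unfolding runs_def exec_Write_iff by auto

lemma runs_Cond:
  "runs w (Cond b P Q) M T R \<longleftrightarrow>
     1 \<le> T \<and> (if expr_val w b M \<noteq> 0 then runs w P M (T - 1) R else runs w Q M (T - 1) R)"
proof
  assume "runs w (Cond b P Q) M T R"
  then obtain t M' where t: "exec w (Cond b P Q) M t M'" "t \<le> T" "R M'"
    unfolding runs_def by blast
  from t(1) show "1 \<le> T \<and> (if expr_val w b M \<noteq> 0 then runs w P M (T - 1) R else runs w Q M (T - 1) R)"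
    by (rule exec_CondE) (use t in \<open>auto intro: runsI\<close>)
next
  assume r: "1 \<le> T \<and> (if expr_val w b M \<noteq> 0 then runs w P M (T - 1) R else runs w Q M (T - 1) R)"
  then show "runs w (Cond b P Q) M T R"
  proof (cases "expr_val w b M = 0")
    case True
    with r obtain t M' where t: "exec w Q M t M'" "t \<le> T - 1" "R M'" unfolding runs_def by auto
    have "exec w (Cond b P Q) M (1 + t) M'"
      using exec.CondF True t by blast
    then show ?thesis using r t by (intro runsI[of w "Cond b P Q" M "1 + t" M' T R]) auto
  next
    case False
    with r obtain t M' where t: "exec w P M t M'" "t \<le> T - 1" "R M'" unfolding runs_def by auto
    have "exec w (Cond b P Q) M (1 + t) M'"
      using exec.CondT False t by blast
    then show ?thesis using r t by (intro runsI[of w "Cond b P Q" M "1 + t" M' T R]) auto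
  qed
qed

lemma runs_Seq:
  assumes "runs w P M T1 Q" "\<And>M'. Q M' \<Longrightarrow> runs w P' M' T2 R" "T1 + T2 \<le> T"
  shows "runs w (Seq P P') M T R"
proof -
  obtain t M' where t: "exec w P M t M'" "t \<le> T1" "Q M'" using assms unfolding runs_def by blast
  then obtain t' M'' where t': "exec w P' M' t' M''" "t' \<le> T2" "R M''"
    using assms(2)[OF t(3)] unfolding runs_def by blast
  have "exec w (Seq P P') M (t + t') M''" using exec.Seq t t' by blast
  then show ?thesis using t t' assms(3) unfolding runs_def by (metis add_mono order_trans)
qed

lemma runs_Seq_Write:
  "runs w (Seq (Write a i e) P) M T Q \<longleftrightarrow>
     1 \<le> T \<and> runs w P (M(a := (M a)(expr_val w i M := expr_val w e M))) (T - 1) Q"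
proof
  assume "runs w (Seq (Write a i e) P) M T Q"
  then obtain t M' where t: "exec w (Seq (Write a i e) P) M t M'" "t \<le> T" "Q M'"
    unfolding runs_def by blast
  from t(1) show "1 \<le> T \<and> runs w P (M(a := (M a)(expr_val w i M := expr_val w e M))) (T - 1) Q"
    by (rule exec_SeqE) (use t in \<open>auto simp: exec_Write_iff intro: runsI\<close>)
next
  assume r: "1 \<le> T \<and> runs w P (M(a := (M a)(expr_val w i M := expr_val w e M))) (T - 1) Q"
  show "runs w (Seq (Write a i e) P) M T Q"
    by (rule runs_Seq[where ?T1.0 = 1 and ?T2.0 = "T - 1"
        and Q = "\<lambda>N. N = M(a := (M a)(expr_val w i M := expr_val w e M))"])
      (use r in \<open>auto simp: runs_Write\<close>)
qed

lemma runs_Seq_assoc: "runs w (Seq (Seq P Q) R) M T X \<longleftrightarrow> runs w (Seq P (Seq Q R)) M T X"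
proof -
  have "exec w (Seq (Seq P Q) R) M t M' \<longleftrightarrow> exec w (Seq P (Seq Q R)) M t M'" for t M'
    by (auto elim!: exec_SeqE intro: exec.Seq) (metis add.assoc exec.Seq)+
  then show ?thesis by (simp add: runs_def)
qed

lemmas runs_simps = runs_Skip runs_Write runs_Cond runs_Seq_Write runs_Seq_assoc

text \<open>\<open>N\<close> rounds cost at most \<open>T\<close> each, plus one unit for every
  successful test and one for the last test.\<close>

lemma runs_while:
  assumes "I 0 M"
    and "\<And>i M. i < N \<Longrightarrow> I i M \<Longrightarrow> expr_val w b M \<noteq> 0 \<and> runs w P M T (I (Suc i))"
    and "\<And>M. I N M \<Longrightarrow> expr_val w b M = 0"
  shows "runs w (While b P) M (N * (T + 1) + 1) (I N)"
proof -
  have "runs w (While b P) M ((N - i) * (T + 1) + 1) (I N)" if "i \<le> N" "I i M" for i M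
    using that
  proof (induction "N - i" arbitrary: i M)
    case 0
    then show ?case using assms(3)[of M] exec.WhileF[of w b M P] unfolding runs_def by auto
  next
    case (Suc d)
    then have "i < N" "I i M" by auto
    then obtain t M' where t: "exec w P M t M'" "t \<le> T" "I (Suc i) M'" "expr_val w b M \<noteq> 0"
      using assms(2)[of i M] unfolding runs_def by blast
    have d: "d = N - Suc i" "Suc i \<le> N" using Suc by auto
    obtain t' M'' where t': "exec w (While b P) M' t' M''" "t' \<le> d * (T + 1) + 1" "I N M''"
      using Suc.hyps(1)[OF d t(3)] d unfolding runs_def by auto
    have "exec w (While b P) M (1 + t + t') M''" using exec.WhileT t t' by blast
    moreover have "1 + t + t' \<le> (N - i) * (T + 1) + 1"
      using t t' Suc.hyps(2)[symmetric] by simp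
    ultimately show ?case using t' unfolding runs_def by blast
  qed
  from this[of 0 M] show ?thesis using assms(1) by simp
qed

abbreviation "var a \<equiv> Read a (Const 0)"
abbreviation "assign a e \<equiv> Write a (Const 0) e"

text \<open>The arrays of a subroutine are moved out of the way of those of the calling program.\<close>

abbreviation "offset \<equiv> 16 :: nat"

fun shift_expr :: "expr \<Rightarrow> expr" where
  "shift_expr (Const c) = Const c"
| "shift_expr (Read a e) = Read (a + offset) (shift_expr e)"
| "shift_expr (Op f e e') = Op f (shift_expr e) (shift_expr e')"

fun shift :: "prog \<Rightarrow> prog" where
  "shift Skip = Skip"
| "shift (Write a i e) = Write (a + offset) (shift_expr i) (shift_expr e)"
| "shift (Seq P Q) = Seq (shift P) (shift Q)"
| "shift (Cond b P Q) = Cond (shift_expr b) (shift P) (shift Q)"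
| "shift (While b P) = While (shift_expr b) (shift P)"

definition inner :: "mem \<Rightarrow> mem" where
  "inner M = (\<lambda>a. M (a + offset))"

definition with_inner :: "mem \<Rightarrow> mem \<Rightarrow> mem" where
  "with_inner M N = (\<lambda>a. if a < offset then M a else N (a - offset))"

lemma expr_val_shift: "expr_val w (shift_expr e) (with_inner M N) = expr_val w e N"
  by (induction e) (auto simp: with_inner_def)

lemma exec_shift:
  "exec w P N t N' \<Longrightarrow> exec w (shift P) (with_inner M N) t (with_inner M N')"
proof (induction rule: exec.induct)
  case (Write a i e N)
  have "with_inner M (N(a := (N a)(expr_val w i N := expr_val w e N))) =
    (with_inner M N)(a + offset := (with_inner M N (a + offset))
      (expr_val w (shift_expr i) (with_inner M N) := expr_val w (shift_expr e) (with_inner M N)))"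
    unfolding expr_val_shift by (auto simp: with_inner_def fun_eq_iff)
  then show ?case
    using exec.Write[of w "a + offset" "shift_expr i" "shift_expr e" "with_inner M N"]
    unfolding shift.simps by (simp only:)
next
  case Skip
  then show ?case by (simp add: exec_Skip_iff)
next
  case Seq
  then show ?case using exec.Seq by simp
next
  case CondT
  then show ?case using exec.CondT by (simp add: expr_val_shift)
next
  case CondF
  then show ?case using exec.CondF by (simp add: expr_val_shift)
next
  case (WhileT b N P t N' t' N'')
  then show ?case using exec.WhileT[of w "shift_expr b" "with_inner M N"]
    by (simp add: expr_val_shift)
next
  case (WhileF b N P)
  then show ?case using exec.WhileF[of w "shift_expr b" "with_inner M N"]
    by (simp add: expr_val_shift)
qed

lemma with_inner_inner: "with_inner M (inner M) = M"
  by (auto simp: with_inner_def inner_def fun_eq_iff)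

lemma inner_with_inner: "inner (with_inner M N) = N"
  by (auto simp: with_inner_def inner_def fun_eq_iff)

lemma runs_shift:
  assumes "exec w P (inner M) t N" "t \<le> T" "Q (with_inner M N)"
  shows "runs w (shift P) M T Q"
  using exec_shift[OF assms(1), of M] assms(2,3) unfolding runs_def with_inner_inner by blast

lemma array_of_snoc: "(array_of xs)(length xs := x) = array_of (xs @ [x])"
  by (auto simp: array_of_def fun_eq_iff nth_append)

lemma array_of_Nil: "array_of [] = (\<lambda>_. 0)"
  by (auto simp: array_of_def)

text \<open>Since execution is deterministic, an invariant that is established and preserved by some
  execution of each program holds in all reachable states.\<close>

lemma solvableI:
  fixes J :: "nat \<Rightarrow> 's \<Rightarrow> mem \<Rightarrow> bool"
  assumes "a > 0"
    and pre: "\<And>w s M. initial \<Pi> a w s M \<Longrightarrow>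
      \<exists>T. runs w Pre M T (J w s) \<and> real T \<le> p (edges \<Pi> s) (verts \<Pi> s)"
    and upd: "\<And>w s M x s'. J w s M \<Longrightarrow> can_update \<Pi> a w s x s' \<Longrightarrow>
      \<exists>T. runs w Upd (put_args (update_args \<Pi> x) M) T (J w s') \<and> real T \<le> u (edges \<Pi> s) (verts \<Pi> s)"
    and qry: "\<And>w s M x. J w s M \<Longrightarrow> can_query \<Pi> a w s x \<Longrightarrow>
      \<exists>T. runs w Qry (put_args (query_args \<Pi> x) M) T
        (\<lambda>M'. J w s M' \<and> answer \<Pi> s x (M' result_arr 0)) \<and> real T \<le> q (edges \<Pi> s) (verts \<Pi> s)"
  shows "solvable \<Pi> p u q"
proof -
  have J: "J w s M" if "reachable \<Pi> a w Pre Upd Qry s M" for w s M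
    using that
  proof induction
    case (preprocess s M t M')
    then show ?case using pre[of w s M] exec_deterministic[of w Pre M t M'] unfolding runs_def by blast
  next
    case (update s M x s' t M')
    then show ?case
      using upd[of w s M x s'] exec_deterministic[of w Upd _ t M'] unfolding runs_def by blast
  next
    case (query s M x t M')
    then show ?case
      using qry[of w s M x] exec_deterministic[of w Qry _ t M'] unfolding runs_def by blast
  qed
  have le: "real t \<le> r" if "t \<le> T" "real T \<le> r" for t T r
    using that by (meson of_nat_le_iff order_trans)
  show ?thesis
    unfolding solvable_def
    apply (rule exI[of _ Pre], rule exI[of _ Upd], rule exI[of _ Qry], rule exI[of _ a])
    using assms(1) pre upd[OF J] qry[OF J] le unfolding runs_def by blast
qed

section \<open>The preprocessing program\<close>

abbreviation "scale_arr \<equiv> 6 :: nat"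
abbreviation "height_arr \<equiv> 7 :: nat"
abbreviation "seen_arr \<equiv> 8 :: nat"
abbreviation "target_arr \<equiv> 9 :: nat"
abbreviation "edge_arr \<equiv> 10 :: nat"
abbreviation "layer_arr \<equiv> 11 :: nat"
abbreviation "vertex_arr \<equiv> 12 :: nat"
abbreviation "length_arr \<equiv> 13 :: nat"

abbreviation "n_expr \<equiv> Read header_arr (Const 0)"
abbreviation "m_expr \<equiv> Read header_arr (Const 1)"
abbreviation "card_S_expr \<equiv> Read header_arr (Const 2)"
abbreviation "fst_expr \<equiv> Read fst_end_arr (var edge_arr)"
abbreviation "snd_expr \<equiv> Read snd_end_arr (var edge_arr)"
abbreviation "layers_expr \<equiv> Op Add (var height_arr) (Const 2)"
abbreviation "on_layer e \<equiv> Op Add (Op Mul (var layer_arr) n_expr) e"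
abbreviation "centre e \<equiv> Op Add n_expr e"
abbreviation "square_expr \<equiv> Op Mul (var scale_arr) (var scale_arr)"
abbreviation "cube_expr \<equiv> Op Mul square_expr (var scale_arr)"
abbreviation "increment a \<equiv> assign a (Op Add (var a) (Const 1))"

definition append_edge :: "expr \<Rightarrow> expr \<Rightarrow> expr \<Rightarrow> prog" where
  "append_edge x y z = Seq (Write (fst_end_arr + offset) (var length_arr) x)
     (Seq (Write (snd_end_arr + offset) (var length_arr) y)
     (Seq (Write (data_arr + offset) (var length_arr) z) (increment length_arr)))"

abbreviation "scale_body B \<equiv> Seq (assign edge_arr (Op Add (var edge_arr) (var edge_arr)))
  (Seq (assign height_arr (Op Add (var height_arr) (Const B)))
    (assign scale_arr (Op Mul (var scale_arr) (Const (2 ^ B)))))"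

text \<open>\<open>edge_arr\<close> is borrowed as a doubling counter: it takes \<open>lg n\<close>
  rounds to reach \<open>n + 2\<close>, each adding \<open>B\<close> to the height and multiplying
  the scale by \<open>2 ^ B\<close>. So \<open>k = B * lg n\<close> and \<open>2 ^ k\<close> arise
  together.\<close>

definition scale_prog :: "nat \<Rightarrow> prog" where
  "scale_prog B = Seq (assign edge_arr (Const 1)) (Seq (assign scale_arr (Const 1))
     (While (Op Lt (var edge_arr) (Op Add n_expr (Const 2)))
       (scale_body B)))"

abbreviation "light_body \<equiv> Seq (append_edge fst_expr (on_layer snd_expr) (Const 1))
  (Seq (append_edge snd_expr (on_layer fst_expr) (Const 1)) (increment layer_arr))"
abbreviation "light_loop \<equiv> While (Op Lt (var layer_arr) layers_expr) light_body"
abbreviation "edge_body \<equiv> Seq (append_edge fst_expr snd_expr (var scale_arr))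
  (Seq (assign layer_arr (Const 1)) (Seq light_loop (increment edge_arr)))"
abbreviation "leaf_body \<equiv>
  Seq (append_edge (centre (var vertex_arr)) (on_layer (var vertex_arr)) square_expr) (increment layer_arr)"
abbreviation "leaf_loop \<equiv> While (Op Lt (var layer_arr) layers_expr) leaf_body"
abbreviation "centre_step \<equiv> Cond (Read data_arr (var vertex_arr)) (increment target_arr)
  (append_edge (var vertex_arr) (centre (var vertex_arr)) cube_expr)"
abbreviation "visit_end \<equiv>
  Seq (assign target_arr (Op Sub (var target_arr) (Op Add (var height_arr) (Const 1)))) centre_step"

definition edges_prog :: prog where
  "edges_prog = Seq (assign edge_arr (Const 0))
     (While (Op Lt (var edge_arr) m_expr)
       edge_body)"

text \<open>\<open>seen_arr\<close> is zero in the initial memory, so no initialisation of length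
  \<open>n\<close> is needed.\<close>

definition visit_prog :: prog where
  "visit_prog = Cond (Read seen_arr (var vertex_arr)) Skip
     (Seq (Write seen_arr (var vertex_arr) (Const 1))
     (Seq (assign layer_arr (Const 2))
     (Seq leaf_loop
     visit_end)))"

text \<open>The target starts as if every vertex were isolated: \<open>(k + 2) * n\<close> lone
  vertices less the members of \<open>S\<close>, plus 2. A covered vertex takes off
  \<open>k + 1\<close>, as its column counts for one cluster instead of \<open>k + 2\<close>, and if
  it is in \<open>S\<close> it gives its 1 back.\<close>

definition vertices_prog :: prog where
  "vertices_prog = Seq (assign edge_arr (Const 0))
     (Seq (assign target_arr (Op Sub (Op Add (Op Mul layers_expr n_expr) (Const 2)) card_S_expr))
     (While (Op Lt (var edge_arr) m_expr)
       (Seq (assign vertex_arr fst_expr) (Seq visit_prog (Seq (assign vertex_arr snd_expr) (Seq visit_prog (increment edge_arr)))))))"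

definition preprocessing_prog :: "nat \<Rightarrow> prog \<Rightarrow> prog" where
  "preprocessing_prog B P = Seq (scale_prog B) (Seq edges_prog (Seq vertices_prog
     (Seq (Write (header_arr + offset) (Const 0) (Op Mul layers_expr n_expr))
     (Seq (Write (header_arr + offset) (Const 1) (var length_arr)) (shift P)))))"

section \<open>Correctness and work of writing out the gadget graph\<close>

definition out :: "(nat \<times> nat \<times> nat) list \<Rightarrow> mem \<Rightarrow> bool" where
  "out T M \<longleftrightarrow> M (fst_end_arr + offset) = array_of (map (\<lambda>(x, y, z). x) T) \<and>
     M (snd_end_arr + offset) = array_of (map (\<lambda>(x, y, z). y) T) \<and>
     M (data_arr + offset) = array_of (map (\<lambda>(x, y, z). z) T) \<and> M length_arr 0 = length T"

text \<open>The writes happen one after the other, so the second and third expressions are evaluated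
  after arrays 17 and 18 have changed; their premises quantify over those contents.\<close>

lemma runs_append_edge:
  assumes "out T M" "length T + 1 < 2 ^ w"
    and "expr_val w a M = x"
    and "\<And>f. expr_val w b (M(17 := f)) = y"
    and "\<And>f g. expr_val w c (M(17 := f, 18 := g)) = z"
    and Q: "\<And>M'. out (T @ [(x, y, z)]) M' \<Longrightarrow> (\<And>r. r \<notin> {13, 17, 18, 19} \<Longrightarrow> M' r = M r) \<Longrightarrow> Q M'"
  shows "runs w (append_edge a b c) M 4 Q"
proof -
  have l: "M 13 0 = length T" using assms(1) by (simp add: out_def)
  have a: "(array_of (map f T))(length T := v) = array_of (map f T @ [v])" for f v
    using array_of_snoc[of "map f T" v] by simp
  have "length T + 1 \<le> 2 ^ w" "w > 0" using assms(2) by (cases w; simp)+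
  then show ?thesis
    unfolding append_edge_def using assms l
    by (simp add: runs_simps a out_def)
qed

lemma runs_append_edge_Seq:
  assumes "out T M" "length T + 1 < 2 ^ w"
    and "expr_val w a M = x"
    and "\<And>f. expr_val w b (M(17 := f)) = y"
    and "\<And>f g. expr_val w c (M(17 := f, 18 := g)) = z"
    and Q: "\<And>M'. out (T @ [(x, y, z)]) M' \<Longrightarrow> (\<And>r. r \<notin> {13, 17, 18, 19} \<Longrightarrow> M' r = M r) \<Longrightarrow>
        runs w P M' K Q"
  shows "runs w (Seq (append_edge a b c) P) M (4 + K) Q"
  by (rule runs_Seq[OF runs_append_edge[OF assms(1-5)], where Q = "\<lambda>M'. runs w P M' K Q"])
    (use Q in auto)

text \<open>The inequality adds up the magnitudes that occur (vertex numbers, weights, the edge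
  counter), so that words can hold all of them.\<close>

locale gadget_construction = gadget n k E S
  for n k :: nat and E :: "nat set set" and S :: "nat set" +
  fixes w :: nat and es :: "(nat \<times> nat) list"
  assumes es: "edge_list es E"
    and bound: "(k + 2) * n + 2 * k + 6 + 2 ^ k * 2 ^ k * 2 ^ k +
      length es * (2 * k + 3) + n * (k + 1) < 2 ^ w"
begin

text \<open>The clauses on zero arrays guarantee in the end that the shifted memory is exactly an
  input of the inner algorithm; arrays 17 to 19 hold the output and are left to
  \<open>out\<close>.\<close>

definition env :: "(nat \<Rightarrow> nat) \<Rightarrow> mem \<Rightarrow> bool" where
  "env \<sigma> M \<longleftrightarrow> M header_arr = array_of [n, length es, card S] \<and>
     M fst_end_arr = array_of (map fst es) \<and> M snd_end_arr = array_of (map snd es) \<and>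
     M data_arr = array_of (map (\<lambda>v. of_bool (v \<in> S)) [0..<n]) \<and>
     M scale_arr 0 = 2 ^ k \<and> M height_arr 0 = k \<and> M seen_arr = \<sigma> \<and>
     M (header_arr + offset) = (\<lambda>_. 0) \<and> (\<forall>r \<ge> args_arr + offset. M r = (\<lambda>_. 0))"

lemma env_agree:
  "env \<sigma> M \<Longrightarrow> (\<And>r. r \<notin> {9, 10, 11, 12, 13, 17, 18, 19} \<Longrightarrow> M' r = M r) \<Longrightarrow> env \<sigma> M'"
  unfolding env_def by simp

lemma env_read:
  assumes "env \<sigma> M"
  shows "M 0 0 = n" "M 0 (Suc 0) = length es" "M 0 2 = card S" "M 6 0 = 2 ^ k" "M 7 0 = k"
    "i < length es \<Longrightarrow> M 1 i = fst (es ! i)" "i < length es \<Longrightarrow> M 2 i = snd (es ! i)"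
    "v < n \<Longrightarrow> M 3 v = of_bool (v \<in> S)" "M 8 = \<sigma>"
  using assms by (auto simp: env_def array_of_def)

lemma edge_ends: "i < length es \<Longrightarrow> fst (es ! i) < n \<and> snd (es ! i) < n"
proof -
  assume "i < length es"
  then have "es ! i \<in> set es" by simp
  then have "{fst (es ! i), snd (es ! i)} \<in> E"
    using es unfolding edge_list_def by (force simp: split_beta)
  then show ?thesis using E_D by blast
qed

lemma small: "w > 0" "2 < (2 :: nat) ^ w" "k + 2 < 2 ^ w" "length es < 2 ^ w" "n < 2 ^ w"
  "(k + 2) * n + 2 < 2 ^ w" "2 ^ k * 2 ^ k * 2 ^ k < (2 :: nat) ^ w" "2 ^ k * 2 ^ k < (2 :: nat) ^ w"
proof -
  show b: "2 < (2 :: nat) ^ w" "k + 2 < 2 ^ w" "(k + 2) * n + 2 < 2 ^ w"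
    "2 ^ k * 2 ^ k * 2 ^ k < (2 :: nat) ^ w"
    using bound by linarith+
  then show "w > 0" by (cases w) auto
  have "length es \<le> length es * (2 * k + 3)" "n \<le> n * (k + 1)" by simp_all
  then show "length es < 2 ^ w" "n < 2 ^ w" using bound by linarith+
  have "(2 :: nat) ^ k * 2 ^ k * 1 \<le> 2 ^ k * 2 ^ k * 2 ^ k" by (intro mult_left_mono) auto
  then show "2 ^ k * 2 ^ k < (2 :: nat) ^ w" using b(4) by linarith
qed

lemma above_small:
  assumes "l < k + 2" "v < n"
  shows "l * n + v < 2 ^ w" "l * n < 2 ^ w"
proof -
  have "l * n + n \<le> (k + 2) * n"
    using assms(1) by (metis Suc_leI add.commute mult_Suc mult_le_mono1)
  then show "l * n + v < 2 ^ w" "l * n < 2 ^ w" using assms small(6) by linarith+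
qed

lemma length_small:
  assumes "length T \<le> length es * (2 * k + 3) + n * (k + 1)"
  shows "length T + 1 < 2 ^ w"
  using assms bound by linarith

text \<open>Work: 4 for the edge itself, 1 for setting the layer, \<open>10 * (k + 1) + 1\<close>
  for the loop, 1 for the counter.\<close>

lemma runs_edge:
  assumes M: "env \<sigma> M" "out T M" "M edge_arr 0 = i" "i < length es"
    and len: "length T + (2 * k + 3) \<le> length es * (2 * k + 3)"
  shows "runs w edge_body M (10 * k + 17)
     (\<lambda>M'. env \<sigma> M' \<and> out (T @ edge_chunk n k (es ! i)) M' \<and> M' edge_arr 0 = Suc i)"
proof -
  let ?Q = "(\<lambda>M'. env \<sigma> M' \<and> out (T @ edge_chunk n k (es ! i)) M' \<and> M' edge_arr 0 = Suc i)"
  obtain u v where uv: "es ! i = (u, v)" by (cases "es ! i")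
  have un: "u < n" "v < n" using edge_ends[OF M(4)] uv by auto
  define ch :: "nat \<Rightarrow> (nat \<times> nat \<times> nat) list" where "ch = (\<lambda>j. (u, v, 2 ^ k) #
    concat (map (\<lambda>l. [(u, l * n + v, 1), (v, l * n + u, 1)]) [1..<j + 1]))"
  have len_ch: "length (ch j) = 2 * j + 1" for j
    unfolding ch_def by (induction j) (auto simp: upt_Suc)
  define I where "I = (\<lambda>j M'. env \<sigma> M' \<and> M' edge_arr 0 = i \<and> M' layer_arr 0 = j + 1 \<and> out (T @ ch j) M')"
  have step: "expr_val w (Op Lt (var layer_arr) layers_expr) M' \<noteq> 0 \<and>
      runs w light_body M' 9 (I (Suc j))"
    if j: "j < k + 1" and I: "I j M'" for j M'
  proof
    note e = env_read[of \<sigma> M'] small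
    show "expr_val w (Op Lt (var layer_arr) layers_expr) M' \<noteq> 0"
      using I j e unfolding I_def by simp
    have l: "length (T @ ch j) + 2 \<le> length es * (2 * k + 3)" using len len_ch[of j] j by simp
    have snoc: "ch (Suc j) = ch j @ [(u, (j + 1) * n + v, 1), (v, (j + 1) * n + u, 1)]"
      unfolding ch_def by (simp add: upt_Suc)
    have ab: "(j + 1) * n + v < 2 ^ w" "(j + 1) * n + u < 2 ^ w" "(j + 1) * n < 2 ^ w" "j + 2 < 2 ^ w"
      using above_small[of "j + 1"] j un small(3) by auto
    show "runs w light_body M' 9 (I (Suc j))"
    proof (rule runs_mono[OF runs_append_edge_Seq[where K = 5 and T = "T @ ch j"
          and x = u and y = "(j + 1) * n + v" and z = 1]])
      show "out (T @ ch j) M'" using I unfolding I_def by blast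
      show "length (T @ ch j) + 1 < 2 ^ w" using l by (intro length_small) simp
      show "expr_val w fst_expr M' = u" using I e M(4) uv unfolding I_def by simp
      show "expr_val w (on_layer snd_expr) (M'(17 := f)) = (j + 1) * n + v" for f
        using I e M(4) uv ab unfolding I_def by simp
      show "expr_val w (Const 1) (M'(17 := f, 18 := g)) = 1" for f g
        using e by simp
      fix M1 assume o1: "out ((T @ ch j) @ [(u, (j + 1) * n + v, 1)]) M1"
        and a1: "\<And>r. r \<notin> {13, 17, 18, 19} \<Longrightarrow> M1 r = M' r"
      have env1: "env \<sigma> M1" "M1 edge_arr 0 = i" "M1 layer_arr 0 = j + 1"
        using I env_agree[of \<sigma> M' M1] a1 unfolding I_def by auto
      note e1 = env_read[OF env1(1)] small
      show "runs w (Seq (append_edge snd_expr (on_layer fst_expr) (Const 1)) (increment layer_arr)) M1 5 (I (Suc j))"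
      proof (rule runs_mono[OF runs_append_edge_Seq[OF o1, where K = 1
          and x = v and y = "(j + 1) * n + u" and z = 1]])
        show "length ((T @ ch j) @ [(u, (j + 1) * n + v, 1)]) + 1 < 2 ^ w"
          using l by (intro length_small) simp
        show "expr_val w snd_expr M1 = v" using env1 e1 M(4) uv by simp
        show "expr_val w (on_layer fst_expr) (M1(17 := f)) = (j + 1) * n + u" for f
          using env1 e1 M(4) uv ab by simp
        show "expr_val w (Const 1) (M1(17 := f, 18 := g)) = 1" for f g
          using e by simp
        fix M2 assume o2: "out (((T @ ch j) @ [(u, (j + 1) * n + v, 1)]) @ [(v, (j + 1) * n + u, 1)]) M2"
          and a2: "\<And>r. r \<notin> {13, 17, 18, 19} \<Longrightarrow> M2 r = M1 r"
        let ?M3 = "M2(layer_arr := (M2 layer_arr)(0 := j + 2))"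
        have "env \<sigma> ?M3" using env_agree[of \<sigma> M1 ?M3] env1 a2 by simp
        moreover have "out (T @ ch (Suc j)) ?M3" using o2 unfolding snoc by (simp add: out_def)
        moreover have "M2 edge_arr 0 = i" "M2 layer_arr 0 = j + 1" using env1 a2 by auto
        ultimately show "runs w (increment layer_arr) M2 1 (I (Suc j))"
          using ab small by (simp add: runs_simps I_def)
      qed auto
    qed auto
  qed
  have ch: "ch (k + 1) = edge_chunk n k (es ! i)"
    unfolding ch_def edge_chunk_def uv by simp
  note e = env_read[OF M(1)] small
  show ?thesis
  proof (rule runs_mono[OF runs_append_edge_Seq[OF M(2), where K = "10 * k + 13"
        and x = u and y = v and z = "2 ^ k"]])
    show "length T + 1 < 2 ^ w" using len by (intro length_small) simp
    show "expr_val w fst_expr M = u" using e M uv by simp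
    show "expr_val w snd_expr (M(17 := f)) = v" for f using e M uv by simp
    show "expr_val w (var scale_arr) (M(17 := f, 18 := g)) = 2 ^ k" for f g using e by simp
    fix M1 assume o1: "out (T @ [(u, v, 2 ^ k)]) M1" and a1: "\<And>r. r \<notin> {13, 17, 18, 19} \<Longrightarrow> M1 r = M r"
    let ?M2 = "M1(layer_arr := (M1 layer_arr)(0 := 1))"
    have "env \<sigma> ?M2" using env_agree[of \<sigma> M ?M2] M a1 by simp
    then have "I 0 ?M2" using o1 a1 M unfolding I_def ch_def by (simp add: out_def)
    then have "runs w light_loop
        ?M2 ((k + 1) * (9 + 1) + 1) (I (k + 1))"
    proof (rule runs_while[where I = I and N = "k + 1" and T = 9])
      show "expr_val w (Op Lt (var layer_arr) layers_expr) M' = 0" if "I (k + 1) M'" for M'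
        using that env_read[of \<sigma> M'] small unfolding I_def by simp
    qed (use step in auto)
    moreover have "runs w (increment edge_arr) M' 1
        ?Q"
      if "I (k + 1) M'" for M'
    proof -
      let ?M3 = "M'(edge_arr := (M' edge_arr)(0 := i + 1))"
      have "env \<sigma> ?M3" using env_agree[of \<sigma> M' ?M3] that unfolding I_def by simp
      moreover have "out (T @ edge_chunk n k (es ! i)) ?M3"
        using that ch unfolding I_def by (simp add: out_def)
      moreover have "i + 1 < 2 ^ w" using M(4) small by linarith
      ultimately show ?thesis using that small unfolding I_def by (simp add: runs_simps)
    qed
    ultimately have "runs w (Seq light_loop
            (increment edge_arr)) ?M2 (10 * k + 12)
        ?Q"
      by (rule runs_Seq) auto
    moreover have c: "expr_val w (Const 0) M1 = 0" "expr_val w (Const 1) M1 = 1"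
      and t: "10 * k + 13 - 1 = 10 * k + 12"
      using small by simp_all
    ultimately show "runs w (Seq (assign layer_arr (Const 1))
       (Seq light_loop
            (increment edge_arr))) M1 (10 * k + 13)
        ?Q"
      unfolding runs_Seq_Write c t by simp
  qed auto
qed

lemma runs_edges:
  assumes M: "env \<sigma> M" "out [] M"
  shows "runs w edges_prog M (length es * (10 * k + 18) + 2)
     (\<lambda>M'. env \<sigma> M' \<and> out (concat (map (edge_chunk n k) es)) M')"
proof -
  define I where "I = (\<lambda>i M'. env \<sigma> M' \<and>
    out (concat (map (edge_chunk n k) (take i es))) M' \<and> M' edge_arr 0 = i)"
    let ?M = "M(edge_arr := (M edge_arr)(0 := 0))"
  have "runs w (While (Op Lt (var edge_arr) m_expr) edge_body) ?M (length es * (10 * k + 17 + 1) + 1) (I (length es))"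
  proof (rule runs_while[where I = I and N = "length es" and T = "10 * k + 17"])
    have "env \<sigma> ?M" using env_agree[of \<sigma> M ?M] M by simp
    then show "I 0 ?M" using M unfolding I_def by (simp add: out_def)
  next
    fix i M' assume i: "i < length es" and I: "I i M'"
    have "length (concat (map (edge_chunk n k) (take i es))) = i * (2 * k + 3)"
      using i by (induction i) (auto simp: take_Suc_conv_app_nth length_edge_chunk)
    moreover have "i * (2 * k + 3) + (2 * k + 3) \<le> length es * (2 * k + 3)"
      using i by (metis Suc_leI add.commute mult_Suc mult_le_mono1)
    ultimately have "runs w edge_body M' (10 * k + 17)
      (\<lambda>M'. env \<sigma> M' \<and> out (concat (map (edge_chunk n k) (take i es)) @ edge_chunk n k (es ! i)) M' \<and> M' edge_arr 0 = Suc i)"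
      using runs_edge[of \<sigma> M' _ i] I i unfolding I_def by simp
    moreover have "concat (map (edge_chunk n k) (take i es)) @ edge_chunk n k (es ! i) =
        concat (map (edge_chunk n k) (take (Suc i) es))"
      using i by (simp add: take_Suc_conv_app_nth)
    ultimately show "expr_val w (Op Lt (var edge_arr) m_expr) M' \<noteq> 0 \<and> runs w edge_body M' (10 * k + 17) (I (Suc i))"
      using I i env_read[of \<sigma> M'] small unfolding I_def by simp
  next
    fix M' assume "I (length es) M'"
    then show "expr_val w (Op Lt (var edge_arr) m_expr) M' = 0"
      using env_read[of \<sigma> M'] small unfolding I_def by simp
  qed
  then have "runs w edges_prog M (length es * (10 * k + 17 + 1) + 2) (I (length es))"
    unfolding edges_prog_def using small by (simp add: runs_simps)
  then show ?thesis by (rule runs_mono) (auto simp: I_def)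
qed

end

lemma sub_mod:
  fixes x y m :: nat
  assumes "y \<le> x" "x < m"
  shows "(x + m - y) mod m = x - y"
proof -
  have e: "x + m - y = (x - y) + m" and "x - y < m" using assms by linarith+
  then show ?thesis unfolding e by simp
qed

text \<open>The binary logarithm of \<open>n + 2\<close>, rounded up; the shift makes it positive
  even for \<open>n = 0\<close>.\<close>

definition lg :: "nat \<Rightarrow> nat" where
  "lg n = (LEAST l. n + 2 \<le> 2 ^ l)"

lemma le_lg: "n + 2 \<le> 2 ^ lg n"
proof -
  have "n + 2 \<le> 2 ^ (n + 2)" using less_exp[of "n + 2"] by linarith
  then show ?thesis unfolding lg_def by (rule LeastI)
qed

lemma less_lg_iff: "2 ^ i < n + 2 \<longleftrightarrow> i < lg n"
proof
  assume "2 ^ i < n + 2"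
  then have "(2 :: nat) ^ i < 2 ^ lg n" using le_lg[of n] by linarith
  then show "i < lg n" by simp
next
  assume "i < lg n"
  then show "2 ^ i < n + 2" unfolding lg_def using not_less_Least by fastforce
qed

lemma lg_pos: "0 < lg n"
  using less_lg_iff[of 0 n] by simp

lemma lg_le: "2 ^ lg n \<le> 2 * (n + 2)"
  using less_lg_iff[of "lg n - 1" n] lg_pos[of n] by (cases "lg n") auto

lemma runs_scale:
  assumes M: "M 0 0 = n" "M 7 0 = 0"
    and bound: "2 * (n + 2) < 2 ^ w" "2 ^ (B * lg n) < (2 :: nat) ^ w"
  shows "runs w (scale_prog B) M (lg n * 4 + 3)
    (\<lambda>M'. M' 6 0 = 2 ^ (B * lg n) \<and> M' 7 0 = B * lg n \<and> (\<forall>r. r \<notin> {6, 7, 10} \<longrightarrow> M' r = M r))"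
proof -
  have w: "2 < (2 :: nat) ^ w" "n + 2 < 2 ^ w" "w > 0" using bound(1) by (cases w; simp)+
  have "B \<le> B * lg n" using lg_pos[of n] by simp
  then have "(2 :: nat) ^ B \<le> 2 ^ (B * lg n)" by (intro power_increasing) auto
  moreover have "B < 2 ^ B" by simp
  ultimately have B: "2 ^ B < (2 :: nat) ^ w" "B < 2 ^ w" using bound(2) by linarith+
  let ?M = "M(10 := (M 10)(0 := 1), 6 := (M 6)(0 := 1))"
  define I where "I = (\<lambda>i M'. M' 10 0 = 2 ^ i \<and> M' 7 0 = B * i \<and> M' 6 0 = 2 ^ (B * i) \<and>
    (\<forall>r. r \<notin> {6, 7, 10} \<longrightarrow> M' r = M r))"
  have "runs w (While (Op Lt (var edge_arr) (Op Add n_expr (Const 2)))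
       (scale_body B)) ?M (lg n * (3 + 1) + 1) (I (lg n))"
  proof (rule runs_while[where I = I and N = "lg n" and T = 3])
    show "I 0 ?M" using M unfolding I_def by simp
  next
    fix i M' assume i: "i < lg n" and I: "I i M'"
    have M0: "M' 0 0 = n" using I M unfolding I_def by simp
    have lt: "2 ^ i < n + 2" using less_lg_iff i by blast
    have "(2 :: nat) ^ (B * Suc i) \<le> 2 ^ (B * lg n)" using i by (intro power_increasing mult_le_mono) auto
    then have s: "2 ^ (B * Suc i) < (2 :: nat) ^ w" using bound(2) by linarith
    have "B * Suc i < 2 ^ (B * Suc i)" by simp
    then have b: "B + B * i < 2 ^ w" using s by (simp only: mult_Suc_right)
    have "2 * 2 ^ i < 2 * (n + 2)" using lt by simp
    then have e: "2 ^ i + 2 ^ i < (2 :: nat) ^ w"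
      using bound(1) unfolding mult_2[symmetric] by (rule less_trans)
    have s': "2 ^ (B * i) * 2 ^ B < (2 :: nat) ^ w"
      using s by (simp add: power_add mult.commute)
    show "expr_val w (Op Lt (var edge_arr) (Op Add n_expr (Const 2))) M' \<noteq> 0 \<and>
       runs w (scale_body B) M' 3 (I (Suc i))"
    proof
      show "expr_val w (Op Lt (var edge_arr) (Op Add n_expr (Const 2))) M' \<noteq> 0"
        using I M0 w lt unfolding I_def by simp
      have v: "expr_val w (Const c) N = c" if "c < 2 ^ w" for c N
        using that by simp
      show "runs w (scale_body B) M' 3 (I (Suc i))"
        using I e b s' B unfolding I_def
        by (simp add: runs_simps power_add mult.commute del: expr_val.simps(1))
          (simp add: v mult.commute)
    qed
  next
    fix M' assume I: "I (lg n) M'"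
    then have "M' 0 0 = n" using M unfolding I_def by simp
    then show "expr_val w (Op Lt (var edge_arr) (Op Add n_expr (Const 2))) M' = 0"
      using I w le_lg[of n] unfolding I_def by simp
  qed
  then have "runs w (scale_prog B) M (lg n * 4 + 3) (I (lg n))"
    unfolding scale_prog_def using w by (simp add: runs_simps)
  then show ?thesis by (rule runs_mono) (auto simp: I_def)
qed

section \<open>Visiting the covered vertices and adjusting the target\<close>

context gadget_construction
begin

abbreviation "main_edges \<equiv> concat (map (edge_chunk n k) es)"

text \<open>The equation for the target is arranged without subtraction, which would
  truncate.\<close>

definition visited :: "nat list \<Rightarrow> mem \<Rightarrow> bool" where
  "visited vs M \<longleftrightarrow> distinct vs \<and> set vs \<subseteq> {..<n} \<and> env (\<lambda>x. of_bool (x \<in> set vs)) M \<and>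
     out (gadget_edges n k S es vs) M \<and>
     M target_arr 0 + card S + length vs * (k + 1) = (k + 2) * n + 2 + card (S \<inter> set vs)"

lemma card_S: "card S \<le> n"
  using card_mono[OF _ S] by simp

lemma finite_S: "finite S"
  using S finite_subset by blast

text \<open>At most \<open>n - length vs\<close> members of \<open>S\<close> are unvisited; so while
  some vertex is unvisited, \<open>k + 1\<close> can be subtracted from the target without wrapping
  around.\<close>

lemma target_large:
  assumes "distinct vs" "set vs \<subseteq> {..<n}" "z < n" "z \<notin> set vs"
    and "t + card S + length vs * (k + 1) = (k + 2) * n + 2 + card (S \<inter> set vs)"
  shows "k + 1 \<le> t"
proof -
  have "S \<subseteq> (S \<inter> set vs) \<union> ({..<n} - set vs)" using S by blast
  then have "card S \<le> card ((S \<inter> set vs) \<union> ({..<n} - set vs))" by (intro card_mono) auto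
  also have "\<dots> \<le> card (S \<inter> set vs) + card ({..<n} - set vs)" by (rule card_Un_le)
  also have "card ({..<n} - set vs) = n - length vs"
    using assms distinct_card[of vs] by (subst card_Diff_subset) auto
  finally have c: "card S \<le> card (S \<inter> set vs) + (n - length vs)" .
  have "length vs = card (set vs)" using assms distinct_card[of vs] by simp
  also have "\<dots> < card {..<n}" using assms by (intro psubset_card_mono) auto
  finally obtain d where d: "n = length vs + Suc d" using less_imp_Suc_add by auto
  show ?thesis using c assms(5) unfolding d by (simp add: algebra_simps)
qed

lemma length_visited:
  assumes "distinct vs" "set vs \<subseteq> {..<n}" "z < n" "z \<notin> set vs"
  shows "length (gadget_edges n k S es vs) + (k + 1) \<le> length es * (2 * k + 3) + n * (k + 1)"
proof -
  have "length vs = card (set vs)" using assms distinct_card[of vs] by simp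
  also have "\<dots> < card {..<n}" using assms by (intro psubset_card_mono) auto
  finally have "Suc (length vs) \<le> n" by simp
  then have "Suc (length vs) * (k + 1) \<le> n * (k + 1)" by (rule mult_le_mono1)
  then show ?thesis using length_gadget_edges[of n k S es vs] by simp
qed

lemma runs_visit:
  assumes M: "visited vs M" "M vertex_arr 0 = z" "z < n"
  shows "runs w visit_prog M (6 * k + 10)
    (\<lambda>M'. visited (if z \<in> set vs then vs else vs @ [z]) M' \<and> M' edge_arr = M edge_arr)"
proof (cases "z \<in> set vs")
  case True
  then have "M seen_arr z = 1" using M unfolding visited_def by (simp add: env_def)
  then show ?thesis unfolding visit_prog_def using M True small by (simp add: runs_simps)
next
  case z: False
  let ?Q = "\<lambda>M'. visited (vs @ [z]) M' \<and> M' edge_arr = M edge_arr"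
  define \<sigma> where "\<sigma> = (\<lambda>x. of_bool (x \<in> set (vs @ [z])) :: nat)"
  define T where "T = gadget_edges n k S es vs"
  define t where "t = M target_arr 0"
  have v: "distinct vs" "set vs \<subseteq> {..<n}" "env (\<lambda>x. of_bool (x \<in> set vs)) M" "out T M"
    "t + card S + length vs * (k + 1) = (k + 2) * n + 2 + card (S \<inter> set vs)"
    using M unfolding visited_def T_def t_def by auto
  note e = env_read[OF v(3)]
  have t: "k + 1 \<le> t" using target_large[OF v(1,2) M(3) z v(5)] .
  have "t \<le> (k + 2) * n + 2 + card (S \<inter> set vs) - card S" using v(5) by linarith
  moreover have "card (S \<inter> set vs) \<le> card S" using finite_S by (intro card_mono) auto
  ultimately have tw: "t < 2 ^ w" using small(6) by linarith
  have len: "length T + (k + 1) \<le> length es * (2 * k + 3) + n * (k + 1)"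
    using length_visited[OF v(1,2) M(3) z] unfolding T_def .
  define leaves where "leaves = (\<lambda>j. map (\<lambda>l. (n + z, l * n + z, (2 :: nat) ^ k * 2 ^ k)) [2..<j + 2])"
  define I where "I = (\<lambda>j M'. env \<sigma> M' \<and> M' vertex_arr 0 = z \<and> M' edge_arr = M edge_arr \<and>
    M' target_arr 0 = t \<and> M' layer_arr 0 = j + 2 \<and> out (T @ leaves j) M')"
  let ?M = "M(seen_arr := (M seen_arr)(z := 1), layer_arr := (M layer_arr)(0 := 2))"
  have \<sigma>: "(M seen_arr)(z := 1) = \<sigma>" using e(9) unfolding \<sigma>_def by auto
  have "env \<sigma> ?M" using v(3) \<sigma> unfolding env_def by simp
  then have I0: "I 0 ?M" using v M unfolding I_def leaves_def t_def by (simp add: out_def)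
  have loop: "runs w leaf_loop ?M (k * (5 + 1) + 1) (I k)"
  proof (rule runs_while[where I = I and N = k and T = 5])
    fix j M' assume j: "j < k" and I: "I j M'"
    note e' = env_read[of \<sigma> M'] small
    have ab: "(j + 2) * n + z < 2 ^ w" "(j + 2) * n < 2 ^ w" "n + z < 2 ^ w" "j + 3 < 2 ^ w"
      using above_small[of "j + 2" z] above_small[of 1 z] j M(3) small(3) by auto
    have env': "env \<sigma> M'" "M' 12 0 = z" "M' 11 0 = j + 2" using I unfolding I_def by auto
    note e' = env_read[OF env'(1)] small
    have "runs w leaf_body M' (4 + 1) (I (Suc j))"
    proof (rule runs_append_edge_Seq[where T = "T @ leaves j"
          and x = "n + z" and y = "(j + 2) * n + z" and z = "2 ^ k * 2 ^ k"])
      show "out (T @ leaves j) M'" using I unfolding I_def by blast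
      show "length (T @ leaves j) + 1 < 2 ^ w"
        using len j by (intro length_small) (simp add: leaves_def)
      show "expr_val w (centre (var vertex_arr)) M' = n + z" using e' env' ab by simp
      show "expr_val w (on_layer (var vertex_arr)) (M'(17 := f)) = (j + 2) * n + z" for f
        using e' env' ab by simp
      show "expr_val w square_expr (M'(17 := f, 18 := g)) = 2 ^ k * 2 ^ k" for f g
        using e' env' by simp
      fix M1 assume o1: "out ((T @ leaves j) @ [(n + z, (j + 2) * n + z, 2 ^ k * 2 ^ k)]) M1"
        and a1: "\<And>r. r \<notin> {13, 17, 18, 19} \<Longrightarrow> M1 r = M' r"
      let ?M2 = "M1(layer_arr := (M1 layer_arr)(0 := j + 3))"
      have "env \<sigma> ?M2" using env_agree[of \<sigma> M' ?M2] env' a1 by simp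
      moreover have "out (T @ leaves (Suc j)) ?M2"
        using o1 unfolding leaves_def by (simp add: out_def upt_Suc)
      moreover have "M1 layer_arr 0 = j + 2" "M1 12 0 = z" "M1 10 = M 10" "M1 9 0 = t"
        using I a1 unfolding I_def by auto
      ultimately show "runs w (increment layer_arr) M1 1 (I (Suc j))"
        using ab small unfolding I_def by (simp add: runs_simps numeral_3_eq_3)
    qed
    then show "expr_val w (Op Lt (var layer_arr) layers_expr) M' \<noteq> 0 \<and>
        runs w leaf_body M' 5 (I (Suc j))"
      using e' env' j by simp
  next
    fix M' assume "I k M'"
    then show "expr_val w (Op Lt (var layer_arr) layers_expr) M' = 0"
      using env_read[of \<sigma> M'] small unfolding I_def by simp
  qed (fact I0)
  have leaves: "leaves k @ (if z \<in> S then [] else [(z, n + z, 2 ^ k * 2 ^ k * 2 ^ k)]) =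
      vertex_chunk n k S z"
    unfolding leaves_def vertex_chunk_def by simp
  have ge: "gadget_edges n k S es (vs @ [z]) = T @ vertex_chunk n k S z"
    unfolding T_def gadget_edges_def by simp
  have tail: "runs w visit_end M' 6
      ?Q" if I: "I k M'" for M'
  proof -
    have env': "env \<sigma> M'" "M' 12 0 = z" "M' 10 = M 10" "M' 9 0 = t" "out (T @ leaves k) M'"
      using I unfolding I_def by auto
    note e' = env_read[OF env'(1)] small
    have k1: "k + 1 < 2 ^ w" using small(3) by linarith
    have sub: "(t + 2 ^ w - (k + 1)) mod 2 ^ w = t - (k + 1)" using sub_mod[OF t tw] .
    let ?M1 = "M'(target_arr := (M' target_arr)(0 := t - (k + 1)))"
    have vals: "expr_val w (Const 0) M' = 0"
      "expr_val w (Op Sub (var target_arr) (Op Add (var height_arr) (Const 1))) M' = t - (k + 1)"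
      using e' env' k1 sub by simp_all
    have env1: "env \<sigma> ?M1" using env_agree[of \<sigma> M' ?M1] env' by simp
    note e1 = env_read[OF env1] small
    have "runs w centre_step ?M1 5
      ?Q"
    proof (cases "z \<in> S")
      case True
      have ins: "card (S \<inter> insert z (set vs)) = card (S \<inter> set vs) + 1"
        using True z finite_S by (simp add: Int_insert_right)
      let ?M2 = "?M1(target_arr := (?M1 target_arr)(0 := t - (k + 1) + 1))"
      have "visited (vs @ [z]) ?M2"
        unfolding visited_def
      proof (intro conjI)
        show "env (\<lambda>x. of_bool (x \<in> set (vs @ [z]))) ?M2"
          using env_agree[of \<sigma> M' ?M2] env' unfolding \<sigma>_def by simp
        show "out (gadget_edges n k S es (vs @ [z])) ?M2"
          using env'(5) leaves True unfolding ge by (simp add: out_def)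
        show "?M2 target_arr 0 + card S + length (vs @ [z]) * (k + 1) =
            (k + 2) * n + 2 + card (S \<inter> set (vs @ [z]))"
          using v(5) t ins by simp
      qed (use v z M(3) in auto)
      moreover have "t - (k + 1) + 1 < 2 ^ w" using tw t by linarith
      ultimately show ?thesis using e' e1 env' M(3) True by (simp add: runs_simps)
    next
      case False
      have ins: "card (S \<inter> insert z (set vs)) = card (S \<inter> set vs)"
        using False by (simp add: Int_insert_right)
      have nz: "n + z < 2 ^ w" using above_small[of 1 z] M(3) by simp
      have "runs w (append_edge (var vertex_arr) (centre (var vertex_arr)) cube_expr) ?M1 4
        ?Q"
      proof (rule runs_append_edge[where T = "T @ leaves k"
            and x = z and y = "n + z" and z = "2 ^ k * 2 ^ k * 2 ^ k"])
        show "out (T @ leaves k) ?M1" using env'(5) by (simp add: out_def)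
        show "length (T @ leaves k) + 1 < 2 ^ w"
          using len by (intro length_small) (simp add: leaves_def)
        show "expr_val w (var vertex_arr) ?M1 = z" using env' by simp
        show "expr_val w (centre (var vertex_arr)) (?M1(17 := f)) = n + z" for f
          using e' env' nz by simp
        show "expr_val w cube_expr (?M1(17 := f, 18 := g)) = 2 ^ k * 2 ^ k * 2 ^ k" for f g
          using e' env' by simp
        fix M2 assume o2: "out ((T @ leaves k) @ [(z, n + z, 2 ^ k * 2 ^ k * 2 ^ k)]) M2"
          and a2: "\<And>r. r \<notin> {13, 17, 18, 19} \<Longrightarrow> M2 r = ?M1 r"
        have "visited (vs @ [z]) M2"
          unfolding visited_def
        proof (intro conjI)
          show "env (\<lambda>x. of_bool (x \<in> set (vs @ [z]))) M2"
            using env_agree[of \<sigma> ?M1 M2] env1 a2 unfolding \<sigma>_def by simp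
          show "out (gadget_edges n k S es (vs @ [z])) M2"
            using o2 leaves False unfolding ge by (metis append_assoc)
          show "M2 target_arr 0 + card S + length (vs @ [z]) * (k + 1) =
            (k + 2) * n + 2 + card (S \<inter> set (vs @ [z]))"
            using v(5) t ins a2[of target_arr] by simp
        qed (use v z M(3) in auto)
        then show "visited (vs @ [z]) M2 \<and> M2 edge_arr = M edge_arr" using a2[of edge_arr] env' by simp
      qed
      then show ?thesis using e1 M(3) False env' by (simp add: runs_simps)
    qed
    then show ?thesis unfolding runs_Seq_Write vals by simp
  qed
  have all: "runs w (Seq leaf_loop
        visit_end) ?M (6 * k + 7)
      ?Q"
    by (rule runs_Seq[OF loop tail]) auto
  have vals: "expr_val w (Read seen_arr (var vertex_arr)) M = 0"
    "expr_val w (var vertex_arr) M = z" "expr_val w (Const 0) N = 0" "expr_val w (Const 1) N = 1"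
    "expr_val w (Const 2) N = 2" for N
    using e z M small by simp_all
  have times: "6 * k + 10 - 1 - 1 - 1 = 6 * k + 7" by simp
  show ?thesis
    unfolding visit_prog_def runs_Cond runs_Seq_Write vals times using all z by simp
qed

end

text \<open>From now on the seen flags serve as the test for being non-isolated. Nothing here
  depends on the order of the edge list.\<close>

definition ready :: "nat \<Rightarrow> nat \<Rightarrow> nat set set \<Rightarrow> nat set \<Rightarrow> mem \<Rightarrow> bool" where
  "ready n k E S M \<longleftrightarrow> M header_arr 0 = n \<and> (\<forall>v < n. M data_arr v = of_bool (v \<in> S)) \<and>
     (\<forall>v < n. M seen_arr v = of_bool (v \<in> covered E)) \<and>
     M target_arr 0 = other_clusters n k E S + 2 \<and> M scale_arr 0 = 2 ^ k"

lemma ready_agree: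
  assumes "ready n k E S M" "\<And>r. r \<in> {0, 3, 6, 8, 9} \<Longrightarrow> M' r = M r"
  shows "ready n k E S M'"
  using assms by (simp add: ready_def)

context gadget_construction
begin

lemma runs_vertices:
  assumes M: "env (\<lambda>_. 0) M" "out main_edges M"
  shows "runs w vertices_prog M (length es * (12 * k + 24) + 3)
    (\<lambda>M'. \<exists>vs. visited vs M' \<and> set vs = covered E)"
proof -
  define seen where "seen = (\<lambda>i. fst ` set (take i es) \<union> snd ` set (take i es))"
  define I where "I = (\<lambda>i M'. (\<exists>vs. visited vs M' \<and> set vs = seen i) \<and> M' edge_arr 0 = i)"
  let ?t = "(k + 2) * n + 2 - card S"
  let ?M = "M(edge_arr := (M edge_arr)(0 := 0), target_arr := (M target_arr)(0 := ?t))"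
  let ?body = "Seq (assign vertex_arr fst_expr) (Seq visit_prog (Seq (assign vertex_arr snd_expr) (Seq visit_prog (increment edge_arr))))"
  have seen_Suc: "seen (Suc i) = insert (snd (es ! i)) (insert (fst (es ! i)) (seen i))"
    if "i < length es" for i
    using that unfolding seen_def by (auto simp: take_Suc_conv_app_nth)
  have "runs w (While (Op Lt (var edge_arr) m_expr) ?body) ?M (length es * (12 * k + 23 + 1) + 1) (I (length es))"
  proof (rule runs_while[where I = I and N = "length es" and T = "12 * k + 23"])
    have "env (\<lambda>_. 0) ?M" using env_agree[of "\<lambda>_. 0" M ?M] M by simp
    moreover have "card S \<le> (k + 2) * n + 2" using card_S by simp
    ultimately have "visited [] ?M"
      using M unfolding visited_def gadget_edges_def by (simp add: out_def)
    then show "I 0 ?M" unfolding I_def seen_def by auto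
  next
    fix i M' assume i: "i < length es" and I: "I i M'"
    obtain vs where vs: "visited vs M'" "set vs = seen i" "M' edge_arr 0 = i"
      using I unfolding I_def by blast
    have env': "env (\<lambda>x. of_bool (x \<in> set vs)) M'" using vs unfolding visited_def by blast
    note e' = env_read[OF env'] small
    obtain u v where uv: "es ! i = (u, v)" "u < n" "v < n"
      using edge_ends[OF i] by (cases "es ! i") auto
    have upd: "visited ws (N(vertex_arr := f))" if "visited ws N" for ws N f
      using that env_agree[of _ N "N(vertex_arr := f)"] unfolding visited_def by (simp add: out_def)
    let ?M1 = "M'(vertex_arr := (M' vertex_arr)(0 := u))"
    define vs1 where "vs1 = (if u \<in> set vs then vs else vs @ [u])"
    define vs2 where "vs2 = (if v \<in> set vs1 then vs1 else vs1 @ [v])"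
    have r1: "runs w visit_prog ?M1 (6 * k + 10) (\<lambda>N. visited vs1 N \<and> N edge_arr 0 = i)"
      using runs_visit[OF upd[OF vs(1)], of "(M' vertex_arr)(0 := u)" u] uv vs(3) unfolding vs1_def
      by (auto elim: runs_mono)
    have r2: "runs w (Seq visit_prog (increment edge_arr)) (N(vertex_arr := (N vertex_arr)(0 := v)))
        (6 * k + 11) (I (Suc i))" if N: "visited vs1 N \<and> N edge_arr 0 = i" for N
    proof (rule runs_Seq[where ?T1.0 = "6 * k + 10" and ?T2.0 = 1])
      show "runs w visit_prog (N(vertex_arr := (N vertex_arr)(0 := v))) (6 * k + 10)
          (\<lambda>N'. visited vs2 N' \<and> N' edge_arr 0 = i)"
        using runs_visit[OF upd, of vs1 N "(N vertex_arr)(0 := v)" v] uv N unfolding vs2_def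
        by (auto elim: runs_mono)
      fix N' assume N': "visited vs2 N' \<and> N' edge_arr 0 = i"
      have "set vs2 = seen (Suc i)" using seen_Suc[OF i] uv vs(2) unfolding vs2_def vs1_def by auto
      moreover have "visited vs2 (N'(edge_arr := f))" for f
        using N' env_agree[of _ N' "N'(edge_arr := f)"] unfolding visited_def by (simp add: out_def)
      moreover have "i + 1 < 2 ^ w" using i small(4) by linarith
      ultimately show "runs w (increment edge_arr) N' 1 (I (Suc i))"
        using N' small unfolding I_def by (auto simp: runs_simps)
    qed simp
    have r3: "runs w (Seq (assign vertex_arr snd_expr) (Seq visit_prog (increment edge_arr))) N
        (6 * k + 12) (I (Suc i))" if N: "visited vs1 N \<and> N edge_arr 0 = i" for N
    proof -
      have "env (\<lambda>x. of_bool (x \<in> set vs1)) N" using N unfolding visited_def by blast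
      from env_read[OF this] have "expr_val w snd_expr N = v" "expr_val w (Const 0) N = 0"
        using N i uv small by simp_all
      then show ?thesis unfolding runs_Seq_Write using r2[OF N] by (auto elim: runs_mono)
    qed
    have "runs w (Seq visit_prog (Seq (assign vertex_arr snd_expr) (Seq visit_prog (increment edge_arr))))
        ?M1 (12 * k + 22) (I (Suc i))"
      by (rule runs_Seq[OF r1 r3]) auto
    moreover have "expr_val w fst_expr M' = u" "expr_val w (Const 0) M' = 0"
      using e' vs(3) i uv by simp_all
    ultimately have "runs w ?body M' (12 * k + 23) (I (Suc i))"
      unfolding runs_Seq_Write by (auto elim: runs_mono)
    then show "expr_val w (Op Lt (var edge_arr) m_expr) M' \<noteq> 0 \<and> runs w ?body M' (12 * k + 23) (I (Suc i))"
      using e' vs(3) i by simp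
  next
    fix M' assume "I (length es) M'"
    then obtain vs where vs: "visited vs M'" "M' edge_arr 0 = length es" unfolding I_def by blast
    then have "env (\<lambda>x. of_bool (x \<in> set vs)) M'" unfolding visited_def by blast
    from env_read[OF this] show "expr_val w (Op Lt (var edge_arr) m_expr) M' = 0"
      using vs small by simp
  qed
  moreover have "expr_val w (Const 0) N = 0" for N using small by simp
  moreover have "expr_val w (Op Sub (Op Add (Op Mul layers_expr n_expr) (Const 2)) card_S_expr)
      (M(edge_arr := (M edge_arr)(0 := 0))) = ?t"
  proof -
    have "(k + 2) * n < 2 ^ w" using small(6) by linarith
    moreover have "((k + 2) * n + 2 + 2 ^ w - card S) mod 2 ^ w = ?t"
      using card_S small(6) by (intro sub_mod) auto
    ultimately show ?thesis using env_read[OF M(1)] small by simp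
  qed
  ultimately have "runs w vertices_prog M (length es * (12 * k + 23 + 1) + 3) (I (length es))"
    unfolding vertices_prog_def runs_Seq_Write by simp
  moreover have "seen (length es) = covered E"
    using covered_edge_list[OF es] unfolding seen_def by simp
  ultimately show ?thesis by (elim runs_mono) (auto simp: I_def)
qed

text \<open>With \<open>c\<close> covered and \<open>d\<close> isolated vertices,
  \<open>(k + 2) * (c + d) - c * (k + 1) = c + d * (k + 2)\<close>, and of \<open>S\<close> only the
  isolated members remain deducted.\<close>

lemma visited_ready:
  assumes M: "visited vs M" and vs: "set vs = covered E"
  shows "ready n k E S M"
proof -
  have env': "env (\<lambda>x. of_bool (x \<in> set vs)) M" using M unfolding visited_def by blast
  define c where "c = card (covered E)"
  define d where "d = n - c"
  have "c \<le> card {..<n}" unfolding c_def using Union_E_D by (intro card_mono) auto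
  then have n: "n = c + d" unfolding d_def by simp
  have len: "length vs = c" using M vs distinct_card[of vs] unfolding visited_def c_def by auto
  have S': "card S = card (S \<inter> covered E) + card (S - covered E)"
    using finite_S by (metis card_Diff_subset_Int card_mono finite_Int inf_le1 le_add_diff_inverse)
  have "card (S - covered E) \<le> card ({..<n} - covered E)" using S by (intro card_mono) auto
  also have "\<dots> = d" unfolding d_def c_def
    using Union_E_D finite_covered by (subst card_Diff_subset) auto
  finally have le: "card (S - covered E) \<le> d" .
  have "M target_arr 0 + card S + c * (k + 1) = (k + 2) * n + 2 + card (S \<inter> covered E)"
    using M vs len unfolding visited_def by simp
  then have "M target_arr 0 + card (S - covered E) = c + d * (k + 2) + 2"
    unfolding S' n by (simp add: algebra_simps)
  moreover have "other_clusters n k E S = c + d * (k + 2) - card (S - covered E)"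
    unfolding other_clusters_def c_def[symmetric] d_def ..
  moreover have "d \<le> d * (k + 2)" by simp
  ultimately have "M target_arr 0 = other_clusters n k E S + 2" using le by linarith
  then show ?thesis using env_read[OF env'] vs unfolding ready_def by simp
qed

text \<open>The header is written last and the arrays from \<open>args_arr + offset\<close> on are
  still zero, so the subroutine finds the memory of a fresh call.\<close>

lemma visited_inner:
  assumes M: "visited vs M"
  defines "T \<equiv> gadget_edges n k S es vs"
  shows "inner (M(16 := (M 16)(0 := (k + 2) * n, 1 := length T))) =
    edges_mem ((k + 2) * n) T"
proof
  fix a :: nat
  have o: "out T M" using M unfolding visited_def T_def by blast
  have z: "M 16 = (\<lambda>_. 0)" "\<And>r. r \<ge> 20 \<Longrightarrow> M r = (\<lambda>_. 0)"
    using M unfolding visited_def env_def by auto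
  have h: "(\<lambda>_. 0)(0 := x, 1 := y) = array_of [x, y]" for x y
    by (auto simp: array_of_def less_Suc_eq fun_eq_iff)
  have f: "map fst (map (\<lambda>(x, y, z). (x, y)) T) = map (\<lambda>(x, y, z). x) T"
    "map snd (map (\<lambda>(x, y, z). (x, y)) T) = map (\<lambda>(x, y, z). y) T" by (induction T) auto
  consider "a = 0" | "a = 1" | "a = 2" | "a = 3" | "4 \<le> a" by linarith
  then show "inner (M(16 := (M 16)(0 := (k + 2) * n, 1 := length T))) a =
    edges_mem ((k + 2) * n) T a"
  proof cases
    case 1
    then show ?thesis unfolding inner_def input_mem_def z(1) h by simp
  qed (use o z(2) in \<open>simp_all add: inner_def input_mem_def f out_def del: map_map\<close>)
qed

text \<open>The premise ranges over all orders \<open>vs\<close>, as the order of discovery is not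
  fixed. Besides \<open>K\<close>, only \<open>lg n * 4 + 10\<close> is independent of the number of
  edges, and soft-O absorbs it.\<close>

lemma runs_preprocessing:
  assumes M: "M = input_mem [n, length es, card S] es (map (\<lambda>v. of_bool (v \<in> S)) [0..<n])"
    and k: "k = B * lg n" and n: "2 * (n + 2) < 2 ^ w"
    and P: "\<And>vs. distinct vs \<Longrightarrow> set vs = covered E \<Longrightarrow>
      \<exists>t N. exec w P (edges_mem ((k + 2) * n) (gadget_edges n k S es vs)) t N \<and> t \<le> K \<and> R N"
  shows "runs w (preprocessing_prog B P) M (lg n * 4 + 10 + length es * (22 * k + 42) + K)
    (\<lambda>M'. ready n k E S M' \<and> R (inner M'))"
proof -
  have M0: "M 0 0 = n" "M 7 0 = 0" unfolding M by (simp_all add: input_mem_def array_of_def)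
  have "(2 :: nat) ^ k \<le> 2 ^ k * 2 ^ k * 2 ^ k"
    using self_le_power[of "2 ^ k :: nat" 3] by (simp add: power3_eq_cube)
  then have "2 ^ k < (2 :: nat) ^ w" using small(7) by linarith
  then have "2 ^ (B * lg n) < (2 :: nat) ^ w" using k by simp
  from runs_scale[where w = w and n = n and M = M and B = B, OF M0 n this]
  have scale: "runs w (scale_prog B) M (lg n * 4 + 3) (\<lambda>M'. env (\<lambda>_. 0) M' \<and> out [] M')"
  proof (rule runs_mono)
    fix M' assume M': "M' 6 0 = 2 ^ (B * lg n) \<and> M' 7 0 = B * lg n \<and> (\<forall>r. r \<notin> {6, 7, 10} \<longrightarrow> M' r = M r)"
    then have eq: "M' r = M r" if "r \<notin> {6, 7, 10}" for r using that by blast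
    have "env (\<lambda>_. 0) M'" using M' eq unfolding env_def M by (simp add: k input_mem_def)
    moreover have "out [] M'" using eq unfolding out_def M by (simp add: input_mem_def array_of_Nil)
    ultimately show "env (\<lambda>_. 0) M' \<and> out [] M'" ..
  qed simp_all
  have finish: "runs w (Seq (Write (header_arr + offset) (Const 0) (Op Mul layers_expr n_expr))
     (Seq (Write (header_arr + offset) (Const 1) (var length_arr)) (shift P))) M1 (K + 2)
     (\<lambda>M'. ready n k E S M' \<and> R (inner M'))" if ex: "\<exists>vs. visited vs M1 \<and> set vs = covered E" for M1
  proof -
    obtain vs where vs: "visited vs M1" "set vs = covered E" using ex by blast
    define T where "T = gadget_edges n k S es vs"
    have env1: "env (\<lambda>x. of_bool (x \<in> set vs)) M1" and o: "out T M1" and d: "distinct vs"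
      using vs unfolding visited_def T_def by auto
    let ?M2 = "M1(16 := (M1 16)(0 := (k + 2) * n, 1 := length T))"
    obtain t N where t: "exec w P (inner ?M2) t N" "t \<le> K" "R N"
      using P[OF d vs(2)] visited_inner[OF vs(1)] unfolding T_def by auto
    have "runs w (shift P) ?M2 K (\<lambda>M'. ready n k E S M' \<and> R (inner M'))"
    proof (rule runs_shift[OF t(1,2)], intro conjI)
      show "ready n k E S (with_inner ?M2 N)"
        by (rule ready_agree[OF visited_ready[OF vs]]) (auto simp: with_inner_def)
    qed (simp add: inner_with_inner t)
    moreover have "(k + 2) * n < 2 ^ w" using small(6) by linarith
    moreover have "M1 13 0 = length T" using o unfolding out_def by simp
    ultimately show ?thesis using env_read[OF env1] small by (simp add: runs_simps)
  qed
  have "runs w (preprocessing_prog B P) M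
     ((lg n * 4 + 3) + ((length es * (10 * k + 18) + 2) + ((length es * (12 * k + 24) + 3) + (K + 2))))
     (\<lambda>M'. ready n k E S M' \<and> R (inner M'))"
    unfolding preprocessing_prog_def
    by (rule runs_Seq[OF scale runs_Seq[OF runs_edges runs_Seq[OF runs_vertices finish]]]) auto
  then show ?thesis by (rule runs_mono) (auto simp: algebra_simps)
qed

end

section \<open>Updates and queries\<close>

lemma pair_weight_agree:
  assumes "x mod n \<noteq> y mod n \<or> x mod n \<notin> covered E \<or> (x mod n \<in> S' \<longleftrightarrow> x mod n \<in> S) \<or>
    \<not> (x div n = 0 \<and> y div n = 1 \<or> x div n = 1 \<and> y div n = 0)"
  shows "pair_weight n k E S' x y = pair_weight n k E S x y"
  using assms by (auto simp: pair_weight_def Let_def)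

text \<open>\<open>S\<close> is consulted only for the edge between layers 0 and 1 of a column, so
  membership of \<open>v\<close> affects no other edge, and none at all if \<open>v\<close> has no
  gadget.\<close>

lemma weight_gadget_agree:
  assumes "\<And>u. u \<noteq> v \<Longrightarrow> u \<in> S' \<longleftrightarrow> u \<in> S" and e: "e \<noteq> {v, n + v} \<or> v \<notin> covered E"
  shows "weight (gadget_graph n k E S') e = weight (gadget_graph n k E S) e"
proof (cases "e \<in> all_edges ((k + 2) * n)")
  case False
  then show ?thesis by (simp add: gadget_graph_def)
next
  case True
  then obtain x y where xy: "e = {x, y}" unfolding all_edges_def by auto
  have "pair_weight n k E S' x y = pair_weight n k E S x y"
  proof (rule pair_weight_agree, rule ccontr)
    assume c: "\<not> (x mod n \<noteq> y mod n \<or> x mod n \<notin> covered E \<or> (x mod n \<in> S' \<longleftrightarrow> x mod n \<in> S) \<or>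
      \<not> (x div n = 0 \<and> y div n = 1 \<or> x div n = 1 \<and> y div n = 0))"
    then have "x mod n = v" using assms(1)[of "x mod n"] by blast
    with c have "x mod n = v" "y mod n = v" "v \<in> covered E" by metis+
    moreover have "x = (x div n) * n + x mod n" "y = (y div n) * n + y mod n"
      by (metis div_mult_mod_eq)+
    ultimately have "{x, y} = {v, n + v}" using c by auto
    then show False using e xy \<open>v \<in> covered E\<close> by blast
  qed
  then show ?thesis unfolding xy weight_gadget by simp
qed

context gadget
begin

lemma edge_centre_None:
  assumes "v < n" "v \<in> S"
  shows "weight G {v, n + v} = None"
proof -
  have "(n + v) div n = 1" "(n + v) mod n = v" using assms by simp_all
  then show ?thesis using assms by (simp add: weight_gadget pair_weight_def)
qed

lemma gadget_graph_insert:
  assumes "v \<in> covered E" "v < n"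
  shows "gadget_graph n k E (insert v S) = G\<lparr>weight := (weight G)({v, n + v} := None)\<rparr>"
proof -
  interpret S': gadget n k E "insert v S" by unfold_locales (use E S assms in auto)
  have "weight (gadget_graph n k E (insert v S)) = (weight G)({v, n + v} := None)"
  proof
    fix e show "weight (gadget_graph n k E (insert v S)) e = ((weight G)({v, n + v} := None)) e"
      using weight_gadget_agree[of v "insert v S" S e n E k] S'.edge_centre_None[of v] assms by auto
  qed
  then show ?thesis by (simp add: gadget_graph_def)
qed

lemma gadget_graph_delete:
  assumes "v \<in> covered E" "v < n"
  shows "gadget_graph n k E (S - {v}) =
    G\<lparr>weight := (weight G)({v, n + v} \<mapsto> 2 ^ k * 2 ^ k * 2 ^ k)\<rparr>"
proof -
  interpret S': gadget n k E "S - {v}" by unfold_locales (use E S assms in auto)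
  have "weight (gadget_graph n k E (S - {v})) = (weight G)({v, n + v} \<mapsto> 2 ^ k * 2 ^ k * 2 ^ k)"
  proof
    fix e show "weight (gadget_graph n k E (S - {v})) e =
        ((weight G)({v, n + v} \<mapsto> 2 ^ k * 2 ^ k * 2 ^ k)) e"
      using weight_gadget_agree[of v "S - {v}" S e n E k] S'.edge_centre[of v] assms by auto
  qed
  then show ?thesis by (simp add: gadget_graph_def)
qed

end

fun updated_vertex :: "vertex_update \<Rightarrow> nat" where
  "updated_vertex (InsertV v) = v"
| "updated_vertex (DeleteV v) = v"

fun centre_update :: "nat \<Rightarrow> nat \<Rightarrow> vertex_update \<Rightarrow> edge_update" where
  "centre_update n k (InsertV v) = DeleteE v (n + v)"
| "centre_update n k (DeleteV v) = InsertE v (n + v) (2 ^ k * 2 ^ k * 2 ^ k)"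

fun updated_set :: "vertex_update \<Rightarrow> nat set \<Rightarrow> nat set" where
  "updated_set (InsertV v) S = insert v S"
| "updated_set (DeleteV v) S = S - {v}"

lemma vertex_stepE:
  assumes "vertex_step D' (vsub n E S) x s'" "S \<subseteq> {..<n}"
  shows "s' = vsub n E (updated_set x S)" "updated_vertex x < n"
    "updated_set x S \<subseteq> {..<n}"
  using assms by (auto elim!: vertex_step.cases)

lemma edge_step_centre_update:
  assumes step: "vertex_step (dual_mode D) (vsub n E S) x s'"
    and G: "gadget n E S" and v: "updated_vertex x \<in> covered E"
  shows "edge_step D (gadget_graph n k E S) (centre_update n k x) (gadget_graph n k E (updated_set x S))"
proof -
  interpret gadget n k E S using G by (simp add: gadget_def)
  have vn: "updated_vertex x < n" using v Union_E_D by blast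
  show ?thesis
    using step
  proof cases
    case (1 v)
    then have "v \<in> covered E" "v < n" "v \<notin> S" using v vn by auto
    moreover from this have "{v, n + v} \<in> dom (weight G)" using edge_centre by blast
    moreover have "D \<noteq> Incremental" using 1 by (cases D) auto
    ultimately show ?thesis
      using 1 edge_step.intros(2)[of D v "n + v" G] gadget_graph_insert[of v] by simp
  next
    case (2 v)
    then have "v \<in> covered E" "v < n" "v \<in> S" using v vn by auto
    moreover from this have "{v, n + v} \<notin> dom (weight G)" using edge_centre_None by auto
    moreover have "D \<noteq> Decremental" using 2 by (cases D) auto
    moreover have "{v, n + v} \<in> all_edges (size_V G)"
      using \<open>v < n\<close> by (simp add: all_edges_pair)
    ultimately show ?thesis
      using 2 edge_step.intros(1)[of D v "n + v" G "2 ^ k * 2 ^ k * 2 ^ k"] gadget_graph_delete[of v]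
      by simp
  qed
qed

lemma gadget_graph_uncovered:
  assumes "updated_vertex x \<notin> covered E"
  shows "gadget_graph n k E (updated_set x S) = gadget_graph n k E S"
proof -
  have "weight (gadget_graph n k E (updated_set x S)) = weight (gadget_graph n k E S)"
    by (rule ext, rule weight_gadget_agree[where v = "updated_vertex x"])
      (use assms in \<open>cases x; auto\<close>)+
  then show ?thesis by (simp add: gadget_graph_def)
qed

abbreviation "flag_expr \<equiv> Read args_arr (Const 0)"
abbreviation "arg_expr \<equiv> Read args_arr (Const 1)"
abbreviation "pass i e \<equiv> Write (args_arr + offset) (Const i) e"

text \<open>The inner flag is the negation of the outer one. For an isolated vertex the target alone
  moves, downwards on insertion, because \<open>other_clusters\<close> deducts the isolated members
  of \<open>S\<close>.\<close>

definition update_prog :: "prog \<Rightarrow> prog" where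
  "update_prog P = Seq (Write data_arr arg_expr flag_expr)
     (Cond (Read seen_arr arg_expr)
       (Cond flag_expr
         (Seq (pass 0 (Const 0)) (Seq (pass 1 arg_expr) (Seq (pass 2 (centre arg_expr)) (shift P))))
         (Seq (pass 0 (Const 1)) (Seq (pass 1 arg_expr) (Seq (pass 2 (centre arg_expr))
           (Seq (pass 3 cube_expr) (shift P))))))
       (Cond flag_expr (assign target_arr (Op Sub (var target_arr) (Const 1))) (increment target_arr)))"

lemma put_args_inner:
  assumes "\<And>r. r \<noteq> 20 \<Longrightarrow> 16 \<le> r \<Longrightarrow> M' r = M r"
    and "\<And>i. M' 20 i = (if i < length xs then xs ! i else M 20 i)"
  shows "inner M' = put_args xs (inner M)"
proof
  fix a show "inner M' a = put_args xs (inner M) a"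
    using assms(1)[of "a + 16"] assms(2) by (auto simp: inner_def put_args_def fun_eq_iff)
qed

lemma nth_simps:
  "i < Suc (Suc (Suc 0)) \<longleftrightarrow> i = 0 \<or> i = 1 \<or> i = 2"
  "i < Suc (Suc (Suc (Suc 0))) \<longleftrightarrow> i = 0 \<or> i = 1 \<or> i = 2 \<or> i = 3" for i :: nat
  by auto

context gadget_construction
begin

lemma small_numbers: "3 < (2 :: nat) ^ w"
  using bound by linarith

lemma runs_update_covered:
  assumes M: "ready n k E S M" and v: "updated_vertex x = v" "v < n" "v \<in> covered E"
    and P: "exec w P (put_args (edge_update_args (centre_update n k x)) (inner M)) t N"
  shows "runs w (update_prog P) (put_args (vertex_update_args x) M) (t + 7)
    (\<lambda>M'. ready n k E (updated_set x S) M' \<and> inner M' = N)"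
proof -
  let ?Q = "(\<lambda>M'. ready n k E (updated_set x S) M' \<and> inner M' = N)"
  define A where "A = put_args (vertex_update_args x) M"
  have A: "A r = M r" if "r \<noteq> 4" for r using that unfolding A_def put_args_def by simp
  have s: "M 0 0 = n" "M 8 v = 1" "M 6 0 = 2 ^ k" using M v unfolding ready_def by auto
  have nv: "n + v < 2 ^ w" using above_small[of 1 v] v by simp
  have other: "other_clusters n k E (updated_set x S) = other_clusters n k E S"
  proof -
    have "updated_set x S - covered E = S - covered E" using v by (cases x) auto
    then show ?thesis by (simp add: other_clusters_def)
  qed
  have final: "ready n k E (updated_set x S) (with_inner M' N)"
    if "M' 3 = (M 3)(v := of_bool (v \<in> updated_set x S))"
      "\<And>r. r \<in> {0, 6, 8, 9} \<Longrightarrow> M' r = M r" for M'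
    using that M other v unfolding ready_def by (cases x) (auto simp: with_inner_def)
  show ?thesis
  proof (cases x)
    case (InsertV u)
    then have x: "x = InsertV v" using v by simp
    have a: "A 4 0 = 1" "A 4 (Suc 0) = v" unfolding A_def x put_args_def by simp_all
    let ?M = "A(3 := (M 3)(v := 1), 20 := (M 20)(0 := 0, Suc 0 := v, 2 := n + v))"
    have "inner ?M = put_args (edge_update_args (centre_update n k x)) (inner M)"
      by (rule put_args_inner) (auto simp: A x nth_simps nth_Cons')
    then have "exec w P (inner ?M) t N" using P by simp
    moreover have "ready n k E (updated_set x S) (with_inner ?M N)"
      by (rule final) (auto simp: A x)
    ultimately have "runs w (shift P) ?M t ?Q"
      by (intro runs_shift) (auto simp: inner_with_inner)
    then have "runs w (update_prog P) A (t + 6)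
      ?Q"
      unfolding update_prog_def using a A s nv small small_numbers by (simp add: runs_simps)
    then show ?thesis unfolding A_def by (rule runs_mono) auto
  next
    case (DeleteV u)
    then have x: "x = DeleteV v" using v by simp
    have a: "A 4 0 = 0" "A 4 (Suc 0) = v" unfolding A_def x put_args_def by simp_all
    let ?M = "A(3 := (M 3)(v := 0),
      20 := (M 20)(0 := 1, Suc 0 := v, 2 := n + v, 3 := 2 ^ k * 2 ^ k * 2 ^ k))"
    have "inner ?M = put_args (edge_update_args (centre_update n k x)) (inner M)"
      by (rule put_args_inner) (auto simp: A x nth_simps nth_Cons')
    then have "exec w P (inner ?M) t N" using P by simp
    moreover have "ready n k E (updated_set x S) (with_inner ?M N)"
      by (rule final) (auto simp: A x)
    ultimately have "runs w (shift P) ?M t ?Q"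
      by (intro runs_shift) (auto simp: inner_with_inner)
    then have "runs w (update_prog P) A (t + 7)
      ?Q"
      unfolding update_prog_def using a A s nv small small_numbers by (simp add: runs_simps)
    then show ?thesis unfolding A_def .
  qed
qed

lemma runs_update_uncovered:
  assumes M: "ready n k E S M" and v: "updated_vertex x = v" "v < n" "v \<notin> covered E"
    and x: "\<And>u. x = InsertV u \<Longrightarrow> u \<notin> S" "\<And>u. x = DeleteV u \<Longrightarrow> u \<in> S"
  shows "runs w (update_prog P) (put_args (vertex_update_args x) M) 7
    (\<lambda>M'. ready n k E (updated_set x S) M' \<and> inner M' = inner M)"
proof -
  let ?Q = "(\<lambda>M'. ready n k E (updated_set x S) M' \<and> inner M' = inner M)"
  define A where "A = put_args (vertex_update_args x) M"
  have A: "A r = M r" if "r \<noteq> 4" for r using that unfolding A_def put_args_def by simp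
  have s: "M 0 0 = n" "M 8 v = 0" "M 9 0 = other_clusters n k E S + 2"
    using M v unfolding ready_def by auto
  define c where "c = card (covered E)"
  have "card (covered E) \<le> card {..<n}" using Union_E_D by (intro card_mono) auto
  then have cn: "c \<le> n" unfolding c_def by simp
  have cd: "card ({..<n} - covered E) = n - c"
    unfolding c_def using Union_E_D finite_covered by (subst card_Diff_subset) auto
  have le: "card (S' - covered E) \<le> n - c" if "S' \<subseteq> {..<n}" for S'
    unfolding cd[symmetric] using that by (intro card_mono) auto
  \<comment> \<open>Keeps the truncated subtraction in \<open>other_clusters\<close> exact, so that
    it changes by precisely one.\<close>
  have le2: "n - c \<le> (n - c) * (k + 2)" by simp
  have "c + (n - c) * (k + 2) \<le> (k + 2) * n"
  proof -
    obtain d where "n = c + d" using cn le_Suc_ex by blast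
    then show ?thesis by (simp add: algebra_simps)
  qed
  then have tw: "M 9 0 < 2 ^ w" using s(3) small(6) unfolding other_clusters_def c_def by linarith
  show ?thesis
  proof (cases x)
    case (InsertV u)
    then have x: "x = InsertV v" "v \<notin> S" using v x by auto
    have a: "A 4 0 = 1" "A 4 (Suc 0) = v" unfolding A_def x put_args_def by simp_all
    let ?M = "A(3 := (M 3)(v := 1), 9 := (M 9)(0 := M 9 0 - 1))"
    have "insert v S - covered E = insert v (S - covered E)" using v by blast
    then have "card (insert v S - covered E) = card (S - covered E) + 1"
      using x finite_S by simp
    moreover have "card (insert v S - covered E) \<le> n - c" using S v by (intro le) auto
    ultimately have "other_clusters n k E (insert v S) + 1 = other_clusters n k E S"
      unfolding other_clusters_def c_def[symmetric] using le2 by linarith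
    then have "ready n k E (updated_set x S) ?M"
      using M A s x unfolding ready_def by auto
    moreover have "inner ?M = inner M" using A by (auto simp: inner_def)
    moreover have "(M 9 0 + 2 ^ w - 1) mod 2 ^ w = M 9 0 - 1"
      using s(3) tw by (intro sub_mod) auto
    ultimately have "runs w (update_prog P) A 7
      ?Q"
      unfolding update_prog_def using a A s(1,2) small small_numbers by (simp add: runs_simps)
    then show ?thesis unfolding A_def .
  next
    case (DeleteV u)
    then have x: "x = DeleteV v" "v \<in> S" using v x by auto
    have a: "A 4 0 = 0" "A 4 (Suc 0) = v" unfolding A_def x put_args_def by simp_all
    let ?M = "A(3 := (M 3)(v := 0), 9 := (M 9)(0 := M 9 0 + 1))"
    have "S - covered E = insert v (S - {v} - covered E)" using v x by blast
    then have "card (S - covered E) = card (S - {v} - covered E) + 1"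
      using finite_S by (metis DiffD1 Diff_iff Suc_eq_plus1 card_insert_disjoint finite_Diff singletonI)
    moreover have "card (S - covered E) \<le> n - c" using S by (intro le) auto
    ultimately have o: "other_clusters n k E (S - {v}) = other_clusters n k E S + 1"
      unfolding other_clusters_def c_def[symmetric] using le2 by linarith
    then have "ready n k E (updated_set x S) ?M"
      using M A s x unfolding ready_def by auto
    moreover have "inner ?M = inner M" using A by (auto simp: inner_def)
    moreover have "M 9 0 + 1 < 2 ^ w"
    proof -
      have "other_clusters n k E (S - {v}) \<le> (k + 2) * n"
        unfolding other_clusters_def c_def[symmetric]
        using \<open>c + (n - c) * (k + 2) \<le> (k + 2) * n\<close> by linarith
      then show ?thesis using o s(3) small(6) by linarith
    qed
    ultimately have "runs w (update_prog P) A 7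
      ?Q"
      unfolding update_prog_def using a A s(1,2) small small_numbers by (simp add: runs_simps)
    then show ?thesis unfolding A_def .
  qed
qed

end

text \<open>The product of two bits is their conjunction. Membership of \<open>s\<close> has to be
  tested separately, since a lone vertex outside \<open>S\<close> shares a cluster with itself; for
  \<open>s\<close> in \<open>S\<close>, any \<open>t\<close> in its cluster is in \<open>S\<close>
  automatically.\<close>

definition subconn_query :: "prog \<Rightarrow> prog" where
  "subconn_query P = Seq (pass 0 flag_expr) (Seq (pass 1 arg_expr) (Seq (pass 2 (var scale_arr))
     (Seq (shift P) (assign result_arr
       (Op Mul (Read data_arr flag_expr) (Read (result_arr + offset) (Const 0)))))))"

definition connsub_query :: "prog \<Rightarrow> prog" where
  "connsub_query P = Seq (pass 0 (var scale_arr)) (Seq (shift P)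
     (assign result_arr (Op Lt (Read (result_arr + offset) (Const 0)) (var target_arr))))"

context gadget_construction
begin

lemma runs_subconn_query:
  assumes M: "ready n k E S M" and st: "s < n" "t < n"
    and P: "exec w P (put_args [s, t, 2 ^ k] (inner M)) T N" and r: "N result_arr 0 = of_bool b"
  shows "runs w (subconn_query P) (put_args [s, t] M) (T + 4)
    (\<lambda>M'. ready n k E S M' \<and> inner M' = N \<and> M' result_arr 0 = of_bool (s \<in> S \<and> b))"
proof -
  let ?Q = "(\<lambda>M'. ready n k E S M' \<and> inner M' = N \<and> M' result_arr 0 = of_bool (s \<in> S \<and> b))"
  define A where "A = put_args [s, t] M"
  have A: "A r = M r" if "r \<noteq> 4" for r using that unfolding A_def put_args_def by simp
  have a: "A 4 0 = s" "A 4 (Suc 0) = t" unfolding A_def put_args_def by simp_all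
  have s: "M 3 s = of_bool (s \<in> S)" "M 6 0 = 2 ^ k" using M st unfolding ready_def by auto
  let ?M = "A(20 := (M 20)(0 := s, Suc 0 := t, 2 := 2 ^ k))"
  have "inner ?M = put_args [s, t, 2 ^ k] (inner M)"
    by (rule put_args_inner) (auto simp: A nth_simps nth_Cons')
  then have "exec w P (inner ?M) T N" using P by simp
  then have "runs w (shift P) ?M T (\<lambda>M'. M' = with_inner ?M N)" by (rule runs_shift) auto
  then have "runs w (Seq (shift P) (assign result_arr
       (Op Mul (Read data_arr flag_expr) (Read (result_arr + offset) (Const 0))))) ?M (T + 1)
    ?Q"
  proof (rule runs_Seq[where ?T2.0 = 1])
    fix M' assume M': "M' = with_inner ?M N"
    have lo: "M' r = A r" if "r < 16" for r using that unfolding M' with_inner_def by simp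
    have "M' 21 0 = of_bool b" using r unfolding M' with_inner_def by simp
    moreover have "ready n k E S (M'(5 := f))" for f
      by (rule ready_agree[OF M]) (auto simp: lo A)
    moreover have "inner (M'(5 := f)) = N" for f
      unfolding M' by (auto simp: inner_def with_inner_def)
    ultimately show "runs w (assign result_arr
       (Op Mul (Read data_arr flag_expr) (Read (result_arr + offset) (Const 0)))) M' 1
      ?Q"
      using lo a A s small by (simp add: runs_simps)
  qed simp
  then have "runs w (subconn_query P) A (T + 4)
    ?Q"
    unfolding subconn_query_def using a A s small by (simp add: runs_simps)
  then show ?thesis unfolding A_def .
qed

lemma runs_connsub_query:
  assumes M: "ready n k E S M"
    and P: "exec w P (put_args [2 ^ k] (inner M)) T N"
  shows "runs w (connsub_query P) (put_args [] M) (T + 4)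
    (\<lambda>M'. ready n k E S M' \<and> inner M' = N \<and>
      M' result_arr 0 = of_bool (N result_arr 0 < other_clusters n k E S + 2))"
proof -
  let ?Q = "(\<lambda>M'. ready n k E S M' \<and> inner M' = N \<and> M' result_arr 0 = of_bool (N result_arr 0 < other_clusters n k E S + 2))"
  have s: "M 6 0 = 2 ^ k" "M 9 0 = other_clusters n k E S + 2" using M unfolding ready_def by auto
  have A: "put_args [] M = M" unfolding put_args_def by auto
  let ?M = "M(20 := (M 20)(0 := 2 ^ k))"
  have "inner ?M = put_args [2 ^ k] (inner M)" by (rule put_args_inner) auto
  then have "exec w P (inner ?M) T N" using P by simp
  then have "runs w (shift P) ?M T (\<lambda>M'. M' = with_inner ?M N)" by (rule runs_shift) auto
  then have "runs w (Seq (shift P)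
     (assign result_arr (Op Lt (Read (result_arr + offset) (Const 0)) (var target_arr)))) ?M (T + 1)
    ?Q"
  proof (rule runs_Seq[where ?T2.0 = 1])
    fix M' assume M': "M' = with_inner ?M N"
    have lo: "M' r = M r" if "r < 16" for r using that unfolding M' with_inner_def by simp
    have "M' 21 0 = N 5 0" unfolding M' with_inner_def by simp
    moreover have "ready n k E S (M'(5 := f))" for f
      by (rule ready_agree[OF M]) (auto simp: lo)
    moreover have "inner (M'(5 := f)) = N" for f
      unfolding M' by (auto simp: inner_def with_inner_def)
    ultimately show "runs w (assign result_arr
       (Op Lt (Read (result_arr + offset) (Const 0)) (var target_arr))) M' 1
      ?Q"
      using lo s small by (simp add: runs_simps)
  qed simp
  then have "runs w (connsub_query P) M (T + 2)
    ?Q"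
    unfolding connsub_query_def using s small by (simp add: runs_simps)
  then show ?thesis unfolding A by (rule runs_mono) auto
qed

end

section \<open>Sizes\<close>

text \<open>Covers the numbers of the outer programs as well as vertex count plus any number handed
  to the inner algorithm, hence the two copies of \<open>(k + 2) * n\<close>. The number of edges is
  replaced by \<open>n * n\<close>, to have a bound in \<open>n\<close> alone.\<close>

definition memory_bound :: "nat \<Rightarrow> nat \<Rightarrow> nat" where
  "memory_bound B n = (let k = B * lg n in
     2 * ((k + 2) * n) + 2 * k + 6 + 2 ^ k * 2 ^ k * 2 ^ k + n * n * (2 * k + 3) + n * (k + 1) + 2 * (n + 2))"

text \<open>As \<open>2 ^ lg n \<le> (n + 2) ^ 2\<close>, the scale \<open>2 ^ k\<close> is at most
  \<open>h = (n + 2) ^ (2 * B)\<close>. Three factors \<open>h\<close> give \<open>6 * B\<close>,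
  three factors \<open>n + 2\<close> give 3, and the numerical constant 24, being below
  \<open>2 ^ 5\<close>, gives 5.\<close>

lemma memory_bound_poly: "memory_bound B n \<le> (n + 2) ^ (6 * B + 8)"
proof -
  define k where "k = B * lg n"
  define c where "c = n + 2"
  define h where "h = c ^ (2 * B)"
  have c: "2 \<le> c" "n \<le> c" unfolding c_def by auto
  have h1: "1 \<le> h" unfolding h_def using c by simp
  have "(2 :: nat) ^ k = (2 ^ lg n) ^ B" unfolding k_def by (metis mult.commute power_mult)
  also have "\<dots> \<le> (c ^ 2) ^ B"
    using lg_le[of n] c by (intro power_mono) (auto simp: power2_eq_square c_def intro: order_trans)
  finally have H: "2 ^ k \<le> h" unfolding h_def by (simp add: power_mult)
  have "k < 2 ^ k" by (rule less_exp)
  then have kh: "k \<le> h" using H by linarith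
  define A where "A = h * h * h"
  define F where "F = c * c * c"
  define X where "X = A * F"
  have A: "h \<le> A" "1 \<le> A" unfolding A_def using h1 by simp_all
  have F: "c \<le> F" "c * c \<le> F" "1 \<le> F" unfolding F_def using c by simp_all
  have "(k + 2) * n \<le> (3 * h) * c" using kh h1 c by (intro mult_le_mono) auto
  moreover have "h * c \<le> X" unfolding X_def using A F by (intro mult_le_mono) auto
  moreover have "2 * k + 6 \<le> 8 * (h * 1)" using kh h1 by simp
  moreover have "h * 1 \<le> X" unfolding X_def using A F by (intro mult_le_mono) auto
  moreover have "2 ^ k * 2 ^ k * 2 ^ k \<le> A" unfolding A_def using H by (simp add: mult_le_mono)
  moreover have "A \<le> X" unfolding X_def using F by simp
  moreover have "n * n * (2 * k + 3) \<le> (c * c) * (5 * h)" using kh h1 c by (intro mult_le_mono) auto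
  moreover have "h * (c * c) \<le> X" unfolding X_def using A F by (intro mult_le_mono) auto
  moreover have "n * (k + 1) \<le> c * (2 * h)" using kh h1 c by (intro mult_le_mono) auto
  moreover have "1 * c \<le> X" unfolding X_def using A F by (intro mult_le_mono) auto
  ultimately have "memory_bound B n \<le> 24 * X"
    unfolding memory_bound_def k_def[symmetric] Let_def c_def[symmetric] by (simp add: algebra_simps)
  also have "\<dots> \<le> 2 ^ 5 * X" by simp
  also have "\<dots> \<le> c ^ 5 * X" using c by (intro mult_le_mono1 power_mono) auto
  also have "\<dots> = c ^ (6 * B + 8)"
  proof -
    have "A = c ^ (6 * B)" unfolding A_def h_def by (simp flip: power_add)
    moreover have "F = c ^ 3" unfolding F_def by (simp add: power3_eq_cube)
    ultimately show ?thesis unfolding X_def by (simp add: add.commute flip: power_add)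
  qed
  finally show ?thesis unfolding c_def .
qed

lemma length_edge_list: "edge_list es E \<Longrightarrow> length es = card E"
  unfolding edge_list_def by (metis distinct_card length_map)

lemma card_edges_le: "E \<subseteq> all_edges n \<Longrightarrow> card E \<le> n * n"
proof -
  assume E: "E \<subseteq> all_edges n"
  have "all_edges n \<subseteq> (\<lambda>(u, v). {u, v}) ` ({..<n} \<times> {..<n})"
    by (auto simp: all_edges_def)
  then have "card (all_edges n) \<le> card ((\<lambda>(u, v). {u, v}) ` ({..<n} \<times> {..<n}))"
    by (intro card_mono) auto
  also have "\<dots> \<le> card ({..<n} \<times> {..<n})" by (rule card_image_le) simp
  finally show ?thesis using card_mono[OF all_edges_finite E] by simp
qed

lemma gadget_constructionI:
  assumes "edge_list es E" "E \<subseteq> all_edges n" "S \<subseteq> {..<n}" "memory_bound B n \<le> 2 ^ w"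
  shows "gadget_construction n (B * lg n) E S w es"
proof
  have arith: "a + b + 6 + c + d + e < v"
    if "d \<le> d'" "2 * a + b + 6 + c + d' + e + 2 * (n + 2) \<le> v" for a b c d d' e v :: nat
    using that by presburger
  have "length es * (2 * (B * lg n) + 3) \<le> n * n * (2 * (B * lg n) + 3)"
    using card_edges_le length_edge_list assms by (metis mult_le_mono1)
  then show "(B * lg n + 2) * n + 2 * (B * lg n) + 6 +
      2 ^ (B * lg n) * 2 ^ (B * lg n) * 2 ^ (B * lg n) +
      length es * (2 * (B * lg n) + 3) + n * (B * lg n + 1) < 2 ^ w"
    using assms(4) unfolding memory_bound_def Let_def by (rule arith)
qed (use assms in auto)

lemma fits_inner:
  assumes "memory_bound B n ^ a \<le> 2 ^ w" "(B * lg n + 2) * n + y + 2 \<le> memory_bound B n"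
  shows "fits a w ((B * lg n + 2) * n) y"
proof -
  have "((B * lg n + 2) * n + y + 2) ^ a \<le> memory_bound B n ^ a"
    using assms(2) by (rule power_mono) simp
  then show ?thesis using assms(1) unfolding fits_def by simp
qed

lemma array_of_le: "\<forall>x \<in> set xs. x \<le> K \<Longrightarrow> array_of xs i \<le> K"
  by (simp add: array_of_def)

lemma input_mem_le:
  assumes "\<forall>x \<in> set hs. x \<le> K" "\<forall>(u, v) \<in> set es. u \<le> K \<and> v \<le> K" "\<forall>x \<in> set xs. x \<le> K"
  shows "input_mem hs es xs b i \<le> K"
  unfolding input_mem_def using assms by (fastforce intro!: array_of_le)

context gadget
begin

lemma weight_le:
  assumes "weight G {x, y} = Some z"
  shows "z \<le> 2 ^ k * 2 ^ k * 2 ^ k"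
proof -
  have "(1 :: nat) \<le> 2 ^ k" by simp
  then have "(1 :: nat) \<le> 2 ^ k * 2 ^ k * 2 ^ k" "(2 :: nat) ^ k \<le> 2 ^ k * 2 ^ k * 2 ^ k"
    "(2 :: nat) ^ k * 2 ^ k \<le> 2 ^ k * 2 ^ k * 2 ^ k" by simp_all
  then show ?thesis
    using assms by (auto simp: weight_gadget pair_weight_def Let_def split: if_splits)
qed

text \<open>At most \<open>2 * m\<close> columns carry a star, and
  \<open>m * (2 * k + 3) + 2 * m * (k + 1) = m * (4 * k + 5)\<close>.\<close>

lemma card_gadget_edges:
  assumes es: "edge_list es E" and vs: "set vs = covered E" "distinct vs"
  shows "length (gadget_edges n k S es vs) \<le> card E * (4 * k + 5)"
proof -
  have "length vs = card (fst ` set es \<union> snd ` set es)"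
    using distinct_card[OF vs(2)] vs(1) covered_edge_list[OF es] by simp
  also have "\<dots> \<le> card (fst ` set es) + card (snd ` set es)" by (rule card_Un_le)
  also have "\<dots> \<le> card (set es) + card (set es)" by (intro add_mono card_image_le) auto
  also have "\<dots> \<le> 2 * length es" using card_length[of es] by simp
  finally have "length vs * (k + 1) \<le> 2 * length es * (k + 1)" by (rule mult_le_mono1)
  then show ?thesis
    using length_gadget_edges[of n k S es vs] length_edge_list[OF es] by (simp add: algebra_simps)
qed

lemma covered_list: obtains vs where "set vs = covered E" "distinct vs"
  using finite_distinct_list[OF finite_covered] by blast

lemma card_dom_le:
  assumes "edge_list es E"
  shows "card (dom (weight G)) \<le> card E * (4 * k + 5)"
proof -
  obtain vs where vs: "set vs = covered E" "distinct vs" by (rule covered_list)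
  show ?thesis using gadget_edge_list(3)[OF assms vs] card_gadget_edges[OF assms vs] by simp
qed

end

context gadget_construction
begin

lemma gadget_input:
  assumes vs: "set vs = covered E" "distinct vs"
  defines "T \<equiv> gadget_edges n k S es vs"
  shows "wgraph_input G (edges_mem ((k + 2) * n) T)"
  unfolding wgraph_input_def
proof (intro conjI exI)
  show "wgraph_ok G" by (rule wgraph_ok_gadget)
  show "edge_list (map (\<lambda>(x, y, z). (x, y)) T) (dom (weight G))"
    using gadget_edge_list(1)[OF es vs] unfolding T_def .
  show "edges_mem ((k + 2) * n) T =
    input_mem [size_V G, length (map (\<lambda>(x, y, z). (x, y)) T)] (map (\<lambda>(x, y, z). (x, y)) T)
      (map (\<lambda>(u, v). the (weight G {u, v})) (map (\<lambda>(x, y, z). (x, y)) T))"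
    unfolding T_def gadget_edge_list(2)[OF es vs] by simp
qed

lemma gadget_input_le:
  assumes vs: "set vs = covered E" "distinct vs" and k: "k = B * lg n"
  defines "T \<equiv> gadget_edges n k S es vs"
  shows "(k + 2) * n + edges_mem ((k + 2) * n) T b i + 2 \<le> memory_bound B n"
proof -
  let ?X = "(k + 2) * n + 2 ^ k * 2 ^ k * 2 ^ k + n * n * (2 * k + 3) + n * (k + 1)"
  have "length vs \<le> card {..<n}"
    using distinct_card[OF vs(2)] vs(1) Union_E_D card_mono[of "{..<n}" "covered E"] by auto
  then have "length vs * (k + 1) \<le> n * (k + 1)" by (intro mult_le_mono1) simp
  moreover have "length es * (2 * k + 3) \<le> n * n * (2 * k + 3)"
    using card_edges_le[OF E] length_edge_list[OF es] by (intro mult_le_mono1) simp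
  ultimately have "length T \<le> ?X"
    using length_gadget_edges[of n k S es vs] unfolding T_def by linarith
  moreover have "x \<le> ?X \<and> y \<le> ?X \<and> z \<le> ?X" if "(x, y, z) \<in> set T" for x y z
  proof -
    have w: "weight G {x, y} = Some z"
      using gadget_edges_weight[OF es vs(1)] that unfolding T_def by blast
    then have "x < (k + 2) * n" "y < (k + 2) * n" using edge_lt[of x y] by auto
    then show ?thesis using weight_le[OF w] by linarith
  qed
  ultimately have "edges_mem ((k + 2) * n) T b i \<le> ?X"
    by (intro input_mem_le) auto
  then show ?thesis unfolding memory_bound_def k[symmetric] Let_def by linarith
qed

end

section \<open>Work bounds\<close>

text \<open>The \<open>+ 1\<close> keeps a graph with one edge in range even for
  \<open>m = 0\<close>; updates of isolated vertices are charged to it.\<close>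

definition edge_bound :: "nat \<Rightarrow> nat \<Rightarrow> nat \<Rightarrow> nat" where
  "edge_bound B m n = m * (4 * (B * lg n) + 5) + 1"

text \<open>The gadget graph has more edges the fewer vertices are in \<open>S\<close>, and nothing is assumed about
  the monotonicity of the given bounds, hence the maximum.\<close>

definition worst :: "nat \<Rightarrow> (nat \<Rightarrow> nat \<Rightarrow> real) \<Rightarrow> nat \<Rightarrow> nat \<Rightarrow> real" where
  "worst B f m n = Max ((\<lambda>j. f j ((B * lg n + 2) * n)) ` {..edge_bound B m n})"

lemma worst_ge: "j \<le> edge_bound B m n \<Longrightarrow> f j ((B * lg n + 2) * n) \<le> worst B f m n"
  unfolding worst_def by (intro Max_ge) auto

lemma log_ge_1: "1 \<le> log 2 (real n + 2)"
  by (simp add: le_log_iff)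

lemma lg_le_log: "real (lg n) \<le> 2 * log 2 (real n + 2)"
proof -
  have "real (2 ^ lg n) \<le> real (2 * (n + 2))" using lg_le[of n] by (simp only: of_nat_le_iff)
  then have "(2 :: real) ^ lg n \<le> 2 * (real n + 2)" by simp
  then have "log 2 (2 ^ lg n) \<le> log 2 (2 * (real n + 2))" by (subst log_le_cancel_iff) auto
  also have "\<dots> = 1 + log 2 (real n + 2)" by (subst log_mult) auto
  finally have "real (lg n) \<le> 1 + log 2 (real n + 2)" by simp
  then show ?thesis using log_ge_1[of n] by linarith
qed

lemma soft_O_linear:
  assumes "\<And>m n. f m n \<le> C * max 1 (g m n) * log 2 (real n + 2)" "C > 0"
  shows "f \<in> soft_O g"
  unfolding soft_O_def using assms by (intro CollectI exI[of _ C] conjI exI[of _ 1]) auto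

lemma soft_O_affine:
  assumes f: "\<And>m n. f m n \<le> (a + b * real (lg n)) * max 1 (g m n)" and ab: "a > 0" "b \<ge> 0"
  shows "f \<in> soft_O g"
proof (rule soft_O_linear[where C = "a + 2 * b"])
  fix m n
  have "a \<le> a * log 2 (real n + 2)" "b * real (lg n) \<le> b * (2 * log 2 (real n + 2))"
    using log_ge_1[of n] lg_le_log[of n] ab by (auto intro: mult_left_mono)
  then have "a + b * real (lg n) \<le> (a + 2 * b) * log 2 (real n + 2)" by (simp add: algebra_simps)
  then have "(a + b * real (lg n)) * max 1 (g m n) \<le> ((a + 2 * b) * log 2 (real n + 2)) * max 1 (g m n)"
    by (intro mult_right_mono) auto
  then show "f m n \<le> (a + 2 * b) * max 1 (g m n) * log 2 (real n + 2)"
    using f[of m n] by (simp add: mult_ac)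
qed (use ab in auto)

text \<open>Nothing is known about the shape of \<open>f\<close>, so the witness
  \<open>\<mu>\<close> is a place where the maximum is attained; being at most
  \<open>edge_bound\<close>, it is soft-O of \<open>m\<close>.\<close>

lemma worst_soft_comp:
  assumes "c > 0"
  shows "(\<lambda>m n. c * worst B f m n) \<in> soft_comp f"
proof -
  have "\<exists>j. j \<le> edge_bound B m n \<and> worst B f m n = f j ((B * lg n + 2) * n)" for m n
  proof -
    have "worst B f m n \<in> (\<lambda>j. f j ((B * lg n + 2) * n)) ` {..edge_bound B m n}"
      unfolding worst_def by (intro Max_in) auto
    then show ?thesis by auto
  qed
  then obtain \<mu> where \<mu>: "\<And>m n. \<mu> m n \<le> edge_bound B m n"
    "\<And>m n. worst B f m n = f (\<mu> m n) ((B * lg n + 2) * n)"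
    by metis
  have "(\<lambda>m n. real (\<mu> m n)) \<in> soft_O (\<lambda>m n. real m)"
  proof (rule soft_O_affine[where a = 6 and b = "4 * real B"])
    fix m n
    have "real (\<mu> m n) \<le> real (edge_bound B m n)" using \<mu>(1) by simp
    also have "\<dots> = real m * (4 * real B * real (lg n) + 5) + 1"
      unfolding edge_bound_def by simp
    also have "\<dots> \<le> max 1 (real m) * (4 * real B * real (lg n) + 5) + max 1 (real m)"
      by (intro add_mono mult_right_mono) auto
    finally show "real (\<mu> m n) \<le> (6 + 4 * real B * real (lg n)) * max 1 (real m)"
      by (simp add: algebra_simps)
  qed auto
  moreover have "(\<lambda>m n. real ((B * lg n + 2) * n)) \<in> soft_O (\<lambda>m n. real n)"
  proof (rule soft_O_affine[where a = 2 and b = "real B"])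
    fix m n :: nat
    have "real ((B * lg n + 2) * n) = (2 + real B * real (lg n)) * real n" by (simp add: algebra_simps)
    also have "\<dots> \<le> (2 + real B * real (lg n)) * max 1 (real n)" by (intro mult_left_mono) auto
    finally show "real ((B * lg n + 2) * n) \<le> (2 + real B * real (lg n)) * max 1 (real n)" .
  qed auto
  ultimately show ?thesis
    unfolding soft_comp_def using \<mu>(2) assms
    by (intro CollectI exI[of _ \<mu>] exI[of _ "\<lambda>m n. (B * lg n + 2) * n"] conjI exI[of _ c]) auto
qed

lemma solvableE:
  assumes "solvable \<Pi> p u q"
  obtains Pre Upd Qry a where "a > 0"
    and "\<And>w s M. initial \<Pi> a w s M \<Longrightarrow>
      \<exists>t M'. exec w Pre M t M' \<and> real t \<le> p (edges \<Pi> s) (verts \<Pi> s)"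
    and "\<And>w s M x s'. reachable \<Pi> a w Pre Upd Qry s M \<Longrightarrow> can_update \<Pi> a w s x s' \<Longrightarrow>
      \<exists>t M'. exec w Upd (put_args (update_args \<Pi> x) M) t M' \<and> real t \<le> u (edges \<Pi> s) (verts \<Pi> s)"
    and "\<And>w s M x. reachable \<Pi> a w Pre Upd Qry s M \<Longrightarrow> can_query \<Pi> a w s x \<Longrightarrow>
      \<exists>t M'. exec w Qry (put_args (query_args \<Pi> x) M) t M' \<and>
        real t \<le> q (edges \<Pi> s) (verts \<Pi> s) \<and> answer \<Pi> s x (M' result_arr 0)"
proof -
  obtain Pre Upd Qry a where a: "a > 0" and *: "\<forall>w.
     (\<forall>s M. initial \<Pi> a w s M \<longrightarrow>
        (\<exists>t M'. exec w Pre M t M' \<and> real t \<le> p (edges \<Pi> s) (verts \<Pi> s))) \<and>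
     (\<forall>s M x s'. reachable \<Pi> a w Pre Upd Qry s M \<and> can_update \<Pi> a w s x s' \<longrightarrow>
        (\<exists>t M'. exec w Upd (put_args (update_args \<Pi> x) M) t M' \<and>
           real t \<le> u (edges \<Pi> s) (verts \<Pi> s))) \<and>
     (\<forall>s M x. reachable \<Pi> a w Pre Upd Qry s M \<and> can_query \<Pi> a w s x \<longrightarrow>
        (\<exists>t M'. exec w Qry (put_args (query_args \<Pi> x) M) t M' \<and>
           real t \<le> q (edges \<Pi> s) (verts \<Pi> s) \<and> answer \<Pi> s x (M' result_arr 0)))"
    using assms unfolding solvable_def by (elim exE conjE)
  show thesis
    by (rule that[of a Pre Upd Qry, OF a]) (use * in blast)+
qed

text \<open>The update of an isolated vertex does not use the given algorithm; its constant work is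
  charged to an update of a graph with a single edge.\<close>

lemma update_work_pos:
  fixes \<Pi> :: "(wgraph, edge_update, 'q) dyn_problem"
  assumes \<Pi>: "verts \<Pi> = size_V" "edges \<Pi> = (\<lambda>G. card (dom (weight G)))" "input \<Pi> = wgraph_input"
      "update \<Pi> = edge_step D" "update_args \<Pi> = edge_update_args"
    and "solvable \<Pi> p u q" and N: "3 \<le> N"
  shows "1 \<le> u 1 N"
proof (rule solvableE[OF assms(6)])
  fix Pre Upd Qry a
  assume pre: "\<And>w s M. initial \<Pi> a w s M \<Longrightarrow>
      \<exists>t M'. exec w Pre M t M' \<and> real t \<le> p (edges \<Pi> s) (verts \<Pi> s)"
    and upd: "\<And>w s M x s'. reachable \<Pi> a w Pre Upd Qry s M \<Longrightarrow> can_update \<Pi> a w s x s' \<Longrightarrow>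
      \<exists>t M'. exec w Upd (put_args (update_args \<Pi> x) M) t M' \<and> real t \<le> u (edges \<Pi> s) (verts \<Pi> s)"
  \<comment> \<open>Any \<open>w\<close> with \<open>(2 * N + 2) ^ a \<le> 2 ^ w\<close> would do;
    the power itself is one.\<close>
  define w where "w = (2 * N + 2) ^ a"
  have fits: "fits a w N y" if "y \<le> N" for y
  proof -
    have "(N + y + 2) ^ a \<le> w" unfolding w_def using that by (intro power_mono) auto
    also have "w \<le> 2 ^ w" using less_exp[of w] by simp
    finally show ?thesis unfolding fits_def .
  qed
  define G where "G = \<lparr>size_V = N, weight = [{0, 1} \<mapsto> 1]\<rparr>"
  define M where "M = input_mem [N, 1] [(0, 1)] [1]"
  have "wgraph_input G M"
    unfolding wgraph_input_def
  proof (intro conjI exI[of _ "[(0, 1)]"])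
    show "wgraph_ok G" using N unfolding wgraph_ok_def G_def by (auto simp: all_edges_pair)
  qed (auto simp: edge_list_def G_def M_def)
  moreover have "M b i \<le> N" for b i
    unfolding M_def using N by (intro input_mem_le) auto
  ultimately have init: "initial \<Pi> a w G M"
    unfolding initial_def \<Pi> using fits by (simp add: G_def)
  then obtain t M' where "exec w Pre M t M'" using pre by blast
  with init have reach: "reachable \<Pi> a w Pre Upd Qry G M'" by (rule reachable.preprocess)
  \<comment> \<open>A legal update must exist in every mode: deleting the edge, or in the
    incremental mode inserting \<open>{0, 2}\<close>, for which a third vertex is at hand.\<close>
  have "\<exists>x s'. can_update \<Pi> a w G x s'"
  proof (cases "D = Incremental")
    case True
    have "{0, 2} \<in> all_edges (size_V G)" "{0, 2} \<notin> dom (weight G)"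
      using N by (auto simp: all_edges_pair G_def doubleton_eq_iff)
    then have "edge_step D G (InsertE 0 2 1) (G\<lparr>weight := (weight G)({0, 2} \<mapsto> 1)\<rparr>)"
      using True by (intro edge_step.intros) auto
    then have "can_update \<Pi> a w G (InsertE 0 2 1) (G\<lparr>weight := (weight G)({0, 2} \<mapsto> 1)\<rparr>)"
      unfolding can_update_def \<Pi> using fits N by (auto simp: G_def)
    then show ?thesis by blast
  next
    case False
    then have "edge_step D G (DeleteE 0 1) (G\<lparr>weight := (weight G)({0, 1} := None)\<rparr>)"
      by (intro edge_step.intros) (auto simp: G_def)
    then have "can_update \<Pi> a w G (DeleteE 0 1) (G\<lparr>weight := (weight G)({0, 1} := None)\<rparr>)"
      unfolding can_update_def \<Pi> using fits N by (auto simp: G_def)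
    then show ?thesis by blast
  qed
  then obtain x t N' where "exec w Upd (put_args (update_args \<Pi> x) M') t N'"
    "real t \<le> u (edges \<Pi> G) (verts \<Pi> G)"
    using upd[OF reach] by blast
  moreover from this have "1 \<le> t" using exec_pos by blast
  ultimately show "1 \<le> u 1 N" unfolding \<Pi> by (simp add: G_def)
qed

text \<open>Removes the asymptotics: \<open>d1\<close> pays for the constant and the finitely many
  small \<open>n\<close>, \<open>d2\<close> for the exponent. The base \<open>n + 2\<close> is at
  least 2, so constants become powers of it.\<close>

lemma poly_bound:
  fixes lam :: "nat \<Rightarrow> real"
  assumes "lam \<in> O(\<lambda>n. real n powr c)" "c > 0"
  shows "\<exists>d. \<forall>n. lam n \<le> (real n + 2) ^ d"
proof -
  obtain C where C: "C > 0" "eventually (\<lambda>n. norm (lam n) \<le> C * norm (real n powr c)) at_top"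
    using assms(1) by (rule landau_o.bigE)
  then obtain n0 where n0: "\<And>n. n0 \<le> n \<Longrightarrow> norm (lam n) \<le> C * norm (real n powr c)"
    unfolding eventually_at_top_linorder by blast
  obtain d1 where d1: "C + (\<Sum>i<n0. \<bar>lam i\<bar>) < 2 ^ d1"
    using real_arch_pow[of 2] by auto
  define d2 where "d2 = nat \<lceil>c\<rceil>"
  have s: "0 \<le> (\<Sum>i<n0. \<bar>lam i\<bar>)" by (rule sum_nonneg) simp
  have "lam n \<le> (real n + 2) ^ (d1 + d2)" for n
  proof -
    have p1: "(2 :: real) ^ d1 \<le> (real n + 2) ^ d1" by (intro power_mono) auto
    have Cd: "C \<le> (real n + 2) ^ d1" using d1 s p1 by linarith
    have p2: "1 \<le> (real n + 2) ^ d2" by (intro one_le_power) auto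
    show ?thesis
    proof (cases "n0 \<le> n")
      case True
      have "real n powr c \<le> (real n + 2) powr c" using assms(2) by (intro powr_mono2) auto
      also have "\<dots> \<le> (real n + 2) powr real d2"
        unfolding d2_def using assms(2) by (intro powr_mono) linarith+
      also have "\<dots> = (real n + 2) ^ d2" by (intro powr_realpow) auto
      finally have le: "real n powr c \<le> (real n + 2) ^ d2" .
      have "lam n \<le> C * real n powr c" using n0[OF True] by simp
      also have "\<dots> \<le> (real n + 2) ^ d1 * (real n + 2) ^ d2"
        using le Cd by (intro mult_mono) auto
      finally show ?thesis by (simp add: power_add)
    next
      case False
      then have "\<bar>lam n\<bar> \<le> (\<Sum>i<n0. \<bar>lam i\<bar>)" by (intro member_le_sum) auto
      then have "lam n \<le> (real n + 2) ^ d1 * 1" using d1 C(1) p1 by linarith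
      also have "\<dots> \<le> (real n + 2) ^ d1 * (real n + 2) ^ d2" using p2 by (intro mult_left_mono) auto
      finally show ?thesis by (simp add: power_add)
    qed
  qed
  then show ?thesis by blast
qed

text \<open>The size at which \<open>lam\<close> is evaluated contains \<open>B\<close> itself, but
  only as a factor, so it adds about \<open>d * log B\<close> to the exponent; \<open>B\<close> just
  has to be large against its own logarithm.\<close>

lemma height_exists:
  fixes lam :: "nat \<Rightarrow> real"
  assumes d: "\<And>n. lam n \<le> (real n + 2) ^ d"
  shows "\<exists>B > 0. \<forall>n. 2 * lam ((B * lg n + 2) * n) < 2 ^ (B * lg n)"
proof -
  \<comment> \<open>With \<open>B = 4 ^ a\<close> the factor \<open>(B + 2) ^ d\<close> costs
    \<open>(2 * a + 1) * d\<close> in the exponent, linear in \<open>a\<close>, whereas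
    \<open>B\<close> is at least \<open>(a + 1) ^ 2\<close>; \<open>a = 3 * d + 4\<close> makes the
    square win.\<close>
  define a where "a = 3 * d + 4"
  define B :: nat where "B = 2 ^ (2 * a)"
  have "a + 1 \<le> 2 ^ a" using less_exp[of a] by linarith
  then have "(a + 1) * (a + 1) \<le> 2 ^ a * 2 ^ a" by (intro mult_le_mono)
  then have B_ge: "(a + 1) * (a + 1) \<le> B" unfolding B_def by (simp add: mult_2 power_add)
  have "2 * 1 \<le> (a + 1) * (a + 1)" unfolding a_def by (intro mult_le_mono) auto
  then have B2: "2 \<le> B" using B_ge by simp
  have "B + 2 \<le> 2 ^ (2 * a + 1)" using B2 unfolding B_def by simp
  then have "(B + 2) ^ d \<le> (2 ^ (2 * a + 1)) ^ d" by (rule power_mono) simp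
  then have Bd: "(B + 2) ^ d \<le> 2 ^ ((2 * a + 1) * d)" by (simp only: power_mult)
  have e: "1 + (2 * a + 1) * d + 2 * d < B"
  proof -
    have "(2 * a + 1) * d + 2 * d = a * (2 * d) + 3 * d" by (simp add: algebra_simps)
    also have "\<dots> \<le> a * a + a" unfolding a_def by (intro add_mono mult_le_mono) auto
    finally have "(2 * a + 1) * d + 2 * d \<le> a * a + a" .
    moreover have "0 < a" unfolding a_def by simp
    moreover have "(a + 1) * (a + 1) = a * a + 2 * a + 1" by simp
    ultimately show ?thesis using B_ge by linarith
  qed
  have main: "2 * lam ((B * lg n + 2) * n) < 2 ^ (B * lg n)" for n
  proof -
    define l where "l = lg n"
    have l: "1 \<le> l" "l \<le> 2 ^ l" "n + 2 \<le> 2 ^ l"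
      using lg_pos[of n] le_lg[of n] less_exp[of l] unfolding l_def by linarith+
    have "(B * l + 2) * n + 2 \<le> (B * l + 2) * (n + 2)" by (simp add: algebra_simps)
    also have "\<dots> \<le> ((B + 2) * l) * 2 ^ l" using l by (intro mult_le_mono) (auto simp: algebra_simps)
    also have "\<dots> \<le> ((B + 2) * 2 ^ l) * 2 ^ l" using l by (intro mult_le_mono) auto
    also have "\<dots> = (B + 2) * 2 ^ (2 * l)" by (simp only: mult_2 power_add mult.assoc)
    finally have N: "(B * l + 2) * n + 2 \<le> (B + 2) * 2 ^ (2 * l)" .
    then have "((B * l + 2) * n + 2) ^ d \<le> ((B + 2) * 2 ^ (2 * l)) ^ d" by (rule power_mono) simp
    also have "\<dots> = (B + 2) ^ d * 2 ^ (2 * l * d)" by (simp only: power_mult_distrib power_mult)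
    also have "\<dots> \<le> 2 ^ ((2 * a + 1) * d) * 2 ^ (2 * l * d)" using Bd by (rule mult_le_mono1)
    also have "\<dots> = 2 ^ ((2 * a + 1) * d + 2 * l * d)" by (simp add: power_add)
    finally have 1: "((B * l + 2) * n + 2) ^ d \<le> 2 ^ ((2 * a + 1) * d + 2 * l * d)" .
    have "1 + (2 * a + 1) * d + 2 * l * d < B * l"
    proof -
      have "(1 + (2 * a + 1) * d) * 1 + 2 * d * l \<le> (1 + (2 * a + 1) * d) * l + 2 * d * l"
        using l by (intro add_mono mult_le_mono) auto
      also have "\<dots> = (1 + (2 * a + 1) * d + 2 * d) * l" by (simp add: algebra_simps)
      also have "\<dots> < B * l" using e l by (intro mult_strict_right_mono) auto
      finally show ?thesis by (simp add: algebra_simps)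
    qed
    then have "(2 :: nat) ^ (1 + (2 * a + 1) * d + 2 * l * d) < 2 ^ (B * l)"
      by (intro power_strict_increasing) auto
    then have "2 * ((B * l + 2) * n + 2) ^ d < 2 ^ (B * l)" using 1 by simp
    then have "real (2 * ((B * l + 2) * n + 2) ^ d) < real (2 ^ (B * l))" by (simp only: of_nat_less_iff)
    then have "2 * (real ((B * l + 2) * n) + 2) ^ d < 2 ^ (B * l)"
      by (simp only: of_nat_mult[of 2] of_nat_power of_nat_add of_nat_numeral)
    then show ?thesis using d[of "(B * l + 2) * n"] unfolding l_def[symmetric] by linarith
  qed
  then show ?thesis using B2 by (intro exI[of _ B]) auto
qed

section \<open>The reduction\<close>

text \<open>Both reductions share the gadget graph, the preprocessing and the updates; only the
  translation of queries differs, and it enters as the hypothesis \<open>query\<close>.\<close>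

lemma transfer:
  fixes \<Pi> :: "(wgraph, edge_update, 'q) dyn_problem" and \<Pi>' :: "(vsubgraph, vertex_update, 'r) dyn_problem"
  assumes B: "B > 0"
    and \<Pi>: "verts \<Pi> = size_V" "edges \<Pi> = (\<lambda>G. card (dom (weight G)))" "input \<Pi> = wgraph_input"
      "update \<Pi> = edge_step D" "update_args \<Pi> = edge_update_args"
    and \<Pi>': "verts \<Pi>' = sg_n" "edges \<Pi>' = (\<lambda>G. card (sg_E G))" "input \<Pi>' = vsubgraph_input"
      "update \<Pi>' = vertex_step (dual_mode D)" "update_args \<Pi>' = vertex_update_args"
    and query: "\<And>n E S es w M x. gadget_construction n (B * lg n) E S w es \<Longrightarrow>
      ready n (B * lg n) E S M \<Longrightarrow> legal_query \<Pi>' (vsub n E S) x \<Longrightarrow>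
      \<exists>y. legal_query \<Pi> (gadget_graph n (B * lg n) E S) y \<and>
        (\<forall>z \<in> set (query_args \<Pi> y). z \<le> n + 2 ^ (B * lg n)) \<and>
        (\<forall>P t N. exec w P (put_args (query_args \<Pi> y) (inner M)) t N \<longrightarrow>
          answer \<Pi> (gadget_graph n (B * lg n) E S) y (N result_arr 0) \<longrightarrow>
          runs w (Q P) (put_args (query_args \<Pi>' x) M) (t + 4) (\<lambda>M'. ready n (B * lg n) E S M' \<and>
            inner M' = N \<and> answer \<Pi>' (vsub n E S) x (M' result_arr 0)))"
    and solv: "solvable \<Pi> p u q"
  shows "\<exists>p' u' q'. solvable \<Pi>' p' u' q' \<and>
    p' \<in> soft_m_plus_comp p \<and> u' \<in> soft_comp u \<and> q' \<in> soft_comp q"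
proof (rule solvableE[OF solv])
  fix Pre Upd Qry a
  assume a: "a > 0"
    and pre: "\<And>w s M. initial \<Pi> a w s M \<Longrightarrow>
      \<exists>t M'. exec w Pre M t M' \<and> real t \<le> p (edges \<Pi> s) (verts \<Pi> s)"
    and upd: "\<And>w s M x s'. reachable \<Pi> a w Pre Upd Qry s M \<Longrightarrow> can_update \<Pi> a w s x s' \<Longrightarrow>
      \<exists>t M'. exec w Upd (put_args (update_args \<Pi> x) M) t M' \<and> real t \<le> u (edges \<Pi> s) (verts \<Pi> s)"
    and qry: "\<And>w s M x. reachable \<Pi> a w Pre Upd Qry s M \<Longrightarrow> can_query \<Pi> a w s x \<Longrightarrow>
      \<exists>t M'. exec w Qry (put_args (query_args \<Pi> x) M) t M' \<and>
        real t \<le> q (edges \<Pi> s) (verts \<Pi> s) \<and> answer \<Pi> s x (M' result_arr 0)"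
  define K where "K = (\<lambda>n. B * lg n)"
  define G where "G = (\<lambda>n E S. gadget_graph n (K n) E S)"
  define own where "own = (\<lambda>m n. lg n * 4 + 10 + m * (22 * K n + 42))"
  \<comment> \<open>Ties the two levels together: the shifted arrays hold a reachable memory of the
    inner algorithm for the current gadget graph. The bound on \<open>w\<close> is remembered from
    the preprocessing, since a query without arguments says nothing about \<open>w\<close>.\<close>
  define J where "J = (\<lambda>w s M. \<exists>n E S es. s = vsub n E S \<and>
    gadget_construction n (K n) E S w es \<and> ready n (K n) E S M \<and>
    reachable \<Pi> a w Pre Upd Qry (G n E S) (inner M) \<and> memory_bound B n ^ a \<le> 2 ^ w)"
  have worst: "f (edges \<Pi> (G n E S)) (verts \<Pi> (G n E S)) \<le> worst B f (card E) n"
    if "gadget_construction n (K n) E S w es" for f n E S w es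
  proof -
    interpret gadget_construction n "K n" E S w es by fact
    have "edges \<Pi> (G n E S) \<le> edge_bound B (card E) n"
      using card_dom_le[OF es] unfolding \<Pi> G_def edge_bound_def K_def by simp
    from worst_ge[OF this, of f] show ?thesis unfolding \<Pi> G_def K_def by simp
  qed
  have fits': "fits a w (verts \<Pi> (G n E S)) y"
    if "memory_bound B n ^ a \<le> 2 ^ w" "y \<le> n + (K n + 2) * n + 2 ^ K n * 2 ^ K n * 2 ^ K n" for n E S w y
  proof -
    have arith: "c + y + 2 \<le> 2 * c + d + 6 + h + e + f + 2 * (n + 2)" if "y \<le> n + c + h" for c d e f h
      using that by simp
    have "(K n + 2) * n + y + 2 \<le> memory_bound B n"
      using that(2) unfolding memory_bound_def K_def Let_def by (rule arith)
    then show ?thesis using fits_inner[OF that(1), of y] unfolding \<Pi> G_def K_def by simp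
  qed
  \<comment> \<open>The factors 8 and 5 absorb the overheads of 7 and 4, as every execution costs at
    least 1.\<close>
  have "solvable \<Pi>' (\<lambda>m n. real (own m n) + worst B p m n) (\<lambda>m n. 8 * worst B u m n)
    (\<lambda>m n. 5 * worst B q m n)"
  \<comment> \<open>The exponent multiplies the inner requirement \<open>a\<close> by the degree
    \<open>6 * B + 8\<close> of \<open>memory_bound\<close>, so the words are long enough for all
    numbers of the gadget graph.\<close>
  proof (rule solvableI[where a = "(6 * B + 8) * a" and Pre = "preprocessing_prog B Pre"
        and Upd = "update_prog Upd" and Qry = "Q Qry" and J = J])
    show "(6 * B + 8) * a > 0" using a by simp
  next
    fix w s M assume init: "initial \<Pi>' ((6 * B + 8) * a) w s M"
    obtain n E S where s: "s = vsub n E S" by (cases s)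
    obtain es where ES: "E \<subseteq> all_edges n" "S \<subseteq> {..<n}" "edge_list es E"
      and M: "M = input_mem [n, length es, card S] es (map (\<lambda>v. of_bool (v \<in> S)) [0..<n])"
      using init unfolding initial_def \<Pi>' vsubgraph_input_def s by auto
    have "fits ((6 * B + 8) * a) w n (M 0 0)" using init unfolding initial_def \<Pi>' s by simp
    then have "(n + M 0 0 + 2) ^ ((6 * B + 8) * a) \<le> 2 ^ w" unfolding fits_def .
    moreover have "(n + 2) ^ ((6 * B + 8) * a) \<le> (n + M 0 0 + 2) ^ ((6 * B + 8) * a)"
      by (rule power_mono) auto
    moreover have "memory_bound B n ^ a \<le> ((n + 2) ^ (6 * B + 8)) ^ a"
      using memory_bound_poly by (rule power_mono) simp
    ultimately have mb: "memory_bound B n ^ a \<le> 2 ^ w" by (simp only: power_mult)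
    moreover have "memory_bound B n \<le> memory_bound B n ^ a" using a by (intro self_le_power) (auto simp: memory_bound_def Let_def)
    ultimately have mb1: "memory_bound B n \<le> 2 ^ w" by linarith
    have gc: "gadget_construction n (K n) E S w es"
      unfolding K_def by (rule gadget_constructionI[OF ES(3,1,2) mb1])
    interpret gadget_construction n "K n" E S w es by fact
    have n: "2 * (n + 2) < 2 ^ w" using mb1 unfolding memory_bound_def Let_def by linarith
    let ?R = "\<lambda>N. reachable \<Pi> a w Pre Upd Qry (G n E S) N"
    have P: "\<exists>t N. exec w Pre (edges_mem ((K n + 2) * n) (gadget_edges n (K n) S es vs)) t N \<and>
        real t \<le> worst B p (card E) n \<and> ?R N"
      if vs: "distinct vs" "set vs = covered E" for vs
    proof -
      let ?M = "edges_mem ((K n + 2) * n) (gadget_edges n (K n) S es vs)"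
      have "fits a w (verts \<Pi> (G n E S)) (?M b i)" for b i
        using fits_inner[OF mb] gadget_input_le[OF vs(2,1), of B b i] unfolding \<Pi> G_def K_def by simp
      then have i: "initial \<Pi> a w (G n E S) ?M"
        unfolding initial_def using gadget_input[OF vs(2,1)] by (simp add: \<Pi>(3) G_def)
      then obtain t N where t: "exec w Pre ?M t N" "real t \<le> p (edges \<Pi> (G n E S)) (verts \<Pi> (G n E S))"
        using pre by blast
      moreover have "?R N" using reachable.preprocess[OF i t(1)] .
      ultimately show ?thesis using worst[OF gc, of p] by (meson order_trans)
    qed
    obtain vs where vs: "set vs = covered E" "distinct vs" by (rule covered_list)
    \<comment> \<open>\<open>p\<close> is an arbitrary real function; its relevant value is
      nonnegative because it bounds an actual amount of work.\<close>
    then have nonneg: "0 \<le> worst B p (card E) n" using P[of vs] by (meson of_nat_0_le_iff order_trans)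
    let ?T = "nat \<lfloor>worst B p (card E) n\<rfloor>"
    have "\<exists>t N. exec w Pre (edges_mem ((K n + 2) * n) (gadget_edges n (K n) S es vs)) t N \<and> t \<le> ?T \<and> ?R N"
      if "distinct vs" "set vs = covered E" for vs
      using P[OF that] le_nat_floor by blast
    then have "runs w (preprocessing_prog B Pre) M (lg n * 4 + 10 + length es * (22 * K n + 42) + ?T)
        (\<lambda>M'. ready n (K n) E S M' \<and> ?R (inner M'))"
      by (intro runs_preprocessing[OF M _ n]) (simp_all only: K_def)
    then have "runs w (preprocessing_prog B Pre) M (own (card E) n + ?T)
        (\<lambda>M'. ready n (K n) E S M' \<and> ?R (inner M'))"
      unfolding own_def length_edge_list[OF ES(3)] .
    then have "runs w (preprocessing_prog B Pre) M (own (card E) n + ?T) (J w s)"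
      by (rule runs_mono) (use gc mb s in \<open>auto simp: J_def\<close>)
    moreover have "real (own (card E) n + ?T) \<le> real (own (card E) n) + worst B p (card E) n"
      using nonneg by simp
    ultimately show "\<exists>T. runs w (preprocessing_prog B Pre) M T (J w s) \<and>
        real T \<le> real (own (edges \<Pi>' s) (verts \<Pi>' s)) + worst B p (edges \<Pi>' s) (verts \<Pi>' s)"
      unfolding \<Pi>' s by auto
  next
    fix w s M x s' assume J: "J w s M" and can: "can_update \<Pi>' ((6 * B + 8) * a) w s x s'"
    obtain n E S es where s: "s = vsub n E S"
      and gc: "gadget_construction n (K n) E S w es" and rd: "ready n (K n) E S M"
      and reach: "reachable \<Pi> a w Pre Upd Qry (G n E S) (inner M)" and mb: "memory_bound B n ^ a \<le> 2 ^ w"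
      using J unfolding J_def by blast
    interpret gadget_construction n "K n" E S w es by fact
    have step: "vertex_step (dual_mode D) (vsub n E S) x s'"
      using can unfolding can_update_def \<Pi>' s by blast
    note s' = vertex_stepE[OF step S]
    have gc': "gadget_construction n (K n) E (updated_set x S) w es"
      by unfold_locales (use E s'(3) es bound in auto)
    show "\<exists>T. runs w (update_prog Upd) (put_args (update_args \<Pi>' x) M) T (J w s') \<and>
        real T \<le> 8 * worst B u (edges \<Pi>' s) (verts \<Pi>' s)"
    proof (cases "updated_vertex x \<in> covered E")
      case True
      let ?x = "centre_update n (K n) x"
      have st: "edge_step D (G n E S) ?x (G n E (updated_set x S))"
        unfolding G_def by (rule edge_step_centre_update[OF step _ True]) unfold_locales
      have "y \<le> n + (K n + 2) * n + 2 ^ K n * 2 ^ K n * 2 ^ K n" if "y \<in> set (edge_update_args ?x)" for y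
      proof -
        have "(1 :: nat) \<le> 2 ^ K n * 2 ^ K n * 2 ^ K n" by simp
        then show ?thesis using that s'(2) by (cases x) auto
      qed
      then have can': "can_update \<Pi> a w (G n E S) ?x (G n E (updated_set x S))"
        unfolding can_update_def using st fits'[OF mb] by (simp add: \<Pi>(4,5))
      obtain t N where t: "exec w Upd (put_args (edge_update_args ?x) (inner M)) t N"
        "real t \<le> u (edges \<Pi> (G n E S)) (verts \<Pi> (G n E S))"
        using upd[OF reach can'] unfolding \<Pi>(5) by blast
      have reach': "reachable \<Pi> a w Pre Upd Qry (G n E (updated_set x S)) N"
        using reachable.update[OF reach can'] t(1) unfolding \<Pi>(5) by blast
      have "runs w (update_prog Upd) (put_args (vertex_update_args x) M) (t + 7) (J w s')"
        using runs_update_covered[OF rd refl s'(2) True t(1)]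
        by (rule runs_mono) (use gc' mb s' reach' in \<open>auto simp: J_def\<close>)
      moreover have "real (t + 7) \<le> 8 * worst B u (card E) n"
        using exec_pos[OF t(1)] t(2) worst[OF gc, of u] by simp
      ultimately show ?thesis unfolding \<Pi>' s by auto
    next
      case False
      have x: "\<And>u. x = InsertV u \<Longrightarrow> u \<notin> S" "\<And>u. x = DeleteV u \<Longrightarrow> u \<in> S"
        using step by (auto elim: vertex_step.cases)
      have same: "G n E (updated_set x S) = G n E S"
        unfolding G_def by (rule gadget_graph_uncovered[OF False])
      have "runs w (update_prog Upd) (put_args (vertex_update_args x) M) 7 (J w s')"
        using runs_update_uncovered[OF rd refl s'(2) False x]
        by (rule runs_mono) (use gc' mb s' reach same in \<open>auto simp: J_def\<close>)
      moreover have "1 \<le> worst B u (card E) n"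
      proof -
        \<comment> \<open>With at least three layers the gadget graph has the three vertices that
          \<open>update_work_pos\<close> asks for.\<close>
        have "1 \<le> B * lg n" using B lg_pos[of n] by (simp add: Suc_le_eq)
        then have "3 * 1 \<le> (B * lg n + 2) * n" using s'(2) by (intro mult_le_mono) auto
        then have "1 \<le> u 1 ((B * lg n + 2) * n)"
          using update_work_pos[OF \<Pi> solv] by simp
        then show ?thesis using worst_ge[of 1 B "card E" n u] by (simp add: edge_bound_def)
      qed
      ultimately show ?thesis unfolding \<Pi>' s by auto
    qed
  next
    fix w s M x assume J: "J w s M" and can: "can_query \<Pi>' ((6 * B + 8) * a) w s x"
    obtain n E S es where s: "s = vsub n E S"
      and gc: "gadget_construction n (K n) E S w es" and rd: "ready n (K n) E S M"
      and reach: "reachable \<Pi> a w Pre Upd Qry (G n E S) (inner M)" and mb: "memory_bound B n ^ a \<le> 2 ^ w"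
      using J unfolding J_def by blast
    have "legal_query \<Pi>' (vsub n E S) x" using can unfolding can_query_def s by blast
    moreover have Kn: "B * lg n = K n" by (simp add: K_def)
    ultimately obtain y where y: "legal_query \<Pi> (G n E S) y"
      "\<forall>z \<in> set (query_args \<Pi> y). z \<le> n + 2 ^ K n"
      and run: "\<And>P t N. exec w P (put_args (query_args \<Pi> y) (inner M)) t N \<Longrightarrow>
        answer \<Pi> (G n E S) y (N result_arr 0) \<Longrightarrow>
        runs w (Q P) (put_args (query_args \<Pi>' x) M) (t + 4) (\<lambda>M'. ready n (K n) E S M' \<and>
            inner M' = N \<and> answer \<Pi>' (vsub n E S) x (M' result_arr 0))"
      using query[of n E S w es M x, unfolded Kn, OF gc rd] unfolding G_def by blast
    have "(2 :: nat) ^ K n \<le> 2 ^ K n * 2 ^ K n * 2 ^ K n"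
      using self_le_power[of "2 ^ K n :: nat" 3] by (simp add: power3_eq_cube)
    then have "n + 2 ^ K n \<le> n + (K n + 2) * n + 2 ^ K n * 2 ^ K n * 2 ^ K n" by linarith
    then have "fits a w (verts \<Pi> (G n E S)) z" if "z \<in> set (query_args \<Pi> y)" for z
      using that y(2) fits'[OF mb] order_trans by blast
    then have can': "can_query \<Pi> a w (G n E S) y" unfolding can_query_def using y(1) by blast
    obtain t N where t: "exec w Qry (put_args (query_args \<Pi> y) (inner M)) t N"
      "real t \<le> q (edges \<Pi> (G n E S)) (verts \<Pi> (G n E S))" "answer \<Pi> (G n E S) y (N result_arr 0)"
      using qry[OF reach can'] by blast
    have "reachable \<Pi> a w Pre Upd Qry (G n E S) N" by (rule reachable.query[OF reach can' t(1)])
    then have "runs w (Q Qry) (put_args (query_args \<Pi>' x) M) (t + 4)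
        (\<lambda>M'. J w s M' \<and> answer \<Pi>' s x (M' result_arr 0))"
      by (intro runs_mono[OF run[OF t(1,3)]]) (use gc mb s in \<open>auto simp: J_def\<close>)
    moreover have "real (t + 4) \<le> 5 * worst B q (card E) n"
      using exec_pos[OF t(1)] t(2) worst[OF gc, of q] by simp
    ultimately show "\<exists>T. runs w (Q Qry) (put_args (query_args \<Pi>' x) M) T
        (\<lambda>M'. J w s M' \<and> answer \<Pi>' s x (M' result_arr 0)) \<and>
        real T \<le> 5 * worst B q (edges \<Pi>' s) (verts \<Pi>' s)"
      unfolding \<Pi>' s by auto
  qed
  moreover have "(\<lambda>m n. real (own m n)) \<in> soft_O (\<lambda>m n. real m)"
  proof (rule soft_O_affine[where a = 52 and b = "4 + 22 * real B"])
    fix m n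
    have "real (own m n) = (real (lg n) * 4 + 10) * 1 + real m * (22 * (real B * real (lg n)) + 42)"
      unfolding own_def K_def by simp
    also have "\<dots> \<le> (real (lg n) * 4 + 10) * max 1 (real m) +
        max 1 (real m) * (22 * (real B * real (lg n)) + 42)"
      by (intro add_mono mult_left_mono mult_right_mono) auto
    finally show "real (own m n) \<le> (52 + (4 + 22 * real B) * real (lg n)) * max 1 (real m)"
      by (simp add: algebra_simps)
  qed auto
  then have "(\<lambda>m n. real (own m n) + worst B p m n) \<in> soft_m_plus_comp p"
    using worst_soft_comp[of 1 B p] unfolding soft_m_plus_comp_def by auto
  ultimately show ?thesis
    using worst_soft_comp[of 8 B u] worst_soft_comp[of 5 B q] by auto
qed

lemma SubConn_from_HAC:
  assumes lam: "\<And>n. 2 * lam ((B * lg n + 2) * n) < 2 ^ (B * lg n)" "\<And>n. 1 \<le> lam n" and B: "B > 0"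
    and solv: "solvable (HAC L lam D) p u q"
  shows "\<exists>p' u' q'. solvable (SubConn (dual_mode D)) p' u' q' \<and>
    p' \<in> soft_m_plus_comp p \<and> u' \<in> soft_comp u \<and> q' \<in> soft_comp q"
proof (rule transfer[OF B _ _ _ _ _ _ _ _ _ _ _ solv, where Q = subconn_query])
  fix n E S es w M x
  assume gc: "gadget_construction n (B * lg n) E S w es" and rd: "ready n (B * lg n) E S M"
    and legal: "legal_query (SubConn (dual_mode D)) (vsub n E S) x"
  define k where "k = B * lg n"
  interpret gadget_construction n k E S w es using gc unfolding k_def .
  obtain s t where x: "x = (s, t)" "s < n" "t < n" using legal by (cases x) (simp add: SubConn_def)
  have run: "runs w (subconn_query P) (put_args [s, t] M) (T + 4) (\<lambda>M'. ready n k E S M' \<and>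
      inner M' = N \<and> M' result_arr 0 = of_bool (connected_in (vsub n E S) s t))"
    if P: "exec w P (put_args [s, t, 2 ^ k] (inner M)) T N"
      and \<C>: "hac_result L (lam ((k + 2) * n)) G (real (2 ^ k)) \<C>"
        "N result_arr 0 = of_bool (\<exists>X \<in> \<C>. s \<in> X \<and> t \<in> X)" for P T N \<C>
  proof -
    have "s \<in> S \<and> (\<exists>X \<in> \<C>. s \<in> X \<and> t \<in> X) \<longleftrightarrow> connected_in (vsub n E S) s t"
    proof (cases "s \<in> S")
      case True
      then show ?thesis
        using hac_answer[OF gadget_axioms \<C>(1) _ lam(2) True x(3)] lam(1)[of n] unfolding k_def by simp
    next
      case False
      then show ?thesis by (simp add: connected_in_def)
    qed
    then show ?thesis using runs_subconn_query[OF rd[folded k_def] x(2,3) P \<C>(2)] by simp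
  qed
  show "\<exists>y. legal_query (HAC L lam D) (gadget_graph n (B * lg n) E S) y \<and>
        (\<forall>z \<in> set (query_args (HAC L lam D) y). z \<le> n + 2 ^ (B * lg n)) \<and>
        (\<forall>P T N. exec w P (put_args (query_args (HAC L lam D) y) (inner M)) T N \<longrightarrow>
          answer (HAC L lam D) (gadget_graph n (B * lg n) E S) y (N result_arr 0) \<longrightarrow>
          runs w (subconn_query P) (put_args (query_args (SubConn (dual_mode D)) x) M) (T + 4)
            (\<lambda>M'. ready n (B * lg n) E S M' \<and> inner M' = N \<and>
              answer (SubConn (dual_mode D)) (vsub n E S) x (M' result_arr 0)))"
    unfolding k_def[symmetric]
  proof (intro exI[of _ "(s, t, 2 ^ k)"] conjI allI impI)
    fix P T N
    assume P: "exec w P (put_args (query_args (HAC L lam D) (s, t, 2 ^ k)) (inner M)) T N"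
      and A: "answer (HAC L lam D) G (s, t, 2 ^ k) (N result_arr 0)"
    obtain \<C> where \<C>: "hac_result L (lam ((k + 2) * n)) G (real (2 ^ k)) \<C>"
      "N result_arr 0 = of_bool (\<exists>X \<in> \<C>. s \<in> X \<and> t \<in> X)"
      using A unfolding HAC_def dyn_problem.simps prod.case size_V_gadget by blast
    have "exec w P (put_args [s, t, 2 ^ k] (inner M)) T N" using P by (simp add: HAC_def)
    from run[OF this \<C>] show "runs w (subconn_query P)
      (put_args (query_args (SubConn (dual_mode D)) x) M) (T + 4)
      (\<lambda>M'. ready n k E S M' \<and> inner M' = N \<and>
        answer (SubConn (dual_mode D)) (vsub n E S) x (M' result_arr 0))"
      unfolding x SubConn_def dyn_problem.simps prod.case .
  qed (use x in \<open>auto simp: HAC_def\<close>)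
qed (simp_all add: HAC_def SubConn_def)

lemma ConnSub_from_Num_HAC:
  assumes lam: "\<And>n. 2 * lam ((B * lg n + 2) * n) < 2 ^ (B * lg n)" "\<And>n. 1 \<le> lam n" and B: "B > 0"
    and solv: "solvable (Num_HAC L lam D) p u q"
  shows "\<exists>p' u' q'. solvable (ConnSub (dual_mode D)) p' u' q' \<and>
    p' \<in> soft_m_plus_comp p \<and> u' \<in> soft_comp u \<and> q' \<in> soft_comp q"
proof (rule transfer[OF B _ _ _ _ _ _ _ _ _ _ _ solv, where Q = connsub_query])
  fix n E S es w M x
  assume gc: "gadget_construction n (B * lg n) E S w es" and rd: "ready n (B * lg n) E S M"
  define k where "k = B * lg n"
  interpret gadget_construction n k E S w es using gc unfolding k_def .
  have run: "runs w (connsub_query P) (put_args [] M) (T + 4) (\<lambda>M'. ready n k E S M' \<and>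
      inner M' = N \<and> M' result_arr 0 = of_bool (induced_connected (vsub n E S)))"
    if P: "exec w P (put_args [2 ^ k] (inner M)) T N"
      and \<C>: "hac_result L (lam ((k + 2) * n)) G (real (2 ^ k)) \<C>" "N result_arr 0 = card \<C>" for P T N \<C>
    using runs_connsub_query[OF rd[folded k_def] P] \<C>(2)
      num_hac_answer[OF gadget_axioms \<C>(1) _ lam(2)] lam(1)[of n] unfolding k_def by simp
  show "\<exists>y. legal_query (Num_HAC L lam D) (gadget_graph n (B * lg n) E S) y \<and>
        (\<forall>z \<in> set (query_args (Num_HAC L lam D) y). z \<le> n + 2 ^ (B * lg n)) \<and>
        (\<forall>P T N. exec w P (put_args (query_args (Num_HAC L lam D) y) (inner M)) T N \<longrightarrow>
          answer (Num_HAC L lam D) (gadget_graph n (B * lg n) E S) y (N result_arr 0) \<longrightarrow>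
          runs w (connsub_query P) (put_args (query_args (ConnSub (dual_mode D)) x) M) (T + 4)
            (\<lambda>M'. ready n (B * lg n) E S M' \<and> inner M' = N \<and>
              answer (ConnSub (dual_mode D)) (vsub n E S) x (M' result_arr 0)))"
    unfolding k_def[symmetric]
    by (rule exI[of _ "2 ^ k"]) (use run in \<open>auto simp: Num_HAC_def ConnSub_def\<close>)
qed (simp_all add: Num_HAC_def ConnSub_def)

theorem theorem6p1:
  fixes c :: real and lam :: "nat \<Rightarrow> real" and L :: linkage and D :: dyn_mode
    and p u q :: "nat \<Rightarrow> nat \<Rightarrow> real"
  assumes "c > 0"
    and "\<And>n. lam n \<ge> 1"
    and "lam \<in> O(\<lambda>n. real n powr c)"
  shows "(solvable (HAC L lam D) p u q \<longrightarrow>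
           (\<exists>p' u' q'. solvable (SubConn (dual_mode D)) p' u' q' \<and>
              p' \<in> soft_m_plus_comp p \<and> u' \<in> soft_comp u \<and> q' \<in> soft_comp q)) \<and>
         (solvable (Num_HAC L lam D) p u q \<longrightarrow>
           (\<exists>p' u' q'. solvable (ConnSub (dual_mode D)) p' u' q' \<and>
              p' \<in> soft_m_plus_comp p \<and> u' \<in> soft_comp u \<and> q' \<in> soft_comp q))"
proof -
  obtain d where "\<And>n. lam n \<le> (real n + 2) ^ d"
    using poly_bound[OF assms(3,1)] by blast
  \<comment> \<open>One constant \<open>B\<close> serves all \<open>n\<close>, so it can be built
    into the program.\<close>
  then obtain B where "B > 0" "\<And>n. 2 * lam ((B * lg n + 2) * n) < 2 ^ (B * lg n)"
    using height_exists[of lam d] by blast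
  then show ?thesis
    using SubConn_from_HAC[of lam B L D p u q] ConnSub_from_Num_HAC[of lam B L D p u q] assms(2)
    by blast
qed

end
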